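(* Let $W$ be a positive random variable with $\mathbf{E}[W^4]<\infty$ and $\mathbf{E}[W^2]<\mathbf{E}[W]$. Let $\mathcal{C}_n$ be the cycle-counting point process of the generalised random graph on $n$ vertices with weight distribution that of $W$, and let $\eta$ be a Poisson point process on $\mathbb{N}_{\geq 3}$ with intensity measure given by $\lambda(\{k\})=\lambda_k$, $k\in\mathbb{N}_{\ge 3}$. There exists a constant $C>0$ such that for all $n\geq 3$ and all $A\subseteq\mathbb{N}_{\geq 3}$, $$d_{TV}(\mathcal{C}_n(A),\eta(A))\leq\frac{C\log(n)^3}{n}.$$
   Context: Generalised random graph: for $n\in\mathbb{N}$ the vertex set is $[n]=\{1,\dots,n\}$, the vertices carry i.i.d. weights $W_1,\dots,W_n$ distributed as the positive random variable $W$, and $L_n=\sum_{i=1}^n W_i$. Conditionally on the weights, any two distinct vertices $i,j\in[n]$ are joined by an edge independently with probability $\frac{W_iW_j}{W_iW_j+L_n}$. $\mathbb{N}_{\geq 3}=\{3,4,\dots\}$. For $A\subseteq\mathbb{N}_{\ge 3}$, $\mathcal{C}_n(A)$ is the number of cycles (as subgraphs, each counted once irrespective of starting vertex and orientation) in the graph whose length lies in $A$. For $k\in\mathbb{N}$, $\lambda_k=\frac{1}{2k}\left(\frac{\mathbf{E}[W^2]}{\mathbf{E}[W]}\right)^k$. Thus $\eta(A)$ is Poisson distributed with parameter $\sum_{k\in A}\lambda_k$. For $\mathbb{N}_0$-valued random variables $X,Y$, $d_{TV}(X,Y)=\sup_{B\subseteq\mathbb{N}_0}|\mathbf{P}(X\in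 B)-\mathbf{P}(Y\in B)|$. *)

theory Defs
  imports "HOL-Probability.Probability"
begin

section \<open>The generalised random graph\<close>

text \<open>
  A graph on the vertex set \<open>{1..n}\<close> is represented by its set of edges, an edge being the
  two-element set of its endpoints.
\<close>

definition vertex_pairs :: "nat \<Rightarrow> nat set set" where
  "vertex_pairs n = {{i, j} | i j. i \<in> {1..n} \<and> j \<in> {1..n} \<and> i \<noteq> j}"

definition edge_prob :: "nat \<Rightarrow> (nat \<Rightarrow> real) \<Rightarrow> nat set \<Rightarrow> real" where
  "edge_prob n w e = (\<Prod>i\<in>e. w i) / ((\<Prod>i\<in>e. w i) + (\<Sum>i=1..n. w i))"

lemma edge_prob_pair:
  "i \<noteq> j \<Longrightarrow> edge_prob n w {i, j} = w i * w j / (w i * w j + (\<Sum>i=1..n. w i))"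
  by (simp add: edge_prob_def)

definition grg_given_weights :: "nat \<Rightarrow> (nat \<Rightarrow> real) \<Rightarrow> nat set set pmf" where
  "grg_given_weights n w =
     map_pmf (\<lambda>present. {e \<in> vertex_pairs n. present e})
       (Pi_pmf (vertex_pairs n) False (\<lambda>e. bernoulli_pmf (edge_prob n w e)))"

text \<open>
  The law of the graph: the mixture of the conditional laws over i.i.d. weights
  \<open>W\<^sub>1, \<dots>, W\<^sub>n\<close> with the distribution of \<open>W\<close>.
\<close>

definition grg :: "'a measure \<Rightarrow> ('a \<Rightarrow> real) \<Rightarrow> nat \<Rightarrow> nat set set measure" where
  "grg M W n =
     (\<Pi>\<^sub>M i\<in>{1..n}. distr M borel W) \<bind> (\<lambda>w. measure_pmf (grg_given_weights n w))"

section \<open>Cycle counts\<close>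

definition cycle_edges :: "nat list \<Rightarrow> nat set set" where
  "cycle_edges vs = {{vs ! i, vs ! (Suc i mod length vs)} | i. i < length vs}"

text \<open>
  A cycle, as a subgraph, is identified with its edge set, so that different choices of
  the starting vertex and of the orientation give the same cycle.
\<close>

definition cycles :: "nat set set \<Rightarrow> nat \<Rightarrow> nat set set set" where
  "cycles E k =
     {cycle_edges vs | vs. distinct vs \<and> length vs = k \<and> 3 \<le> k \<and> cycle_edges vs \<subseteq> E}"

definition cycle_count :: "nat set set \<Rightarrow> nat set \<Rightarrow> nat" where
  "cycle_count E A = card (\<Union>k\<in>A. cycles E k)"

section \<open>Poisson point processes\<close>

definition point_process :: "'o measure \<Rightarrow> 'x measure \<Rightarrow> ('o \<Rightarrow> 'x measure) \<Rightarrow> bool" where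
  "point_process P S \<eta> \<longleftrightarrow>
     prob_space P \<and>
     (\<forall>\<omega>\<in>space P. sets (\<eta> \<omega>) = sets S \<and>
        (\<forall>B\<in>sets S. emeasure (\<eta> \<omega>) B \<in> insert \<infinity> (range of_nat))) \<and>
     (\<forall>B\<in>sets S. (\<lambda>\<omega>. emeasure (\<eta> \<omega>) B) \<in> borel_measurable P)"

text \<open>
  The Poisson probabilities are written out because \<^const>\<open>poisson_pmf\<close> requires a strictly
  positive parameter, whereas sets of intensity \<open>0\<close> have to be covered here.
\<close>

definition poisson_point_process ::
    "'o measure \<Rightarrow> 'x measure \<Rightarrow> ('o \<Rightarrow> 'x measure) \<Rightarrow> bool" where
  "poisson_point_process P \<Lambda> \<eta> \<longleftrightarrow>
     point_process P \<Lambda> \<eta> \<and>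
     (\<forall>B\<in>sets \<Lambda>. emeasure \<Lambda> B < \<infinity> \<longrightarrow>
        (\<forall>k::nat. measure P {\<omega> \<in> space P. emeasure (\<eta> \<omega>) B = of_nat k}
                    = measure \<Lambda> B ^ k / fact k * exp (- measure \<Lambda> B))) \<and>
     (\<forall>B\<in>sets \<Lambda>. emeasure \<Lambda> B = \<infinity> \<longrightarrow> (AE \<omega> in P. emeasure (\<eta> \<omega>) B = \<infinity>)) \<and>
     (\<forall>(B :: nat \<Rightarrow> 'x set) m. (\<forall>i<m. B i \<in> sets \<Lambda>) \<and> disjoint_family_on B {..<m} \<longrightarrow>
        prob_space.indep_vars P (\<lambda>_. borel) (\<lambda>i \<omega>. emeasure (\<eta> \<omega>) (B i)) {..<m})"

definition cycle_rate :: "'a measure \<Rightarrow> ('a \<Rightarrow> real) \<Rightarrow> nat \<Rightarrow> real" where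
  "cycle_rate M W k =
     1 / (2 * real k) * ((\<integral>x. (W x)\<^sup>2 \<partial>M) / (\<integral>x. W x \<partial>M)) ^ k"

definition cycle_intensity :: "'a measure \<Rightarrow> ('a \<Rightarrow> real) \<Rightarrow> nat measure" where
  "cycle_intensity M W = point_measure {3..} (\<lambda>k. ennreal (cycle_rate M W k))"

section \<open>Total variation distance\<close>

text \<open>
  The variables are (almost surely) valued in the natural numbers, embedded in \<^typ>\<open>ennreal\<close>
  because this is where the values of a point process live.
\<close>

definition dTV :: "'a measure \<Rightarrow> ('a \<Rightarrow> ennreal) \<Rightarrow> 'b measure \<Rightarrow> ('b \<Rightarrow> ennreal) \<Rightarrow> real" where
  "dTV M X N Y =
     (SUP B :: nat set. \<bar>measure M {x \<in> space M. X x \<in> of_nat ` B}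
                        - measure N {y \<in> space N. Y y \<in> of_nat ` B}\<bar>)"

end

theory Submission
  imports Defs
begin

text \<open>
  Fix the weights \<open>w\<close> and write \<open>L\<close>, \<open>S\<close>, \<open>T\<close> for the sums of \<open>w\<^sub>i\<close>, \<open>w\<^sub>i\<^sup>2\<close>, \<open>w\<^sub>i\<^sup>4\<close> and \<open>R = S / L\<close>.
  Conditionally on the weights the edges are independent, and forcing a cycle \<open>a\<close> to be present
  changes the count by exactly one unless some ear of \<open>a\<close> (a path meeting \<open>a\<close> in its two
  end points only) is present. Interpolating between the count and a Poisson variable by
  thinning, the conditional total variation error is at most a constant times the sum over all
  cycles \<open>a\<close> and ears \<open>g\<close> of \<open>p\<^sub>a p\<^sub>g\<close>, which is \<open>O(T / L\<^sup>2)\<close> as long as \<open>R\<close> stays below some \<open>\<rho> < 1\<close>.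
  The conditional mean count is \<open>\<phi>(R) + O(T / L\<^sup>2)\<close> with \<open>\<phi>(r) = \<Sum>\<^bsub>k\<in>A\<^esub> r\<^sup>k / (2k)\<close>.

  The Poisson probabilities of \<open>\<phi>(R)\<close> and \<open>\<phi>(\<nu>)\<close>, \<open>\<nu> = E[W\<^sup>2] / E[W]\<close>, differ to first order by a
  multiple of \<open>(S - \<nu> L) / n\<close>, which has mean zero; so although \<open>R - \<nu>\<close> is of order \<open>n\<^sup>-\<^sup>1\<^sup>/\<^sup>2\<close>,
  averaging over the weights leaves an error of order \<open>(T + (S - E S)\<^sup>2 + (L - E L)\<^sup>2) / n\<^sup>2\<close>,
  whose mean is \<open>O(1 / n)\<close>. The same quantity bounds, by Chebyshev, the contribution of those
  weights for which \<open>R\<close> is not below \<open>\<rho>\<close>.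
\<close>

section \<open>Random subsets with independent elements\<close>

text \<open>One constant has to serve all \<open>A\<close> and all events. Events are therefore
  replaced by test functions with \<open>\<bar>h m\<bar> \<le> 1\<close>, and every series over
  cycle lengths is dominated by \<open>square_series \<rho>\<close>, which does not involve
  \<open>A\<close>. The derivative of the thinning in \<open>t\<close> is the Stein-Chen expression
  \<open>x * f (x - 1) - s * f x\<close>, where \<open>f\<close> is a bounded function built from
  the differences of \<open>h\<close>; independence turns its mean into a comparison of
  \<open>f\<close> at the count and at the count with a cycle forced, less one. The order
  \<open>T / L\<^sup>2\<close> has two sources: two coinciding vertices in a closed walk, and two
  vertices of a cycle joined by a further edge or path, where Cauchy-Schwarz reduces the squared sum
  of cubes to \<open>S * T\<close>. The linear correction has mean zero only under the full law of
  the weights. It must therefore be the same function of the weights everywhere, and it is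
  subtracted and estimated also where \<open>R\<close> is not below \<open>\<rho>\<close>.\<close>

definition subset_mean :: "'e set \<Rightarrow> ('e \<Rightarrow> real) \<Rightarrow> ('e set \<Rightarrow> real) \<Rightarrow> real" where
  "subset_mean V p F = (\<Sum>G\<in>Pow V. (\<Prod>e\<in>V. if e \<in> G then p e else 1 - p e) * F G)"

lemma subset_mean_sum:
  "subset_mean V p (\<lambda>G. \<Sum>i\<in>I. F i G) = (\<Sum>i\<in>I. subset_mean V p (F i))"
  unfolding subset_mean_def by (simp add: sum_distrib_left sum.swap[of _ _ I])

lemma subset_mean_diff:
  "subset_mean V p (\<lambda>G. F G - H G) = subset_mean V p F - subset_mean V p H"
  unfolding subset_mean_def by (simp add: right_diff_distrib sum_subtractf)

lemma subset_mean_cmult: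
  "subset_mean V p (\<lambda>G. c * F G) = c * subset_mean V p F"
  unfolding subset_mean_def by (simp add: sum_distrib_left mult_ac)

lemma subset_mean_cong:
  "(\<And>G. G \<subseteq> V \<Longrightarrow> F G = H G) \<Longrightarrow> subset_mean V p F = subset_mean V p H"
  unfolding subset_mean_def by (intro sum.cong) auto

lemma subset_mean_mono:
  assumes "\<And>e. e \<in> V \<Longrightarrow> 0 \<le> p e \<and> p e \<le> 1" and "\<And>G. G \<subseteq> V \<Longrightarrow> F G \<le> H G"
  shows "subset_mean V p F \<le> subset_mean V p H"
  unfolding subset_mean_def using assms
  by (intro sum_mono mult_left_mono prod_nonneg) auto

lemma subset_mean_abs_le:
  assumes "\<And>e. e \<in> V \<Longrightarrow> 0 \<le> p e \<and> p e \<le> 1"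
    and "\<And>G. G \<subseteq> V \<Longrightarrow> \<bar>F G\<bar> \<le> H G"
  shows "\<bar>subset_mean V p F\<bar> \<le> subset_mean V p H"
proof -
  have "subset_mean V p F \<le> subset_mean V p H"
    by (intro subset_mean_mono assms(1)) (auto dest: assms(2) simp: abs_le_iff)
  moreover have "subset_mean V p (\<lambda>G. (-1) * F G) \<le> subset_mean V p H"
    by (intro subset_mean_mono assms(1)) (auto dest: assms(2) simp: abs_le_iff)
  ultimately show ?thesis unfolding subset_mean_cmult by linarith
qed

text \<open>Conditioning on whether \<open>e\<close> belongs to the random set:
  \<open>Pow (insert e V)\<close> splits into the subsets of \<open>V\<close> and their images under
  \<open>insert e\<close>.\<close>

lemma subset_mean_insert:
  assumes "finite V" "e \<notin> V"
  shows "subset_mean (insert e V) p F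
         = p e * subset_mean V p (\<lambda>G. F (insert e G)) + (1 - p e) * subset_mean V p F"
proof -
  let ?w = "\<lambda>V G. \<Prod>e\<in>V. if e \<in> G then p e else 1 - p e"
  have inj: "inj_on (insert e) (Pow V)" using assms(2) by (auto simp: inj_on_def)
  have w1: "?w (insert e V) (insert e G) = p e * ?w V G" for G
    using assms by (subst prod.insert) (auto intro!: prod.cong arg_cong2[of _ _ _ _ "(*)"])
  have w2: "?w (insert e V) G = (1 - p e) * ?w V G" if "G \<in> Pow V" for G
    using assms that by (subst prod.insert) auto
  have "subset_mean (insert e V) p F
        = (\<Sum>G\<in>Pow V. ?w (insert e V) G * F G) + (\<Sum>G\<in>insert e ` Pow V. ?w (insert e V) G * F G)"
    unfolding subset_mean_def Pow_insert using assms by (intro sum.union_disjoint) auto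
  also have "(\<Sum>G\<in>insert e ` Pow V. ?w (insert e V) G * F G)
             = p e * subset_mean V p (\<lambda>G. F (insert e G))"
    unfolding subset_mean_def sum_distrib_left sum.reindex[OF inj] o_def w1
    by (simp add: mult_ac)
  also have "(\<Sum>G\<in>Pow V. ?w (insert e V) G * F G) = (1 - p e) * subset_mean V p F"
    unfolding subset_mean_def sum_distrib_left
    by (intro sum.cong) (auto simp: w2[simplified] mult_ac)
  finally show ?thesis by simp
qed

lemma subset_mean_const [simp]: "finite V \<Longrightarrow> subset_mean V p (\<lambda>_. c) = c"
proof (induction V rule: finite_induct)
  case empty
  show ?case by (simp add: subset_mean_def)
next
  case (insert e V)
  then show ?case by (simp add: subset_mean_insert algebra_simps)
qed

lemma subset_mean_force_one:
  assumes "finite V" "e \<in> V"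
  shows "subset_mean V p (\<lambda>G. of_bool (e \<in> G) * F G)
         = p e * subset_mean V p (\<lambda>G. F (insert e G))"
proof -
  define V' where "V' = V - {e}"
  have V: "V = insert e V'" "e \<notin> V'" "finite V'" using assms by (auto simp: V'_def)
  have "subset_mean V' p (\<lambda>G. of_bool (e \<in> G) * F G) = subset_mean V' p (\<lambda>_. 0)"
    using V by (intro subset_mean_cong) auto
  then show ?thesis
    using V by (simp add: subset_mean_insert algebra_simps)
qed

text \<open>By independence, conditioning on \<open>a \<subseteq> G\<close> amounts to adding
  \<open>a\<close> to an unconditioned \<open>G\<close>. This is the coupling behind the Poisson
  approximation.\<close>

lemma subset_mean_force:
  assumes "finite V" "a \<subseteq> V"
  shows "subset_mean V p (\<lambda>G. of_bool (a \<subseteq> G) * F G)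
         = prod p a * subset_mean V p (\<lambda>G. F (G \<union> a))"
proof -
  have "finite a" using assms finite_subset by blast
  then show ?thesis using assms(2)
  proof (induction a arbitrary: F rule: finite_induct)
    case empty
    show ?case by simp
  next
    case (insert e a)
    have "subset_mean V p (\<lambda>G. of_bool (insert e a \<subseteq> G) * F G)
          = subset_mean V p (\<lambda>G. of_bool (e \<in> G) * (of_bool (a \<subseteq> G) * F G))"
      by (intro subset_mean_cong) auto
    also have "\<dots> = p e * subset_mean V p (\<lambda>G. of_bool (a \<subseteq> insert e G) * F (insert e G))"
      using insert.prems assms(1) by (subst subset_mean_force_one) auto
    also have "subset_mean V p (\<lambda>G. of_bool (a \<subseteq> insert e G) * F (insert e G))
               = subset_mean V p (\<lambda>G. of_bool (a \<subseteq> G) * F (insert e G))"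
      using insert.hyps by (intro subset_mean_cong) (auto simp: subset_insert)
    finally show ?case
      using insert by (simp add: Un_insert_right mult_ac)
  qed
qed

lemma subset_mean_superset:
  assumes "finite V" "a \<subseteq> V"
  shows "subset_mean V p (\<lambda>G. of_bool (a \<subseteq> G)) = prod p a"
  using subset_mean_force[OF assms, of p "\<lambda>_. 1"] assms(1) by simp

section \<open>Poisson expectations\<close>

text \<open>The expectation of \<open>h\<close> under the Poisson law with mean \<open>s\<close>.
  For bounded \<open>h\<close> it is an entire function of \<open>s\<close>, so it makes sense and
  can be differentiated at \<open>s = 0\<close> too, where its value is \<open>h 0\<close>.\<close>

definition poisson_mean :: "(nat \<Rightarrow> real) \<Rightarrow> real \<Rightarrow> real" where
  "poisson_mean h s = (\<Sum>m. h m / fact m * s ^ m) * exp (- s)"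

lemma summable_poisson:
  assumes "\<And>m. \<bar>h m\<bar> \<le> K"
  shows "summable (\<lambda>m. h m / fact m * (s::real) ^ m)"
proof (rule summable_comparison_test')
  show "summable (\<lambda>m. K * (\<bar>s\<bar> ^ m / fact m))"
    using summable_exp[of "\<bar>s\<bar>"] by (intro summable_mult) (simp add: field_simps)
  show "norm (h m / fact m * s ^ m) \<le> K * (\<bar>s\<bar> ^ m / fact m)" for m
    using mult_right_mono[OF assms[of m], of "\<bar>s\<bar> ^ m / fact m"]
    by (simp add: abs_mult power_abs)
qed

definition shift_diff :: "(nat \<Rightarrow> real) \<Rightarrow> nat \<Rightarrow> real" where
  "shift_diff h m = h (Suc m) - h m"

lemma shift_diff_abs_le:
  assumes "\<And>m. \<bar>h m\<bar> \<le> K"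
  shows "\<bar>shift_diff h m\<bar> \<le> 2 * K"
  using assms[of m] assms[of "Suc m"] unfolding shift_diff_def by linarith

lemma poisson_mean_abs_le:
  assumes "\<And>m. \<bar>h m\<bar> \<le> K" "0 \<le> s"
  shows "\<bar>poisson_mean h s\<bar> \<le> K"
proof -
  have e: "(\<lambda>m. K * (s ^ m / fact m)) sums (K * exp s)"
    using exp_converges[of s] by (intro sums_mult) (simp add: divide_inverse mult.commute)
  have le: "norm (h m / fact m * s ^ m) \<le> K * (s ^ m / fact m)" for m
    using mult_right_mono[OF assms(1)[of m], of "s ^ m / fact m"] assms(2)
    by (simp add: abs_mult power_abs)
  have "norm (\<Sum>m. h m / fact m * s ^ m) \<le> (\<Sum>m. K * (s ^ m / fact m))"
    using e le by (intro norm_suminf_le) (auto simp: sums_iff)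
  then have "\<bar>\<Sum>m. h m / fact m * s ^ m\<bar> \<le> K * exp s"
    using e by (simp add: sums_iff)
  then show ?thesis
    unfolding poisson_mean_def by (simp add: abs_mult exp_minus field_simps)
qed

text \<open>Differentiating the series replaces \<open>h m\<close> by \<open>h (Suc m)\<close>, and
  differentiating \<open>exp (- s)\<close> subtracts the original. The derivative is again a Poisson
  expectation and so inherits uniform bounds.\<close>

lemma poisson_mean_deriv:
  assumes h: "\<And>m. \<bar>h m\<bar> \<le> K"
  shows "(poisson_mean h has_real_derivative poisson_mean (shift_diff h) s) (at s)"
proof -
  let ?c = "\<lambda>m. h m / fact m"
  have d: "diffs ?c m = h (Suc m) / fact m" for m
    unfolding diffs_def fact_Suc by (simp del: of_nat_Suc)
  have "((\<lambda>s. \<Sum>m. ?c m * s ^ m) has_real_derivative (\<Sum>m. diffs ?c m * s ^ m)) (at s)"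
    using summable_poisson[OF h] by (rule termdiffs_strong_converges_everywhere)
  then have "(poisson_mean h has_real_derivative
       (\<Sum>m. diffs ?c m * s ^ m) * exp (-s) - (\<Sum>m. ?c m * s ^ m) * exp (-s)) (at s)"
    unfolding poisson_mean_def[abs_def] by (auto intro!: derivative_eq_intros)
  also have "(\<Sum>m. diffs ?c m * s ^ m) * exp (-s) - (\<Sum>m. ?c m * s ^ m) * exp (-s)
             = ((\<Sum>m. h (Suc m) / fact m * s ^ m) - (\<Sum>m. h m / fact m * s ^ m)) * exp (-s)"
    unfolding d by (simp add: algebra_simps)
  also have "(\<Sum>m. h (Suc m) / fact m * s ^ m) - (\<Sum>m. h m / fact m * s ^ m)
             = (\<Sum>m. h (Suc m) / fact m * s ^ m - h m / fact m * s ^ m)"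
    using summable_poisson[of "\<lambda>m. h (Suc m)", OF h] summable_poisson[of h, OF h]
    by (rule suminf_diff)
  also have "(\<Sum>m. h (Suc m) / fact m * s ^ m - h m / fact m * s ^ m) * exp (-s)
             = poisson_mean (shift_diff h) s"
    unfolding poisson_mean_def shift_diff_def by (simp add: diff_divide_distrib left_diff_distrib)
  finally show ?thesis .
qed

text \<open>The mean value theorem applied twice; each \<open>shift_diff\<close> at most doubles the
  uniform bound, hence \<open>4 * K\<close>.\<close>

lemma poisson_mean_taylor:
  assumes h: "\<And>m. \<bar>h m\<bar> \<le> K" and "0 \<le> s" "0 \<le> t"
  shows "\<bar>poisson_mean h t - poisson_mean h s - (t - s) * poisson_mean (shift_diff h) s\<bar>
         \<le> 4 * K * (t - s)\<^sup>2"
proof -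
  have d1: "\<bar>shift_diff h m\<bar> \<le> 2 * K" for m using shift_diff_abs_le[of h, OF h] .
  have d2: "\<bar>shift_diff (shift_diff h) m\<bar> \<le> 4 * K" for m
    using shift_diff_abs_le[of "shift_diff h", OF d1] by simp
  \<comment> \<open>The mean value theorem without an ordering of \<open>a\<close> and
    \<open>b\<close>. The intermediate point stays nonnegative, where Poisson expectations are
    bounded.\<close>
  have mvt: "\<exists>z. 0 \<le> z \<and> \<bar>z - a\<bar> \<le> \<bar>b - a\<bar> \<and>
        poisson_mean g b - poisson_mean g a = (b - a) * poisson_mean (shift_diff g) z"
    if g: "\<And>m. \<bar>g m\<bar> \<le> K'" and ab: "0 \<le> a" "0 \<le> b" for g K' a b
  proof -
    consider "a = b" | "a < b" | "b < a" by linarith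
    then show ?thesis
    proof cases
      case 1
      then show ?thesis using ab by auto
    next
      case 2
      from MVT2[OF this, of "poisson_mean g" "poisson_mean (shift_diff g)"]
        poisson_mean_deriv[of g, OF g]
      obtain z where "a < z" "z < b"
        "poisson_mean g b - poisson_mean g a = (b - a) * poisson_mean (shift_diff g) z" by blast
      then show ?thesis using ab by (intro exI[of _ z]) auto
    next
      case 3
      from MVT2[OF this, of "poisson_mean g" "poisson_mean (shift_diff g)"]
        poisson_mean_deriv[of g, OF g]
      obtain z where "b < z" "z < a"
        "poisson_mean g a - poisson_mean g b = (a - b) * poisson_mean (shift_diff g) z" by blast
      then show ?thesis using ab by (intro exI[of _ z]) (auto simp: algebra_simps)
    qed
  qed
  obtain z where z: "0 \<le> z" "\<bar>z - s\<bar> \<le> \<bar>t - s\<bar>"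
    "poisson_mean h t - poisson_mean h s = (t - s) * poisson_mean (shift_diff h) z"
    using mvt[of h K s t] h assms(2,3) by blast
  obtain y where y: "0 \<le> y"
    "poisson_mean (shift_diff h) z - poisson_mean (shift_diff h) s
     = (z - s) * poisson_mean (shift_diff (shift_diff h)) y"
    using mvt[of "shift_diff h" "2 * K" s z] d1 assms(2) z(1) by blast
  have "poisson_mean h t - poisson_mean h s - (t - s) * poisson_mean (shift_diff h) s
        = (t - s) * ((z - s) * poisson_mean (shift_diff (shift_diff h)) y)"
    unfolding z(3) y(2)[symmetric] by (simp add: algebra_simps)
  also have "\<bar>\<dots>\<bar> = \<bar>t - s\<bar> * (\<bar>z - s\<bar> * \<bar>poisson_mean (shift_diff (shift_diff h)) y\<bar>)"
    by (simp add: abs_mult)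
  also have "\<dots> \<le> \<bar>t - s\<bar> * (\<bar>t - s\<bar> * (4 * K))"
    using z(2) poisson_mean_abs_le[of "shift_diff (shift_diff h)", OF d2 y(1)] by (intro mult_left_mono mult_mono) auto
  also have "\<dots> = 4 * K * (t - s)\<^sup>2"
    by (simp add: power2_eq_square)
  finally show ?thesis .
qed

section \<open>Poisson approximation by thinning\<close>

text \<open>
  \<open>thinned_mean s x h t\<close> is the mean of \<open>h\<close> at \<open>Bin(x, t) + Poi((1 - t) s)\<close>, which interpolates
  between \<open>Poi(s)\<close> at \<open>t = 0\<close> and the constant \<open>x\<close> at \<open>t = 1\<close>.
\<close>

primrec thinned_mean :: "real \<Rightarrow> nat \<Rightarrow> (nat \<Rightarrow> real) \<Rightarrow> real \<Rightarrow> real" where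
  "thinned_mean s 0 h t = poisson_mean h ((1 - t) * s)"
| "thinned_mean s (Suc x) h t
     = (1 - t) * thinned_mean s x h t + t * thinned_mean s x (\<lambda>m. h (Suc m)) t"

lemma thinned_mean_0: "thinned_mean s x h 0 = poisson_mean h s"
  by (induction x arbitrary: h) auto

lemma thinned_mean_1: "thinned_mean s x h 1 = h x"
proof (induction x arbitrary: h)
  case 0
  show ?case using powser_zero[of "\<lambda>m. h m / fact m"] by (simp add: poisson_mean_def)
qed simp

lemma thinned_mean_abs_le:
  assumes "\<And>m. \<bar>h m\<bar> \<le> K" "0 \<le> s" "0 \<le> t" "t \<le> 1"
  shows "\<bar>thinned_mean s x h t\<bar> \<le> K"
  using assms(1)
proof (induction x arbitrary: h)
  case 0
  then show ?case using assms by (auto intro!: poisson_mean_abs_le)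
next
  case (Suc x)
  have "\<bar>thinned_mean s (Suc x) h t\<bar>
        \<le> (1 - t) * \<bar>thinned_mean s x h t\<bar> + t * \<bar>thinned_mean s x (\<lambda>m. h (Suc m)) t\<bar>"
    using assms(3,4) by (auto intro!: order_trans[OF abs_triangle_ineq] simp: abs_mult)
  also have "\<dots> \<le> (1 - t) * K + t * K"
    using assms(3,4) Suc by (intro add_mono mult_left_mono) auto
  finally show ?case by (simp add: algebra_simps)
qed

lemma poisson_mean_diff:
  assumes "\<And>m. \<bar>h m\<bar> \<le> K" "\<And>m. \<bar>g m\<bar> \<le> K'"
  shows "poisson_mean (\<lambda>m. g m - h m) s = poisson_mean g s - poisson_mean h s"
proof -
  have "(\<Sum>m. (g m - h m) / fact m * s ^ m) = (\<Sum>m. g m / fact m * s ^ m) - (\<Sum>m. h m / fact m * s ^ m)"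
    using suminf_diff[OF summable_poisson[of g, OF assms(2)] summable_poisson[of h, OF assms(1)], of s s]
    by (simp only: diff_divide_distrib left_diff_distrib)
  then show ?thesis unfolding poisson_mean_def by (simp only: left_diff_distrib)
qed

lemma thinned_mean_diff:
  assumes "\<And>m. \<bar>h m\<bar> \<le> K" "\<And>m. \<bar>g m\<bar> \<le> K'"
  shows "thinned_mean s x (\<lambda>m. g m - h m) t = thinned_mean s x g t - thinned_mean s x h t"
  using assms
proof (induction x arbitrary: h g)
  case 0
  then show ?case using poisson_mean_diff[of h K g K'] by simp
next
  case (Suc x)
  have "thinned_mean s x (\<lambda>m. g m - h m) t = thinned_mean s x g t - thinned_mean s x h t"
    "thinned_mean s x (\<lambda>m. g (Suc m) - h (Suc m)) t
     = thinned_mean s x (\<lambda>m. g (Suc m)) t - thinned_mean s x (\<lambda>m. h (Suc m)) t"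
    using Suc.IH[of h g] Suc.IH[of "\<lambda>m. h (Suc m)" "\<lambda>m. g (Suc m)"] Suc.prems by auto
  then show ?case by (simp only: thinned_mean.simps right_diff_distrib)
qed

text \<open>By the product rule each of the \<open>x\<close> coins contributes the thinned mean of
  \<open>shift_diff h\<close> over the other \<open>x - 1\<close> coins, and the Poisson part
  contributes the term with \<open>- s\<close>. With
  \<open>f x = thinned_mean s x (shift_diff h) t\<close> this is
  \<open>x * f (x - 1) - s * f x\<close>, whose mean vanishes if \<open>x\<close> is Poisson with
  mean \<open>s\<close>.\<close>

lemma thinned_mean_deriv:
  assumes "\<And>m. \<bar>h m\<bar> \<le> K"
  shows "(thinned_mean s x h has_real_derivative
           real x * thinned_mean s (x - 1) (shift_diff h) t - s * thinned_mean s x (shift_diff h) t)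
         (at t)"
  using assms
proof (induction x arbitrary: h)
  case 0
  have "((\<lambda>t. poisson_mean h ((1 - t) * s)) has_real_derivative
           poisson_mean (shift_diff h) ((1 - t) * s) * (- s)) (at t)"
    by (rule DERIV_chain2[OF poisson_mean_deriv[of h, OF 0]]) (auto intro!: derivative_eq_intros)
  then show ?case by (simp add: mult.commute)
next
  case (Suc x)
  let ?h = "\<lambda>m. h (Suc m)"
  let ?d = "shift_diff h"
  have sd: "shift_diff ?h = (\<lambda>m. ?d (Suc m))" by (auto simp: shift_diff_def)
  have 1: "thinned_mean s x ?h t - thinned_mean s x h t = thinned_mean s x ?d t"
    unfolding shift_diff_def[abs_def] using Suc.prems
    by (subst thinned_mean_diff[of h K ?h K]) auto
  \<comment> \<open>One coin is split off \<open>thinned_mean s x\<close>. For \<open>x = 0\<close>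
    the truncated \<open>x - 1\<close> is harmless because of the factor
    \<open>real x\<close>.\<close>
  have 2: "real x * ((1 - t) * thinned_mean s (x - 1) ?d t
             + t * thinned_mean s (x - 1) (shift_diff ?h) t) = real x * thinned_mean s x ?d t"
    by (cases x) (auto simp: sd)
  have "(thinned_mean s (Suc x) h has_real_derivative
      (1 - t) * (real x * thinned_mean s (x - 1) ?d t - s * thinned_mean s x ?d t)
      - thinned_mean s x h t
      + (thinned_mean s x ?h t
         + t * (real x * thinned_mean s (x - 1) (shift_diff ?h) t - s * thinned_mean s x (shift_diff ?h) t)))
      (at t)"
    unfolding thinned_mean.simps(2)[abs_def]
    using Suc.IH[of h] Suc.IH[of ?h] Suc.prems by (auto intro!: derivative_eq_intros)
  also have "(1 - t) * (real x * thinned_mean s (x - 1) ?d t - s * thinned_mean s x ?d t)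
      - thinned_mean s x h t
      + (thinned_mean s x ?h t
         + t * (real x * thinned_mean s (x - 1) (shift_diff ?h) t - s * thinned_mean s x (shift_diff ?h) t))
      = real (Suc x) * thinned_mean s x ?d t - s * thinned_mean s (Suc x) ?d t"
    using 1 2 unfolding thinned_mean.simps(2) sd by (simp add: algebra_simps)
  finally show ?case by simp
qed

lemma subset_mean_deriv:
  assumes "\<And>G. (F G has_real_derivative F' G) (at t)"
  shows "((\<lambda>t. subset_mean V p (\<lambda>G. F G t)) has_real_derivative subset_mean V p F') (at t)"
  unfolding subset_mean_def by (intro DERIV_sum DERIV_cmult assms)

text \<open>
  The sets in \<open>ear a\<close> certify that forcing \<open>a\<close> to be present does more than adding \<open>a\<close> itself
  to the count.
\<close>

lemma subset_count_poisson_approx: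
  fixes p :: "'e \<Rightarrow> real" and \<C> :: "'e set set" and ear :: "'e set \<Rightarrow> 'e set set"
  defines "X \<equiv> \<lambda>G. card {a \<in> \<C>. a \<subseteq> G}"
  assumes V: "finite V" and p: "\<And>e. e \<in> V \<Longrightarrow> 0 \<le> p e \<and> p e \<le> 1"
    and C: "\<C> \<subseteq> Pow V"
    and ear: "\<And>a. a \<in> \<C> \<Longrightarrow> finite (ear a)" "\<And>a g. a \<in> \<C> \<Longrightarrow> g \<in> ear a \<Longrightarrow> g \<subseteq> V"
    and no_ear: "\<And>a G. a \<in> \<C> \<Longrightarrow> G \<subseteq> V \<Longrightarrow> \<not> (\<exists>g\<in>ear a. g \<subseteq> G) \<Longrightarrow> X (G \<union> a) = Suc (X G)"
    and h: "\<And>m. \<bar>h m\<bar> \<le> K"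
  shows "\<bar>subset_mean V p (\<lambda>G. h (X G)) - poisson_mean h (\<Sum>a\<in>\<C>. prod p a)\<bar>
         \<le> 4 * K * (\<Sum>a\<in>\<C>. prod p a * (\<Sum>g\<in>ear a. prod p g))"
proof -
  define s where "s = (\<Sum>a\<in>\<C>. prod p a)"
  \<comment> \<open>At \<open>t = 1\<close> this is the mean of \<open>h (X G)\<close> and at
    \<open>t = 0\<close> the Poisson mean, so it suffices to bound the derivative at a single
    \<open>t\<close>.\<close>
  define F where "F = (\<lambda>t. subset_mean V p (\<lambda>G. thinned_mean s (X G) h t))"
  let ?d = "shift_diff h"
  define F' where "F' = (\<lambda>t. subset_mean V p (\<lambda>G. real (X G) * thinned_mean s (X G - 1) ?d t
                               - s * thinned_mean s (X G) ?d t))"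
  have finC: "finite \<C>" using C V finite_subset by blast
  have p0: "0 \<le> prod p a" if "a \<subseteq> V" for a using that p by (intro prod_nonneg) auto
  have s0: "0 \<le> s" unfolding s_def using C p0 by (intro sum_nonneg) auto
  have K: "0 \<le> K" using h[of 0] by simp
  have "(F has_real_derivative F' t) (at t)" for t
    unfolding F_def F'_def by (rule subset_mean_deriv, rule thinned_mean_deriv[of h, OF h])
  then have "\<exists>t>0. t < 1 \<and> F 1 - F 0 = (1 - 0) * F' t" by (intro MVT2) auto
  then obtain t where t: "0 < t" "t < 1" "F 1 - F 0 = F' t" by (metis diff_zero mult_1)
  define f where "f = (\<lambda>x. thinned_mean s x ?d t)"
  have f: "\<bar>f x\<bar> \<le> 2 * K" for x
    unfolding f_def using t s0 shift_diff_abs_le[of h, OF h] by (intro thinned_mean_abs_le) auto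
  have X: "real (X G) = (\<Sum>a\<in>\<C>. of_bool (a \<subseteq> G))" for G
    unfolding X_def using finC by (simp add: of_bool_def sum.If_cases Int_def)
  have "F' t = subset_mean V p (\<lambda>G. (\<Sum>a\<in>\<C>. of_bool (a \<subseteq> G) * f (X G - 1)) - s * f (X G))"
    unfolding F'_def f_def X by (simp add: sum_distrib_right)
  \<comment> \<open>Each indicator of \<open>a \<subseteq> G\<close> is traded for the factor
    \<open>prod p a\<close> and a forced copy of \<open>a\<close>; \<open>s\<close> is the sum of
    the same factors, so the two sums can be compared term by term.\<close>
  also have "\<dots> = (\<Sum>a\<in>\<C>. prod p a * subset_mean V p (\<lambda>G. f (X (G \<union> a) - 1)))
                  - (\<Sum>a\<in>\<C>. prod p a * subset_mean V p (\<lambda>G. f (X G)))"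
    unfolding subset_mean_diff subset_mean_sum subset_mean_cmult s_def sum_distrib_right
    using C V by (intro arg_cong2[of _ _ _ _ "(-)"] sum.cong) (auto intro!: subset_mean_force)
  also have "\<dots> = (\<Sum>a\<in>\<C>. prod p a * subset_mean V p (\<lambda>G. f (X (G \<union> a) - 1) - f (X G)))"
    unfolding subset_mean_diff by (simp add: sum_subtractf right_diff_distrib)
  finally have eq: "F' t = \<dots>" .
  have one: "\<bar>subset_mean V p (\<lambda>G. f (X (G \<union> a) - 1) - f (X G))\<bar> \<le> 4 * K * (\<Sum>g\<in>ear a. prod p g)"
    if a: "a \<in> \<C>" for a
  proof -
    have "\<bar>subset_mean V p (\<lambda>G. f (X (G \<union> a) - 1) - f (X G))\<bar>
          \<le> subset_mean V p (\<lambda>G. 4 * K * (\<Sum>g\<in>ear a. of_bool (g \<subseteq> G)))"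
    proof (intro subset_mean_abs_le p)
      fix G assume G: "G \<subseteq> V"
      show "\<bar>f (X (G \<union> a) - 1) - f (X G)\<bar> \<le> 4 * K * (\<Sum>g\<in>ear a. of_bool (g \<subseteq> G))"
      \<comment> \<open>Without an ear \<open>X (G \<union> a) - 1 = X G\<close> and the difference
        vanishes; otherwise it is at most \<open>4 * K\<close>, and at least one ear is counted on
        the right.\<close>
      proof (cases "\<exists>g\<in>ear a. g \<subseteq> G")
        case False
        with no_ear[OF a G] K show ?thesis by (simp add: sum_nonneg)
      next
        case True
        then obtain g where g: "g \<in> ear a" "g \<subseteq> G" by auto
        have "1 \<le> (\<Sum>g\<in>ear a. of_bool (g \<subseteq> G) :: real)"
          using member_le_sum[OF g(1), of "\<lambda>g. of_bool (g \<subseteq> G) :: real"] g(2) ear(1)[OF a] by simp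
        from mult_left_mono[OF this, of "4 * K"] f[of "X (G \<union> a) - 1"] f[of "X G"] K
        show ?thesis by linarith
      qed
    qed auto
    also have "\<dots> = 4 * K * (\<Sum>g\<in>ear a. prod p g)"
      unfolding subset_mean_cmult subset_mean_sum
      using V ear(2)[OF a] by (intro arg_cong2[of _ _ _ _ "(*)"] sum.cong refl subset_mean_superset) auto
    finally show ?thesis .
  qed
  have "\<bar>F' t\<bar> \<le> (\<Sum>a\<in>\<C>. prod p a * (4 * K * (\<Sum>g\<in>ear a. prod p g)))"
    unfolding eq
  proof (intro order_trans[OF sum_abs] sum_mono)
    fix a assume a: "a \<in> \<C>"
    have "0 \<le> prod p a" using p0 C a by auto
    then show "\<bar>prod p a * subset_mean V p (\<lambda>G. f (X (G \<union> a) - 1) - f (X G))\<bar>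
          \<le> prod p a * (4 * K * (\<Sum>g\<in>ear a. prod p g))"
      using one[OF a] by (auto simp: abs_mult intro!: mult_left_mono)
  qed
  also have "\<dots> = 4 * K * (\<Sum>a\<in>\<C>. prod p a * (\<Sum>g\<in>ear a. prod p g))"
    by (simp add: sum_distrib_left mult_ac)
  finally have "\<bar>F 1 - F 0\<bar> \<le> \<dots>" unfolding t(3) .
  then show ?thesis
    using V unfolding F_def by (simp add: thinned_mean_0 thinned_mean_1 s_def)
qed

section \<open>Paths and cycles\<close>

fun path_edges :: "nat list \<Rightarrow> nat set set" where
  "path_edges (x # y # zs) = insert {x, y} (path_edges (y # zs))"
| "path_edges _ = {}"

lemma path_edges_append:
  "path_edges (xs @ y # zs) = path_edges (xs @ [y]) \<union> path_edges (y # zs)"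
  by (induction xs rule: path_edges.induct) (cases zs; auto)+

lemma path_edges_rev: "path_edges (rev xs) = path_edges xs"
proof (induction xs rule: path_edges.induct)
  case (1 x y zs)
  have "path_edges (rev (x # y # zs)) = path_edges (rev (y # zs)) \<union> {{x, y}}"
    using path_edges_append[of "rev zs" y "[x]"] by (auto simp: insert_commute)
  with 1 show ?case by simp
qed auto

lemma path_edges_conv_nth: "path_edges xs = {{xs ! i, xs ! Suc i} | i. Suc i < length xs}"
proof (induction xs rule: path_edges.induct)
  case (1 x y zs)
  have "{{(x # y # zs) ! i, (x # y # zs) ! Suc i} | i. Suc i < length (x # y # zs)}
        = insert {x, y} {{(y # zs) ! i, (y # zs) ! Suc i} | i. Suc i < length (y # zs)}"
    (is "?L = ?R")
  proof
    show "?L \<subseteq> ?R"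
    proof
      fix e assume "e \<in> ?L"
      then obtain i where "Suc i < length (x # y # zs)" "e = {(x # y # zs) ! i, (x # y # zs) ! Suc i}"
        by blast
      then show "e \<in> ?R" by (cases i) auto
    qed
    show "?R \<subseteq> ?L" by (force intro: exI[of _ 0] exI[of _ "Suc _"])
  qed
  with 1 show ?case by simp
qed auto

lemma path_edges_subset_Pow: "e \<in> path_edges xs \<Longrightarrow> e \<subseteq> set xs"
  by (induction xs rule: path_edges.induct) auto

lemma finite_path_edges [simp]: "finite (path_edges xs)"
  by (induction xs rule: path_edges.induct) auto

text \<open>As the interior of an ear avoids the cycle, this shows that an ear with nonempty
  interior shares no edge with the cycle.\<close>

lemma path_edge_meets_interior:
  "xs \<noteq> [] \<Longrightarrow> e \<in> path_edges (u # xs @ [v]) \<Longrightarrow> e \<inter> set xs \<noteq> {}"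
proof (induction xs arbitrary: u)
  case (Cons x xs)
  then show ?case by (cases "xs = []") fastforce+
qed simp

text \<open>Repeating the start vertex at the end removes the index modulo the length, so that facts
  about paths proved by list induction carry over to cycles.\<close>

lemma cycle_edges_conv_path: "cycle_edges (a # r) = path_edges (a # r @ [a])"
proof -
  have "{(a # r) ! i, (a # r) ! (Suc i mod length (a # r))} = {(a # r @ [a]) ! i, (a # r @ [a]) ! Suc i}"
    if "i < length (a # r)" for i
  proof (cases "i = length r")
    case True
    then show ?thesis by (auto simp: nth_append nth_Cons')
  next
    case False
    with that have "i < length r" by simp
    then show ?thesis by (auto simp: nth_append nth_Cons')
  qed
  moreover have "length (a # r @ [a]) = Suc (length (a # r))" by simp
  ultimately show ?thesis unfolding cycle_edges_def path_edges_conv_nth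
    by (metis (no_types, lifting) Suc_less_eq)
qed

section \<open>Closed lists up to rotation and reflection\<close>

lemma cycle_edges_rotate: "cycle_edges (xs @ ys) = cycle_edges (ys @ xs)"
proof (cases "xs = [] \<or> ys = []")
  case False
  then obtain a p b q where [simp]: "xs = a # p" "ys = b # q" by (auto simp: neq_Nil_conv)
  show ?thesis
    using path_edges_append[of "a # p" b "q @ [a]"] path_edges_append[of "b # q" a "p @ [b]"]
    by (auto simp: cycle_edges_conv_path)
qed auto

lemma cycle_edges_reflect: "cycle_edges (a # rev r) = cycle_edges (a # r)"
  using path_edges_rev[of "a # r @ [a]"] by (simp add: cycle_edges_conv_path)

lemma rotate_to_element:
  assumes "x \<in> set xs"
  obtains r where "cycle_edges (x # r) = cycle_edges xs" "set (x # r) = set xs"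
    "length (x # r) = length xs" "distinct xs \<Longrightarrow> distinct (x # r)"
proof -
  obtain p q where "xs = p @ x # q" using assms by (auto dest: split_list)
  then show ?thesis
    using that[of "q @ p"] cycle_edges_rotate[of p "x # q"] by auto
qed

section \<open>Degrees in a cycle\<close>

definition nbrs :: "nat set set \<Rightarrow> nat \<Rightarrow> nat set" where
  "nbrs E a = {b. {a, b} \<in> E}"

lemma nbrs_cycle_edges:
  assumes "distinct (a # r)" "2 \<le> length r"
  shows "nbrs (cycle_edges (a # r)) a = {hd r, last r}" "hd r \<noteq> last r"
proof -
  obtain b p c where r: "r = b # p @ [c]"
    using assms(2) by (cases r; cases "tl r" rule: rev_cases) auto
  have "path_edges (a # r @ [a]) = insert {a, b} (insert {c, a} (path_edges r))"
    unfolding r using path_edges_append[of "b # p" c "[a]"] by auto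
  moreover have "{a, y} \<notin> path_edges r" for y
    using path_edges_subset_Pow[of "{a, y}" r] assms(1) by auto
  ultimately show "nbrs (cycle_edges (a # r)) a = {hd r, last r}"
    by (auto simp: nbrs_def cycle_edges_conv_path r doubleton_eq_iff)
  show "hd r \<noteq> last r" using assms(1) by (auto simp: r)
qed

lemma card_nbrs_cycle:
  assumes "distinct xs" "3 \<le> length xs" "a \<in> set xs"
  shows "card (nbrs (cycle_edges xs) a) = 2"
proof -
  obtain r where r: "cycle_edges (a # r) = cycle_edges xs" "length (a # r) = length xs" "distinct (a # r)"
    using rotate_to_element[OF assms(3)] assms(1) by metis
  then have "2 \<le> length r" using assms(2) by simp
  from nbrs_cycle_edges[OF r(3) this] show ?thesis unfolding r(1) by simp
qed

lemma Union_cycle_edges: "xs \<noteq> [] \<Longrightarrow> \<Union> (cycle_edges xs) = set xs"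
proof -
  assume "xs \<noteq> []"
  then obtain a r where xs: "xs = a # r" by (cases xs) auto
  have U: "\<Union> (path_edges (x # y # zs)) = insert x (insert y (set zs))" for x y zs
    by (induction zs arbitrary: x y) auto
  show ?thesis
    unfolding xs cycle_edges_conv_path by (cases r) (auto simp: U simp del: path_edges.simps)
qed

lemma cycle_edges_pair:
  assumes "distinct xs" "2 \<le> length xs" "e \<in> cycle_edges xs"
  obtains a b where "e = {a, b}" "a \<noteq> b" "a \<in> set xs" "b \<in> set xs"
proof -
  obtain i where i: "i < length xs" "e = {xs ! i, xs ! (Suc i mod length xs)}"
    using assms(3) by (auto simp: cycle_edges_def)
  have "Suc i mod length xs \<noteq> i"
    using i(1) assms(2) by (auto simp: mod_Suc split: if_splits)
  moreover have lt: "Suc i mod length xs < length xs" using i(1) by (intro mod_less_divisor) auto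
  ultimately have "xs ! i \<noteq> xs ! (Suc i mod length xs)"
    using i(1) assms(1) nth_eq_iff_index_eq by metis
  then show ?thesis using that[of "xs ! i" "xs ! (Suc i mod length xs)"] i lt by auto
qed

text \<open>Two positions carrying the same edge would be each other's cyclic successors, which is
  impossible from length three on.\<close>

lemma cycle_edges_inj:
  assumes "distinct xs" "3 \<le> length xs" "i < length xs" "j < length xs"
    and "{xs ! i, xs ! (Suc i mod length xs)} = {xs ! j, xs ! (Suc j mod length xs)}"
  shows "i = j"
proof (rule ccontr)
  assume ne: "i \<noteq> j"
  let ?k = "length xs"
  have "?k > 0" using assms(2) by linarith
  then have lt: "Suc i mod ?k < ?k" "Suc j mod ?k < ?k" by auto
  have "i = Suc j mod ?k \<and> j = Suc i mod ?k"
    using assms(1,3-5) ne lt by (auto simp: doubleton_eq_iff nth_eq_iff_index_eq)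
  moreover have "Suc i mod ?k = (if Suc i = ?k then 0 else Suc i)"
    "Suc j mod ?k = (if Suc j = ?k then 0 else Suc j)"
    using assms(3,4) by auto
  ultimately have "i = (if Suc j = ?k then 0 else Suc j)" "j = (if Suc i = ?k then 0 else Suc i)" by metis+
  then have "i = 0 \<and> Suc j = ?k \<or> i = Suc j" "j = 0 \<and> Suc i = ?k \<or> j = Suc i" by meson+
  then show False using assms(2) by (elim disjE conjE) linarith+
qed

lemma prod_cycle_edges:
  assumes "distinct xs" "3 \<le> length xs"
  shows "prod f (cycle_edges xs) = (\<Prod>i<length xs. f {xs ! i, xs ! (Suc i mod length xs)})"
proof -
  have "cycle_edges xs = (\<lambda>i. {xs ! i, xs ! (Suc i mod length xs)}) ` {..<length xs}"
    by (auto simp: cycle_edges_def)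
  moreover have "inj_on (\<lambda>i. {xs ! i, xs ! (Suc i mod length xs)}) {..<length xs}"
    using cycle_edges_inj[OF assms] by (auto intro!: inj_onI)
  ultimately show ?thesis by (simp add: prod.reindex)
qed

lemma card_cycle_edges:
  assumes "distinct xs" "3 \<le> length xs"
  shows "card (cycle_edges xs) = length xs"
  using prod_cycle_edges[OF assms, of "\<lambda>_. 2 :: nat"] by simp

text \<open>Both cycles are 2-regular, and the larger one is connected.\<close>

lemma cycle_edges_subset_eq:
  assumes xs: "distinct xs" "3 \<le> length xs" and ys: "distinct ys" "3 \<le> length ys"
    and sub: "cycle_edges ys \<subseteq> cycle_edges xs"
  shows "cycle_edges ys = cycle_edges xs"
proof -
  have fin: "finite (nbrs (cycle_edges zs) a)" for zs a
    by (rule finite_subset[of _ "\<Union> (cycle_edges zs)"]) (auto simp: nbrs_def cycle_edges_def)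
  have V: "set ys \<subseteq> set xs"
    using sub Union_cycle_edges[of ys] Union_cycle_edges[of xs] xs ys by fastforce
  \<comment> \<open>Both neighbourhoods have two elements, so the inclusion is an equality.\<close>
  have nb: "nbrs (cycle_edges ys) a = nbrs (cycle_edges xs) a" if "a \<in> set ys" for a
    using that V sub card_nbrs_cycle[OF xs, of a] card_nbrs_cycle[OF ys, of a] fin
    by (intro card_subset_eq) (auto simp: nbrs_def)
  have step: "b \<in> set ys \<and> {a, b} \<in> cycle_edges ys" if "a \<in> set ys" "{a, b} \<in> cycle_edges xs" for a b
  proof -
    have "{a, b} \<in> cycle_edges ys" using nb[OF that(1)] that(2) by (auto simp: nbrs_def)
    then show ?thesis using Union_cycle_edges[of ys] ys by fastforce
  qed
  have "hd ys \<in> set xs" using V ys by (cases ys) auto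
  then obtain r where r: "cycle_edges (hd ys # r) = cycle_edges xs"
    using rotate_to_element by metis
  \<comment> \<open>A walk along edges of the larger cycle that starts in \<open>ys\<close> uses
    only edges of \<open>ys\<close> and never leaves its vertices.\<close>
  have "path_edges zs \<subseteq> cycle_edges ys"
    if "path_edges zs \<subseteq> cycle_edges xs" "zs \<noteq> [] \<Longrightarrow> hd zs \<in> set ys" for zs
    using that
  proof (induction zs rule: path_edges.induct)
    case (1 x y zs)
    then show ?case using step[of x y] by auto
  qed auto
  from this[of "hd ys # r @ [hd ys]"] r sub ys show ?thesis
    by (cases ys) (auto simp: cycle_edges_conv_path)
qed

subsection \<open>Each cycle of length $k$ is traversed by exactly $2k$ lists\<close>

text \<open>Start vertex and direction determine the list: the entry after a vertex is the neighbour
  that differs from the entry before it.\<close>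

lemma cycle_edges_eqI:
  assumes "distinct (a # b # p)" "distinct (a # b # q)"
    and "cycle_edges (a # b # p) = cycle_edges (a # b # q)" "length p = length q" "p \<noteq> []"
  shows "p = q"
proof -
  let ?xs = "a # b # p" and ?ys = "a # b # q"
  \<comment> \<open>Two consecutive entries are carried through the induction, since the next entry
    depends on both.\<close>
  have "?xs ! i = ?ys ! i \<and> ?xs ! Suc i = ?ys ! Suc i" if "Suc i < length ?xs" for i
    using that
  proof (induction i)
    case 0
    then show ?case by simp
  next
    case (Suc i)
    let ?x = "?xs ! Suc i"
    have nb: "nbrs (cycle_edges zs) (zs ! Suc i) = {zs ! Suc (Suc i), zs ! i}"
      "zs ! Suc (Suc i) \<noteq> zs ! i"
      if zs: "distinct zs" "length zs = length ?xs" for zs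
    proof -
      let ?t = "drop (Suc (Suc i)) zs" and ?h = "take (Suc i) zs"
      have len: "Suc (Suc i) < length zs" using Suc.prems zs by simp
      have split: "zs = ?h @ zs ! Suc i # ?t"
        using id_take_nth_drop[of "Suc i" zs] len by simp
      have ne: "?t \<noteq> []" "?h \<noteq> []" using len by auto
      \<comment> \<open>Rotation brings \<open>zs ! Suc i\<close> to the front, where its neighbours
        are the first and the last element of the remaining list.\<close>
      have "distinct (zs ! Suc i # ?t @ ?h)"
        using zs(1) split by (metis distinct_append distinct_rotate rotate_append append_Cons)
      moreover have "2 \<le> length (?t @ ?h)" using len by simp
      ultimately have "nbrs (cycle_edges (zs ! Suc i # ?t @ ?h)) (zs ! Suc i)
          = {hd (?t @ ?h), last (?t @ ?h)}" "hd (?t @ ?h) \<noteq> last (?t @ ?h)"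
        using nbrs_cycle_edges by blast+
      moreover have "cycle_edges (zs ! Suc i # ?t @ ?h) = cycle_edges zs"
        using cycle_edges_rotate[of ?h "zs ! Suc i # ?t"] split by simp
      moreover have "hd (?t @ ?h) = zs ! Suc (Suc i)" using ne len by (simp add: hd_drop_conv_nth)
      moreover have "last (?t @ ?h) = zs ! i" using len by (simp add: take_Suc_conv_app_nth)
      ultimately show "nbrs (cycle_edges zs) (zs ! Suc i) = {zs ! Suc (Suc i), zs ! i}"
        "zs ! Suc (Suc i) \<noteq> zs ! i" by simp_all
    qed
    have IH: "?xs ! i = ?ys ! i" "?xs ! Suc i = ?ys ! Suc i" using Suc by simp_all
    have "{?xs ! Suc (Suc i), ?xs ! i} = {?ys ! Suc (Suc i), ?ys ! i}"
      using nb(1)[of ?xs] nb(1)[of ?ys] assms IH by simp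
    then have "?xs ! Suc (Suc i) = ?ys ! Suc (Suc i)"
      using nb(2)[of ?xs] nb(2)[of ?ys] assms IH unfolding doubleton_eq_iff by metis
    with IH show ?case by simp
  qed
  then have "?xs ! i = ?ys ! i" if "i < length ?xs" for i
    using that by (cases i) auto
  then have "?xs = ?ys" using assms(4) by (intro nth_equalityI) auto
  then show ?thesis by simp
qed

text \<open>A list is determined by its first two entries, and these can be any vertex of the cycle
  followed by either of its two neighbours.\<close>

lemma card_cycle_lists:
  assumes xs: "distinct xs" "3 \<le> length xs"
  defines "fiber \<equiv> {ys. distinct ys \<and> length ys = length xs \<and> cycle_edges ys = cycle_edges xs}"
  shows "card fiber = 2 * length xs"
proof -
  let ?f = "\<lambda>ys :: nat list. (ys ! 0, ys ! 1)"
  have shape: "\<exists>a b p. ys = a # b # p \<and> p \<noteq> []" if "length ys = length xs" for ys :: "nat list"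
    using that xs(2) by (cases ys; cases "tl ys"; cases "tl (tl ys)") auto
  have set_eq: "set ys = set xs" if "ys \<in> fiber" for ys
    using that Union_cycle_edges[of ys] Union_cycle_edges[of xs] xs(2) unfolding fiber_def
    by fastforce
  have inj: "inj_on ?f fiber"
  proof (rule inj_onI)
    fix us vs assume us: "us \<in> fiber" and vs: "vs \<in> fiber" and eq: "?f us = ?f vs"
    obtain a b p where 1: "us = a # b # p" "p \<noteq> []" using shape us unfolding fiber_def by blast
    obtain c d q where 2: "vs = c # d # q" using shape vs unfolding fiber_def by blast
    show "us = vs" using us vs eq cycle_edges_eqI[of a b p q] unfolding fiber_def 1 2
      by (simp add: 1)
  qed
  have im: "?f ` fiber = Sigma (set xs) (nbrs (cycle_edges xs))"
  proof
    show "?f ` fiber \<subseteq> Sigma (set xs) (nbrs (cycle_edges xs))"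
    proof clarsimp
      fix ys assume ys: "ys \<in> fiber"
      obtain a b p where 1: "ys = a # b # p" using shape ys unfolding fiber_def by blast
      have "{a, b} \<in> cycle_edges ys" by (simp add: 1 cycle_edges_conv_path)
      then show "ys ! 0 \<in> set xs \<and> ys ! Suc 0 \<in> nbrs (cycle_edges xs) (ys ! 0)"
        using ys set_eq[OF ys] by (auto simp: 1 nbrs_def fiber_def)
    qed
    show "Sigma (set xs) (nbrs (cycle_edges xs)) \<subseteq> ?f ` fiber"
    proof clarify
      fix a b assume a: "a \<in> set xs" and b: "b \<in> nbrs (cycle_edges xs) a"
      obtain r where r: "cycle_edges (a # r) = cycle_edges xs" "length (a # r) = length xs"
        "distinct (a # r)"
        using rotate_to_element[OF a] xs(1) by metis
      have r2: "2 \<le> length r" using r(2) xs(2) by simp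
      then have ne: "r \<noteq> []" by auto
      \<comment> \<open>One neighbour comes second in the given orientation, the other in the
        reversed one.\<close>
      from nbrs_cycle_edges[OF r(3) r2] b r(1) consider "b = hd r" | "b = last r" by auto
      then show "(a, b) \<in> ?f ` fiber"
      proof cases
        case 1
        then show ?thesis using r ne
          by (intro image_eqI[of _ _ "a # r"]) (auto simp: fiber_def hd_conv_nth)
      next
        case 2
        then show ?thesis using r ne
          by (intro image_eqI[of _ _ "a # rev r"])
             (auto simp: fiber_def cycle_edges_reflect last_conv_nth rev_nth)
      qed
    qed
  qed
  have "card fiber = card (Sigma (set xs) (nbrs (cycle_edges xs)))"
    using card_image[OF inj] im by simp
  also have "\<dots> = (\<Sum>a\<in>set xs. card (nbrs (cycle_edges xs) a))"
    using card_nbrs_cycle[OF xs] by (intro card_SigmaI) (auto intro: card_ge_0_finite)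
  also have "\<dots> = 2 * length xs"
    using card_nbrs_cycle[OF xs] distinct_card[OF xs(1)] by simp
  finally show ?thesis .
qed

subsection \<open>Ears\<close>

text \<open>
  Single edges of the cycle itself count as ears, so that a graph without ears of \<open>a\<close> does not
  contain \<open>a\<close>.
\<close>

definition ear_paths :: "nat set \<Rightarrow> nat set \<Rightarrow> nat list set" where
  "ear_paths U S = {u # xs @ [v] | u v xs. u \<in> S \<and> v \<in> S \<and> u \<noteq> v \<and> distinct xs \<and>
                      set xs \<subseteq> U - S}"

definition ears :: "nat set \<Rightarrow> nat set set \<Rightarrow> nat set set set" where
  "ears U a = path_edges ` ear_paths U (\<Union> a)"

text \<open>On a list starting in \<open>S\<close>, let \<open>b\<close> be the first vertex outside
  \<open>S\<close>; rotating puts its predecessor \<open>a\<close>, which is still in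
  \<open>S\<close>, at the front.\<close>

lemma rotate_to_exit:
  assumes "x \<in> set xs \<inter> S" "y \<in> set xs - S"
  obtains a b r where "cycle_edges (a # b # r) = cycle_edges xs" "set (a # b # r) = set xs"
    "length (a # b # r) = length xs"
    "distinct xs \<Longrightarrow> distinct (a # b # r)" "a \<in> S" "b \<notin> S"
proof -
  obtain q where q: "cycle_edges (x # q) = cycle_edges xs" "set (x # q) = set xs"
    "length (x # q) = length xs" "distinct xs \<Longrightarrow> distinct (x # q)"
    using rotate_to_element[of x xs] assms(1) by blast
  have "\<exists>z\<in>set (x # q). z \<notin> S" using q(2) assms(2) by auto
  then obtain p b r where p: "x # q = p @ b # r" "b \<notin> S" "\<forall>z\<in>set p. \<not> z \<notin> S"
    using split_list_first_prop[of "x # q" "\<lambda>z. z \<notin> S"] by blast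
  have "p \<noteq> []" using p(1,2) assms(1) by (cases p) auto
  then obtain p' a where a: "p = p' @ [a]" by (meson rev_exhaust)
  have "cycle_edges (a # b # r @ p') = cycle_edges (x # q)"
    using cycle_edges_rotate[of p' "a # b # r"] p(1) a by simp
  moreover have "set (a # b # r @ p') = set (x # q)" "length (a # b # r @ p') = length (x # q)"
    "distinct (a # b # r @ p') \<longleftrightarrow> distinct (x # q)"
    unfolding p(1) a by auto
  ultimately show ?thesis
    using q p(2,3) a that[of a b "r @ p'"] by simp
qed

text \<open>If the second cycle stays on the vertices of the first, it has an edge that the first
  lacks, which is a chord. Otherwise it leaves these vertices, and the excursion up to the first
  return is an ear. In both cases the edges found are not on the first cycle and hence lie in
  \<open>G\<close>.\<close>

lemma cycle_contains_ear:
  assumes xs: "distinct xs" "3 \<le> length xs" and ys: "distinct ys" "3 \<le> length ys"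
    and G: "cycle_edges ys \<subseteq> G \<union> cycle_edges xs" "\<not> cycle_edges ys \<subseteq> G"
    and ne: "cycle_edges ys \<noteq> cycle_edges xs" and U: "set ys \<subseteq> U"
  shows "\<exists>g\<in>ears U (cycle_edges xs). g \<subseteq> G"
proof -
  have Un: "\<Union> (cycle_edges xs) = set xs" using xs by (intro Union_cycle_edges) auto
  show ?thesis
  proof (cases "set ys \<subseteq> set xs")
    case True
    have "\<not> cycle_edges ys \<subseteq> cycle_edges xs"
      using cycle_edges_subset_eq[OF xs ys] ne by blast
    then obtain e where e: "e \<in> cycle_edges ys" "e \<notin> cycle_edges xs" by blast
    from cycle_edges_pair[OF ys(1) _ e(1)] ys(2) obtain a b
      where ab: "e = {a, b}" "a \<noteq> b" "a \<in> set ys" "b \<in> set ys" by auto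
    have "[a, b] \<in> ear_paths U (set xs)"
      unfolding ear_paths_def using ab True by (auto intro!: exI[of _ "[]"])
    moreover have "path_edges [a, b] \<subseteq> G" using e ab G(1) by auto
    ultimately show ?thesis unfolding ears_def Un by blast
  next
    case False
    then obtain y where y: "y \<in> set ys - set xs" by blast
    obtain e where e: "e \<in> cycle_edges ys" "e \<in> cycle_edges xs" using G by blast
    from cycle_edges_pair[OF ys(1) _ e(1)] ys(2) obtain c d
      where cd: "e = {c, d}" "c \<noteq> d" "c \<in> set ys" "d \<in> set ys" by auto
    have cd': "c \<in> set xs" "d \<in> set xs" using e(2) cd(1) Un by blast+
    obtain a b r where r: "cycle_edges (a # b # r) = cycle_edges ys" "set (a # b # r) = set ys"
       "distinct (a # b # r)" "a \<in> set xs" "b \<notin> set xs"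
      using rotate_to_exit[of c ys "set xs" y] y cd cd' ys(1) by (metis IntI)
    \<comment> \<open>At least one of the two common vertices \<open>c\<close> and \<open>d\<close>
      differs from \<open>a\<close>, so the excursion returns, and by distinctness at a vertex other
      than \<open>a\<close>.\<close>
    have "\<exists>z\<in>set (b # r). z \<in> set xs"
      using cd cd' r(2) by (metis set_ConsD)
    then obtain p v q where p: "b # r = p @ v # q" "v \<in> set xs" "\<forall>z\<in>set p. z \<notin> set xs"
      using split_list_first_prop[of "b # r" "\<lambda>z. z \<in> set xs"] by blast
    have pne: "p \<noteq> []" using p r(5) by (cases p) auto
    have "set (a # b # r) = set (a # p @ v # q)" "distinct (a # p @ v # q)"
      using r(3) unfolding p(1)[symmetric] by simp_all
    then have "a # p @ [v] \<in> ear_paths U (set xs)"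
      unfolding ear_paths_def using r(2,4) p U by auto
    moreover have "path_edges (a # p @ [v]) \<subseteq> G"
    proof
      fix e assume e: "e \<in> path_edges (a # p @ [v])"
      then have "e \<notin> cycle_edges xs"
        using path_edge_meets_interior[OF pne e] p(3) Un by blast
      moreover have "cycle_edges (a # b # r) = path_edges ((a # p) @ v # q @ [a])"
        unfolding p(1) cycle_edges_conv_path by simp
      then have "e \<in> cycle_edges ys"
        using e r(1) unfolding path_edges_append[of "a # p" v "q @ [a]"] by simp
      ultimately show "e \<in> G" using G(1) by blast
    qed
    ultimately show ?thesis unfolding ears_def Un by blast
  qed
qed

subsection \<open>Cycles of the complete graph\<close>

definition all_cycles :: "nat \<Rightarrow> nat set \<Rightarrow> nat set set set" where
  "all_cycles n A = (\<Union>k\<in>A. cycles (vertex_pairs n) k)"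

definition cycle_lists :: "nat \<Rightarrow> nat \<Rightarrow> nat list set" where
  "cycle_lists n k = {xs. distinct xs \<and> length xs = k \<and> set xs \<subseteq> {1..n}}"

lemma finite_vertex_pairs [simp]: "finite (vertex_pairs n)"
  by (rule finite_subset[of _ "Pow {1..n}"]) (auto simp: vertex_pairs_def)

lemma cycle_edges_subset_vertex_pairs:
  assumes "distinct xs" "3 \<le> length xs"
  shows "cycle_edges xs \<subseteq> vertex_pairs n \<longleftrightarrow> set xs \<subseteq> {1..n}"
proof
  assume "cycle_edges xs \<subseteq> vertex_pairs n"
  then have "\<Union> (cycle_edges xs) \<subseteq> {1..n}" unfolding vertex_pairs_def by force
  moreover have "xs \<noteq> []" using assms(2) by auto
  ultimately show "set xs \<subseteq> {1..n}" using Union_cycle_edges[of xs] by simp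
next
  assume "set xs \<subseteq> {1..n}"
  moreover have "2 \<le> length xs" using assms by simp
  ultimately show "cycle_edges xs \<subseteq> vertex_pairs n"
    using assms(1) unfolding vertex_pairs_def by (blast elim: cycle_edges_pair)
qed

lemma cycles_vertex_pairs:
  "cycles (vertex_pairs n) k = (if 3 \<le> k then cycle_edges ` cycle_lists n k else {})"
  unfolding cycles_def cycle_lists_def using cycle_edges_subset_vertex_pairs[of _ n] by auto

lemma cycle_count_conv:
  assumes "E \<subseteq> vertex_pairs n"
  shows "cycle_count E A = card {a \<in> all_cycles n A. a \<subseteq> E}"
proof -
  have "(\<Union>k\<in>A. cycles E k) = {a \<in> all_cycles n A. a \<subseteq> E}"
    unfolding all_cycles_def cycles_def using assms by blast
  then show ?thesis by (simp add: cycle_count_def)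
qed

lemma all_cycles_subset: "all_cycles n A \<subseteq> Pow (vertex_pairs n)"
  by (auto simp: all_cycles_def cycles_def)

lemma all_cyclesE:
  assumes "a \<in> all_cycles n A"
  obtains xs where "a = cycle_edges xs" "distinct xs" "3 \<le> length xs" "length xs \<in> A" "set xs \<subseteq> {1..n}"
  using assms by (auto simp: all_cycles_def cycles_vertex_pairs cycle_lists_def split: if_splits)

lemma finite_cycle_lists [simp]: "finite (cycle_lists n k)"
  by (rule finite_subset[OF _ finite_lists_length_eq[of "{1..n}" k]]) (auto simp: cycle_lists_def)

lemma cycle_lists_empty: "n < k \<Longrightarrow> cycle_lists n k = {}"
proof -
  have "length xs \<le> n" if "xs \<in> cycle_lists n k" for xs
    using that card_mono[of "{1..n}" "set xs"] distinct_card[of xs] by (simp add: cycle_lists_def)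
  moreover assume "n < k"
  ultimately show ?thesis by (fastforce simp: cycle_lists_def)
qed

text \<open>Cycles are grouped by length, which is the number of their edges and at most
  \<open>n\<close>; the sum over lists counts each cycle of length \<open>k\<close> exactly
  \<open>2 * k\<close> times.\<close>

lemma sum_all_cycles:
  fixes f :: "nat set set \<Rightarrow> real"
  assumes "A \<subseteq> {3..}"
  shows "sum f (all_cycles n A)
         = (\<Sum>k\<in>A \<inter> {..n}. (\<Sum>xs\<in>cycle_lists n k. f (cycle_edges xs)) / (2 * real k))"
proof -
  have A: "3 \<le> k" if "k \<in> A \<inter> {..n}" for k using that assms by auto
  have "all_cycles n A = (\<Union>k\<in>A \<inter> {..n}. cycle_edges ` cycle_lists n k)"
    (is "_ = ?R")
  proof -
    have "cycles (vertex_pairs n) k = (if k \<le> n then cycle_edges ` cycle_lists n k else {})"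
      if "k \<in> A" for k
      using that assms by (auto simp: cycles_vertex_pairs cycle_lists_empty)
    then have "all_cycles n A = (\<Union>k\<in>A. if k \<le> n then cycle_edges ` cycle_lists n k else {})"
      unfolding all_cycles_def by (intro SUP_cong) auto
    also have "\<dots> = ?R" by (auto split: if_splits)
    finally show ?thesis .
  qed
  then have eq: "sum f (all_cycles n A) = (\<Sum>k\<in>A \<inter> {..n}. sum f (cycle_edges ` cycle_lists n k))"
  proof (simp only:, intro sum.UNION_disjoint ballI impI)
    fix k l assume kl: "k \<in> A \<inter> {..n}" "l \<in> A \<inter> {..n}" "k \<noteq> l"
    have "card a = k" if "a \<in> cycle_edges ` cycle_lists n k" "3 \<le> k" for a k
      using that card_cycle_edges by (auto simp: cycle_lists_def)
    then show "cycle_edges ` cycle_lists n k \<inter> cycle_edges ` cycle_lists n l = {}"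
      using kl A by blast
  qed auto
  have fiber: "sum f (cycle_edges ` cycle_lists n k)
             = (\<Sum>xs\<in>cycle_lists n k. f (cycle_edges xs)) / (2 * real k)" if "3 \<le> k" for k
  proof -
    have "(\<Sum>xs\<in>cycle_lists n k. f (cycle_edges xs))
          = (\<Sum>a\<in>cycle_edges ` cycle_lists n k. \<Sum>xs\<in>{xs \<in> cycle_lists n k. cycle_edges xs = a}. f (cycle_edges xs))"
      by (rule sum.image_gen) simp
    also have "\<dots> = (\<Sum>a\<in>cycle_edges ` cycle_lists n k. 2 * real k * f a)"
    proof (intro sum.cong refl)
      fix a assume "a \<in> cycle_edges ` cycle_lists n k"
      then obtain ys where ys: "a = cycle_edges ys" "distinct ys" "length ys = k" "set ys \<subseteq> {1..n}"
        by (auto simp: cycle_lists_def)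
      have "{xs \<in> cycle_lists n k. cycle_edges xs = a}
            = {xs. distinct xs \<and> length xs = length ys \<and> cycle_edges xs = cycle_edges ys}"
      proof -
        have "set xs \<subseteq> {1..n}" if "length xs = length ys" "cycle_edges xs = cycle_edges ys" for xs
        proof -
          have "xs \<noteq> []" "ys \<noteq> []" using that ys(3) \<open>3 \<le> k\<close> by auto
          then have "set xs = set ys"
            using Union_cycle_edges[of xs] Union_cycle_edges[of ys] that by simp
          then show ?thesis using ys(4) by simp
        qed
        then show ?thesis using ys unfolding cycle_lists_def by auto
      qed
      then have "card {xs \<in> cycle_lists n k. cycle_edges xs = a} = 2 * k"
        using card_cycle_lists[of ys] ys that by simp
      then show "(\<Sum>xs\<in>{xs \<in> cycle_lists n k. cycle_edges xs = a}. f (cycle_edges xs)) = 2 * real k * f a"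
        by simp
    qed
    finally show ?thesis using that by (simp add: sum_distrib_left[symmetric])
  qed
  show ?thesis unfolding eq using A by (intro sum.cong refl fiber) blast
qed

lemma finite_ear_paths: "finite U \<Longrightarrow> finite S \<Longrightarrow> finite (ear_paths U S)"
proof -
  assume fin: "finite U" "finite S"
  have "ear_paths U S \<subseteq> (\<lambda>(u, v, xs). u # xs @ [v]) ` (S \<times> S \<times> {xs. set xs \<subseteq> U \<and> distinct xs})"
    by (force simp: ear_paths_def)
  then show ?thesis
    using fin finite_subset_distinct[of U] by (auto intro: finite_subset)
qed

lemma ears_subset_vertex_pairs:
  assumes "S \<subseteq> {1..n}" "ys \<in> ear_paths {1..n} S"
  shows "path_edges ys \<subseteq> vertex_pairs n"
proof -
  obtain u v xs where ys: "ys = u # xs @ [v]" "u \<in> S" "v \<in> S" "u \<noteq> v" "distinct xs"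
    "set xs \<subseteq> {1..n} - S" using assms(2) by (auto simp: ear_paths_def)
  have d: "distinct ys" "set ys \<subseteq> {1..n}" using ys assms(1) by auto
  show ?thesis
  proof
    fix e assume "e \<in> path_edges ys"
    then obtain i where i: "Suc i < length ys" "e = {ys ! i, ys ! Suc i}"
      by (auto simp: path_edges_conv_nth)
    moreover have "ys ! i \<noteq> ys ! Suc i" using d(1) i by (simp add: nth_eq_iff_index_eq)
    moreover have "ys ! i \<in> {1..n}" "ys ! Suc i \<in> {1..n}"
      using d(2) i(1) nth_mem[of i ys] nth_mem[of "Suc i" ys] by (meson Suc_lessD subsetD)+
    ultimately show "e \<in> vertex_pairs n" unfolding vertex_pairs_def by blast
  qed
qed

text \<open>By \<open>cycle_contains_ear\<close> every cycle in \<open>G \<union> a\<close> other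
  than \<open>a\<close> lies in \<open>G\<close> already, while \<open>a\<close> itself does not:
  \<open>a\<close> is the only new cycle.\<close>

lemma cycle_count_no_ear:
  assumes a: "a \<in> all_cycles n A" and G: "G \<subseteq> vertex_pairs n"
    and no: "\<not> (\<exists>g\<in>ears {1..n} a. g \<subseteq> G)"
  shows "card {b \<in> all_cycles n A. b \<subseteq> G \<union> a} = Suc (card {b \<in> all_cycles n A. b \<subseteq> G})"
proof -
  obtain xs where xs: "a = cycle_edges xs" "distinct xs" "3 \<le> length xs" using all_cyclesE[OF a] by metis
  have "\<not> a \<subseteq> G"
  proof
    assume "a \<subseteq> G"
    obtain u v r where uv: "xs = u # v # r" using xs(3) by (cases xs; cases "tl xs") auto
    have "[u, v] \<in> ear_paths {1..n} (\<Union> a)"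
      using Union_cycle_edges[of xs] xs(1,2) unfolding ear_paths_def
      by (auto simp: uv intro!: exI[of _ "[]"])
    moreover have "path_edges [u, v] \<subseteq> G"
      using \<open>a \<subseteq> G\<close> by (simp add: xs(1) uv cycle_edges_conv_path)
    ultimately show False using no unfolding ears_def by blast
  qed
  moreover have "b = a \<or> b \<subseteq> G" if b: "b \<in> all_cycles n A" "b \<subseteq> G \<union> a" for b
  proof -
    obtain ys where ys: "b = cycle_edges ys" "distinct ys" "3 \<le> length ys" "set ys \<subseteq> {1..n}"
      using all_cyclesE[OF b(1)] by metis
    show ?thesis
      using cycle_contains_ear[OF xs(2,3) ys(2,3), of G "{1..n}"] b(2) ys no unfolding xs(1) by blast
  qed
  ultimately have "{b \<in> all_cycles n A. b \<subseteq> G \<union> a} = insert a {b \<in> all_cycles n A. b \<subseteq> G}"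
    "a \<notin> {b \<in> all_cycles n A. b \<subseteq> G}" using a by blast+
  moreover have "finite (all_cycles n A)"
    using all_cycles_subset finite_vertex_pairs by (metis finite_Pow_iff finite_subset)
  ultimately show ?thesis by simp
qed

section \<open>Sums over lists of vertices\<close>

text \<open>The distributive law: expanding the product of sums gives one term for each
  list.\<close>

lemma sum_lists_prod:
  fixes g :: "nat \<Rightarrow> 'b \<Rightarrow> real"
  assumes "finite U"
  shows "(\<Sum>xs | set xs \<subseteq> U \<and> length xs = k. \<Prod>i<k. g i (xs ! i)) = (\<Prod>i<k. \<Sum>x\<in>U. g i x)"
proof (induction k arbitrary: g)
  case 0
  have "{xs :: 'b list. set xs \<subseteq> U \<and> length xs = 0} = {[]}" by auto
  then show ?case by simp
next
  case (Suc k)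
  let ?L = "{xs. set xs \<subseteq> U \<and> length xs = k}"
  have "{xs. set xs \<subseteq> U \<and> length xs = Suc k} = (\<lambda>(x, xs). x # xs) ` (U \<times> ?L)"
    by (auto simp: length_Suc_conv image_iff)
  moreover have "inj_on (\<lambda>(x, xs). x # xs) (U \<times> ?L)" by (auto simp: inj_on_def)
  ultimately have "(\<Sum>xs | set xs \<subseteq> U \<and> length xs = Suc k. \<Prod>i<Suc k. g i (xs ! i))
      = (\<Sum>(x, xs)\<in>U \<times> ?L. g 0 x * (\<Prod>i<k. g (Suc i) (xs ! i)))"
    by (simp add: sum.reindex prod.lessThan_Suc_shift case_prod_unfold del: prod.lessThan_Suc)
  also have "\<dots> = (\<Sum>x\<in>U. g 0 x) * (\<Sum>xs\<in>?L. \<Prod>i<k. g (Suc i) (xs ! i))"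
    by (simp add: sum_product sum.cartesian_product)
  finally show ?case using Suc[of "\<lambda>i. g (Suc i)"] by (simp add: prod.lessThan_Suc_shift del: prod.lessThan_Suc)
qed

lemma sum_over_nth:
  assumes "distinct xs"
  shows "(\<Sum>i<length xs. f (xs ! i)) = (\<Sum>x\<in>set xs. f x)"
  using bij_betw_nth[OF assms refl refl] by (rule sum.reindex_bij_betw)

lemma prod_over_cyclic_shift:
  assumes "0 < k"
  shows "(\<Prod>i<k. f (Suc i mod k)) = (\<Prod>i<k. f i)"
proof -
  obtain m where k: "k = Suc m" using assms by (cases k) auto
  have "(\<Prod>i<k. f (Suc i mod k)) = (\<Prod>i<m. f (Suc i)) * f 0"
    unfolding k by (auto intro!: prod.cong)
  also have "\<dots> = (\<Prod>i<k. f i)" unfolding k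
    by (simp add: prod.lessThan_Suc_shift mult.commute del: prod.lessThan_Suc)
  finally show ?thesis .
qed

text \<open>Serves two situations with an exceptional pair of positions: two vertices carrying an
  extra weight, and two vertices forced to coincide.\<close>

lemma prod_two_distinguished:
  fixes x y :: real
  assumes "i < k" "j < k" "i \<noteq> j"
  shows "(\<Prod>l<k. if l = i \<or> l = j then x else y) = x * x * y ^ (k - 2)"
proof -
  have "(\<Prod>l<k. if l = i \<or> l = j then x else y)
        = x ^ card {l. l < k \<and> (l = i \<or> l = j)} * y ^ card {l. l < k \<and> l \<noteq> i \<and> l \<noteq> j}"
    by (subst prod.If_cases) (auto simp: Int_def)
  also have "{l. l < k \<and> (l = i \<or> l = j)} = {i, j}" using assms by auto
  also have "{l. l < k \<and> l \<noteq> i \<and> l \<noteq> j} = {..<k} - {i, j}" by auto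
  finally show ?thesis
    using assms by (simp add: card_Diff_subset power2_eq_square numeral_2_eq_2)
qed

lemma card_distinct_pairs_le: "real (card {(i, j). i < k \<and> j < k \<and> i \<noteq> j}) \<le> (real k)\<^sup>2"
proof -
  have "card {(i, j). i < k \<and> j < k \<and> i \<noteq> j} \<le> card ({..<k} \<times> {..<k})"
    by (intro card_mono) auto
  then have "real (card {(i, j). i < k \<and> j < k \<and> i \<noteq> j}) \<le> real (k * k)"
    by (simp only: of_nat_le_iff card_cartesian_product card_lessThan)
  then show ?thesis by (simp add: power2_eq_square)
qed

text \<open>The Weierstrass product inequality; it bounds the loss from replacing
  \<open>a / (1 + a)\<close> by \<open>a\<close> along a whole cycle.\<close>

lemma prod_one_minus_ge:
  fixes x :: "'b \<Rightarrow> real"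
  assumes "\<And>i. i \<in> I \<Longrightarrow> x i \<in> {0..1}"
  shows "1 - (\<Sum>i\<in>I. x i) \<le> (\<Prod>i\<in>I. 1 - x i)"
  using assms
proof (induction I rule: infinite_finite_induct)
  case (insert a I)
  have x: "0 \<le> x i \<and> x i \<le> 1" if "i \<in> insert a I" for i using insert.prems that by auto
  have P: "0 \<le> (\<Prod>i\<in>I. 1 - x i)" "(\<Prod>i\<in>I. 1 - x i) \<le> 1"
    using x by (auto intro!: prod_nonneg prod_le_1)
  have "1 - (\<Sum>i\<in>I. x i) \<le> (\<Prod>i\<in>I. 1 - x i)"
    using insert by auto
  moreover have "x a * (\<Prod>i\<in>I. 1 - x i) \<le> x a * 1"
    using P x[of a] by (intro mult_left_mono) auto
  ultimately show ?case using insert.hyps by (simp add: algebra_simps)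
qed auto

section \<open>The graph with given weights\<close>

locale positive_weights =
  fixes n :: nat and w :: "nat \<Rightarrow> real"
  assumes n: "1 \<le> n" and w: "\<And>i. i \<in> {1..n} \<Longrightarrow> 0 < w i"
begin

definition L :: real where "L = (\<Sum>i=1..n. w i)"
definition S :: real where "S = (\<Sum>i=1..n. (w i)\<^sup>2)"
definition T :: real where "T = (\<Sum>i=1..n. w i ^ 4)"
definition R :: real where "R = S / L"

abbreviation p :: "nat set \<Rightarrow> real" where "p \<equiv> edge_prob n w"

text \<open>A vertex of a cycle lies on two of its edges, so the edge bounds
  \<open>w i * w j / L\<close> multiply to \<open>mass xs\<close> around the cycle through
  \<open>xs\<close>. The interior of an ear contributes in the same way.\<close>

definition mass :: "nat list \<Rightarrow> real" where
  "mass xs = (\<Prod>i<length xs. (w (xs ! i))\<^sup>2 / L)"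

text \<open>Edge bounds summed over ordered pairs of vertices. The same quantity controls the end
  points of ears and the loss from replacing edge probabilities by their bounds.\<close>

definition cross :: "nat set \<Rightarrow> real" where
  "cross V = (\<Sum>u\<in>V. \<Sum>v\<in>V - {u}. w u * w v / L)"

lemma L_pos: "0 < L"
  unfolding L_def using n w by (intro sum_pos) auto

lemma S_nonneg: "0 \<le> S" and T_nonneg: "0 \<le> T"
  by (auto simp: S_def T_def intro!: sum_nonneg)

lemma R_nonneg: "0 \<le> R"
  unfolding R_def using L_pos S_nonneg by simp

lemma R_eq: "(\<Sum>x=1..n. (w x)\<^sup>2 / L) = R"
  by (simp add: R_def S_def sum_divide_distrib)

lemma mass_nonneg: "0 \<le> mass xs"
  unfolding mass_def using L_pos by (intro prod_nonneg) auto

section \<open>Edge probabilities and ears\<close>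

lemma wt_nonneg: "i \<in> {1..n} \<Longrightarrow> j \<in> {1..n} \<Longrightarrow> 0 \<le> w i * w j / L"
  using w[of i] w[of j] L_pos by simp

lemma cross_nonneg: "V \<subseteq> {1..n} \<Longrightarrow> 0 \<le> cross V"
  unfolding cross_def by (intro sum_nonneg wt_nonneg) auto

text \<open>The form \<open>a / (1 + a)\<close> shows both the upper bound \<open>a\<close> and the
  relative error, which is \<open>a / (1 + a)\<close> again.\<close>

lemma p_pair:
  assumes "i \<in> {1..n}" "j \<in> {1..n}" "i \<noteq> j"
  shows "p {i, j} = (w i * w j / L) / (1 + w i * w j / L)"
  using L_pos w[OF assms(1)] w[OF assms(2)] edge_prob_pair[OF assms(3), of n w]
  unfolding L_def[symmetric] by (simp add: field_simps)

lemma p_pair_le: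
  assumes "i \<in> {1..n}" "j \<in> {1..n}" "i \<noteq> j"
  shows "p {i, j} \<le> w i * w j / L"
proof -
  have "a / (1 + a) \<le> a" if "0 \<le> a" for a :: real
    using that by (simp add: divide_simps algebra_simps)
  then show ?thesis unfolding p_pair[OF assms] using wt_nonneg assms by blast
qed

lemma p_bounds: "e \<in> vertex_pairs n \<Longrightarrow> 0 \<le> p e \<and> p e \<le> 1"
proof -
  assume "e \<in> vertex_pairs n"
  then obtain i j where e: "e = {i, j}" "i \<in> {1..n}" "j \<in> {1..n}" "i \<noteq> j"
    by (auto simp: vertex_pairs_def)
  have "0 \<le> a / (1 + a) \<and> a / (1 + a) \<le> 1" if "0 \<le> a" for a :: real
    using that by simp
  then show ?thesis unfolding e(1) p_pair[OF e(2-4)] using wt_nonneg e by blast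
qed

lemma prod_p_nonneg: "a \<subseteq> vertex_pairs n \<Longrightarrow> 0 \<le> prod p a"
  using p_bounds by (intro prod_nonneg) auto

text \<open>An interior vertex lies on two edges of the path and yields its squared weight, an end
  point lies on one. There is one edge more than interior vertices, hence one factor
  \<open>1 / L\<close> beyond \<open>mass xs\<close>.\<close>

lemma prod_ear_le:
  assumes "distinct (u # xs @ [v])" "set (u # xs @ [v]) \<subseteq> {1..n}"
  shows "prod p (path_edges (u # xs @ [v])) \<le> w u * w v / L * mass xs"
  using assms
proof (induction xs arbitrary: u)
  case Nil
  then show ?case using p_pair_le[of u v] by (simp add: mass_def)
next
  case (Cons x xs)
  have V: "u \<in> {1..n}" "x \<in> {1..n}" "u \<noteq> x" "v \<in> {1..n}" using Cons.prems by auto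
  have "{u, x} \<notin> path_edges (x # xs @ [v])"
    using path_edges_subset_Pow[of "{u, x}" "x # xs @ [v]"] Cons.prems(1) by auto
  then have "prod p (path_edges (u # (x # xs) @ [v])) = p {u, x} * prod p (path_edges (x # xs @ [v]))"
    by simp
  also have "\<dots> \<le> (w u * w x / L) * (w x * w v / L * mass xs)"
  proof (intro mult_mono)
    show "p {u, x} \<le> w u * w x / L" using p_pair_le[OF V(1-3)] .
    show "prod p (path_edges (x # xs @ [v])) \<le> w x * w v / L * mass xs"
      using Cons by auto
    show "0 \<le> w u * w x / L" using wt_nonneg V by blast
    show "0 \<le> prod p (path_edges (x # xs @ [v]))"
    proof (intro prod_p_nonneg subsetI)
      fix e assume "e \<in> path_edges (x # xs @ [v])"
      then obtain i where i: "Suc i < length (x # xs @ [v])"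
        "e = {(x # xs @ [v]) ! i, (x # xs @ [v]) ! Suc i}"
        unfolding path_edges_conv_nth by blast
      have d: "distinct (x # xs @ [v])" "set (x # xs @ [v]) \<subseteq> {1..n}" using Cons.prems by auto
      have "(x # xs @ [v]) ! i \<noteq> (x # xs @ [v]) ! Suc i"
        using nth_eq_iff_index_eq[OF d(1), of i "Suc i"] i(1) by (simp del: nth_Cons_Suc)
      moreover have "(x # xs @ [v]) ! i \<in> {1..n}" "(x # xs @ [v]) ! Suc i \<in> {1..n}"
        using d(2) i(1) nth_mem by (meson Suc_lessD subsetD)+
      ultimately show "e \<in> vertex_pairs n" unfolding vertex_pairs_def i(2) by blast
    qed
  qed
  also have "\<dots> = w u * w v / L * mass (x # xs)"
    by (simp add: mass_def prod.lessThan_Suc_shift power2_eq_square del: prod.lessThan_Suc)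
  finally show ?case .
qed

lemma sum_mass_lists: "(\<Sum>xs | set xs \<subseteq> {1..n} \<and> length xs = k. mass xs) = R ^ k"
proof -
  have "(\<Sum>xs | set xs \<subseteq> {1..n} \<and> length xs = k. mass xs)
        = (\<Sum>xs | set xs \<subseteq> {1..n} \<and> length xs = k. \<Prod>i<k. (w (xs ! i))\<^sup>2 / L)"
    by (intro sum.cong) (auto simp: mass_def)
  also have "\<dots> = R ^ k"
    using sum_lists_prod[of "{1..n}" "\<lambda>_ x. (w x)\<^sup>2 / L" k] R_eq by simp
  finally show ?thesis .
qed

text \<open>The end points give \<open>cross V\<close> and the interiors a geometric series in
  \<open>R\<close>. Counting an ear in both directions, and allowing interiors that repeat vertices
  or meet \<open>V\<close>, only adds nonnegative terms.\<close>

lemma sum_ears_le: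
  assumes V: "V \<subseteq> {1..n}" "\<Union> a = V" and R: "R \<le> \<rho>" "\<rho> < 1"
  shows "(\<Sum>g\<in>ears {1..n} a. prod p g) \<le> cross V / (1 - \<rho>)"
proof -
  let ?D = "\<lambda>m. {xs. set xs \<subseteq> {1..n} \<and> length xs = m}"
  \<comment> \<open>Lengths up to \<open>n\<close> suffice, since the interior of an ear has
    distinct vertices.\<close>
  define D where "D = (\<Union>m\<in>{..n}. ?D m)"
  define P where "P = (SIGMA u:V. V - {u})"
  define E where "E = {((u, v), xs). (u, v) \<in> P \<and> distinct xs \<and> set xs \<subseteq> {1..n} - V}"
  let ?path = "\<lambda>z. path_edges (fst (fst z) # snd z @ [snd (fst z)])"
  let ?wt = "\<lambda>z. w (fst (fst z)) * w (snd (fst z)) / L * mass (snd z)"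
  have finV: "finite V" using V(1) finite_subset by blast
  have finD: "finite D" "\<And>m. finite (?D m)"
    unfolding D_def by (auto intro: finite_lists_length_eq)
  have finP: "finite P" unfolding P_def using finV by auto
  have "E \<subseteq> P \<times> D"
  proof clarsimp
    fix u v xs assume "((u, v), xs) \<in> E"
    then show "(u, v) \<in> P \<and> xs \<in> D"
      using card_mono[of "{1..n}" "set xs"] distinct_card[of xs] by (auto simp: E_def D_def)
  qed
  then have finE: "finite E" using finP finD by (meson finite_SigmaI finite_subset)
  have ok: "distinct (u # xs @ [v])" "set (u # xs @ [v]) \<subseteq> {1..n}"
    if "((u, v), xs) \<in> E" for u v xs
    using that V(1) by (auto simp: E_def P_def)
  have ears: "ears {1..n} a = ?path ` E"
    unfolding ears_def V(2) ear_paths_def E_def P_def by (force simp: image_iff)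
  have "(\<Sum>g\<in>ears {1..n} a. prod p g) \<le> (\<Sum>z\<in>E. prod p (?path z))"
    unfolding ears
  proof (rule order_trans[OF sum_image_le[OF finE]])
    fix z assume z: "z \<in> E"
    obtain u v xs where [simp]: "z = ((u, v), xs)" by (metis prod.exhaust)
    have "u # xs @ [v] \<in> ear_paths {1..n} V"
      using z unfolding E_def P_def ear_paths_def by auto
    then show "0 \<le> prod p (?path z)"
      using ears_subset_vertex_pairs[OF V(1)] prod_p_nonneg by simp
  qed (simp add: o_def)
  also have "\<dots> \<le> (\<Sum>z\<in>E. ?wt z)"
    using prod_ear_le ok by (intro sum_mono) force
  also have "\<dots> \<le> (\<Sum>z\<in>P \<times> D. ?wt z)"
  proof (intro sum_mono2)
    fix z assume "z \<in> P \<times> D - E"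
    then have "fst (fst z) \<in> {1..n}" "snd (fst z) \<in> {1..n}" using V(1) by (auto simp: P_def)
    then show "0 \<le> ?wt z" using wt_nonneg mass_nonneg by (intro mult_nonneg_nonneg) auto
  qed (use \<open>E \<subseteq> P \<times> D\<close> finP finD in auto)
  also have "\<dots> = (\<Sum>z\<in>P. w (fst z) * w (snd z) / L) * (\<Sum>xs\<in>D. mass xs)"
    by (simp add: sum_product sum.cartesian_product case_prod_unfold)
  also have "(\<Sum>z\<in>P. w (fst z) * w (snd z) / L) = cross V"
    unfolding P_def cross_def using finV by (subst sum.Sigma) (auto simp: case_prod_unfold)
  also have "(\<Sum>xs\<in>D. mass xs) = (\<Sum>m\<le>n. \<Sum>xs\<in>?D m. mass xs)"
    unfolding D_def using finD by (intro sum.UNION_disjoint) auto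
  also have "\<dots> = (\<Sum>m\<le>n. R ^ m)" using sum_mass_lists by simp
  also have "cross V * \<dots> \<le> cross V * (1 / (1 - \<rho>))"
  proof (intro mult_left_mono cross_nonneg V)
    have "(\<Sum>m\<le>n. R ^ m) \<le> (\<Sum>m. R ^ m)"
      using R R_nonneg by (intro sum_le_suminf summable_geometric) auto
    also have "\<dots> = 1 / (1 - R)" using R R_nonneg by (intro suminf_geometric) auto
    also have "\<dots> \<le> 1 / (1 - \<rho>)" using R by (intro divide_left_mono) auto
    finally show "(\<Sum>m\<le>n. R ^ m) \<le> 1 / (1 - \<rho>)" .
  qed
  finally show ?thesis by simp
qed

text \<open>An edge has probability \<open>a i * (1 - a i / (1 + a i))\<close>. Around the cycle the
  \<open>a i\<close> multiply to \<open>mass xs\<close>, and the product of the other factors lies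
  between one minus the sum of the \<open>a i\<close> and one.\<close>

lemma prod_cycle_bounds:
  assumes xs: "xs \<in> cycle_lists n k" and k: "3 \<le> k"
  shows "prod p (cycle_edges xs) \<le> mass xs"
    and "mass xs * (1 - cross (set xs)) \<le> prod p (cycle_edges xs)"
proof -
  have d: "distinct xs" "length xs = k" "set xs \<subseteq> {1..n}" using xs by (auto simp: cycle_lists_def)
  define s where "s = (\<lambda>i. Suc i mod k)"
  define a where "a = (\<lambda>i. w (xs ! i) * w (xs ! s i) / L)"
  have V: "xs ! i \<in> {1..n}" "xs ! s i \<in> {1..n}" "xs ! i \<noteq> xs ! s i" "s i < k" if "i < k" for i
  proof -
    have lt: "s i < k" using k unfolding s_def by (intro mod_less_divisor) auto
    have "s i \<noteq> i" using that k by (auto simp: s_def mod_Suc split: if_splits)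
    then show "xs ! i \<noteq> xs ! s i" using nth_eq_iff_index_eq[OF d(1)] that lt d(2) by metis
    show "xs ! i \<in> {1..n}" "xs ! s i \<in> {1..n}" "s i < k"
      using d(2,3) that lt nth_mem by (metis subsetD)+
  qed
  have a0: "0 \<le> a i" if "i < k" for i
    unfolding a_def using w[OF V(1)[OF that]] w[OF V(2)[OF that]] L_pos by simp
  have pe: "prod p (cycle_edges xs) = (\<Prod>i<k. a i * (1 - a i / (1 + a i)))"
  proof -
    have "prod p (cycle_edges xs) = (\<Prod>i<k. p {xs ! i, xs ! s i})"
      using prod_cycle_edges[OF d(1), of p] k unfolding s_def d(2) by simp
    also have "\<dots> = (\<Prod>i<k. a i * (1 - a i / (1 + a i)))"
    proof (intro prod.cong refl)
      fix i assume "i \<in> {..<k}"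
      then have i: "i < k" by simp
      show "p {xs ! i, xs ! s i} = a i * (1 - a i / (1 + a i))"
      proof -
        have "p {xs ! i, xs ! s i} = a i / (1 + a i)"
          using p_pair[OF V(1-3)[OF i]] unfolding a_def .
        then show ?thesis using a0[OF i] by (simp add: field_simps)
      qed
    qed
    finally show ?thesis .
  qed
  have m: "(\<Prod>i<k. a i) = mass xs"
  proof -
    have "(\<Prod>i<k. a i) = (\<Prod>i<k. w (xs ! i)) * (\<Prod>i<k. w (xs ! s i)) / L ^ k"
      unfolding a_def by (simp add: prod_dividef prod.distrib)
    also have "(\<Prod>i<k. w (xs ! s i)) = (\<Prod>i<k. w (xs ! i))"
      unfolding s_def using k by (intro prod_over_cyclic_shift[of k "\<lambda>i. w (xs ! i)"]) auto
    also have "(\<Prod>i<k. w (xs ! i)) * (\<Prod>i<k. w (xs ! i)) / L ^ k = mass xs"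
      unfolding mass_def d(2) by (simp add: prod_dividef power2_eq_square prod.distrib)
    finally show ?thesis .
  qed
  have b: "a i / (1 + a i) \<in> {0..1}" "a i / (1 + a i) \<le> a i" if "i < k" for i
    using a0[OF that] by (auto simp: divide_simps algebra_simps)
  show "prod p (cycle_edges xs) \<le> mass xs"
    unfolding pe m[symmetric] using a0 b by (intro prod_mono) (auto simp: mult_left_le)
  have "(\<Sum>i<k. a i / (1 + a i)) \<le> (\<Sum>i<k. a i)"
    using b by (intro sum_mono) auto
  \<comment> \<open>A vertex and its successor form one of the ordered pairs counted by
    \<open>cross\<close>.\<close>
  also have "\<dots> \<le> (\<Sum>i<k. \<Sum>v\<in>set xs - {xs ! i}. w (xs ! i) * w v / L)"
  proof (intro sum_mono)
    fix i assume "i \<in> {..<k}"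
    then have i: "i < k" by simp
    show "a i \<le> (\<Sum>v\<in>set xs - {xs ! i}. w (xs ! i) * w v / L)"
      unfolding a_def
    proof (rule member_le_sum[of "xs ! s i" _ "\<lambda>v. w (xs ! i) * w v / L"])
      show "xs ! s i \<in> set xs - {xs ! i}" using V[OF i] d(2) by auto
      show "0 \<le> w (xs ! i) * w v / L" if "v \<in> set xs - {xs ! i} - {xs ! s i}" for v
        using that d(3) w V(1)[OF i] L_pos by (auto intro!: divide_nonneg_nonneg mult_nonneg_nonneg less_imp_le)
    qed auto
  qed
  also have "\<dots> = cross (set xs)"
    unfolding cross_def using sum_over_nth[OF d(1), of "\<lambda>u. \<Sum>v\<in>set xs - {u}. w u * w v / L"]
    by (simp add: d(2))
  finally have "1 - cross (set xs) \<le> 1 - (\<Sum>i<k. a i / (1 + a i))" by simp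
  also have "\<dots> \<le> (\<Prod>i<k. 1 - a i / (1 + a i))"
    using b by (intro prod_one_minus_ge) auto
  finally have "mass xs * (1 - cross (set xs)) \<le> mass xs * (\<Prod>i<k. 1 - a i / (1 + a i))"
    using mass_nonneg by (intro mult_left_mono)
  then show "mass xs * (1 - cross (set xs)) \<le> prod p (cycle_edges xs)"
    unfolding pe prod.distrib m .
qed

section \<open>Sums over lists without repeated vertices\<close>

lemma cycle_lists_subset: "cycle_lists n k \<subseteq> {xs. set xs \<subseteq> {1..n} \<and> length xs = k}"
  by (auto simp: cycle_lists_def)


text \<open>For each pair of positions, \<open>cross\<close> puts an extra factor \<open>w\<close>
  on both, so that the sums at these positions become \<open>?S3 / L\<close>. Cauchy-Schwarz bounds
  \<open>?S3\<^sup>2\<close> by \<open>S * T\<close>, and the factor \<open>S\<close> raises the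
  power of \<open>R\<close> from \<open>k - 2\<close> to \<open>k - 1\<close>.\<close>

lemma sum_mass_cross_le:
  assumes k: "2 \<le> k"
  shows "(\<Sum>xs\<in>cycle_lists n k. mass xs * cross (set xs)) \<le> (real k)\<^sup>2 * (R ^ (k - 1) * (T / L\<^sup>2))"
proof -
  let ?D = "{xs. set xs \<subseteq> {1..n} \<and> length xs = k}"
  let ?P = "{(i, j). i < k \<and> j < k \<and> i \<noteq> j}"
  define g where "g = (\<lambda>i j (l :: nat) x. (w x)\<^sup>2 / L * (if l = i \<or> l = j then w x else 1))"
  have w0: "0 \<le> w x" if "x \<in> {1..n}" for x using w[OF that] by simp
  have cr: "mass xs * cross (set xs) = (\<Sum>(i, j)\<in>?P. (\<Prod>l<k. g i j l (xs ! l)) / L)"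
    if "xs \<in> cycle_lists n k" for xs
  proof -
    have d: "distinct xs" "length xs = k" using that by (auto simp: cycle_lists_def)
    have "cross (set xs) = (\<Sum>i<k. \<Sum>v\<in>set xs - {xs ! i}. w (xs ! i) * w v / L)"
      unfolding cross_def using sum_over_nth[OF d(1), of "\<lambda>u. \<Sum>v\<in>set xs - {u}. w u * w v / L"]
      by (simp add: d(2))
    also have "\<dots> = (\<Sum>i<k. \<Sum>j\<in>{..<k} - {i}. w (xs ! i) * w (xs ! j) / L)"
    proof (rule sum.cong[OF refl])
      fix i assume i: "i \<in> {..<k}"
      have "bij_betw (nth xs) ({..<k} - {i}) (set xs - {xs ! i})"
        using bij_betw_nth[OF d(1) refl refl] i d(2) by (intro bij_betw_DiffI) auto
      then show "(\<Sum>v\<in>set xs - {xs ! i}. w (xs ! i) * w v / L)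
                 = (\<Sum>j\<in>{..<k} - {i}. w (xs ! i) * w (xs ! j) / L)"
        by (rule sum.reindex_bij_betw[symmetric])
    qed
    also have "\<dots> = (\<Sum>(i, j)\<in>?P. w (xs ! i) * w (xs ! j) / L)"
      by (subst sum.Sigma) (auto intro!: sum.cong)
    finally have c: "cross (set xs) = \<dots>" .
    have "(\<Prod>l<k. g i j l (xs ! l)) = mass xs * (w (xs ! i) * w (xs ! j))" if "(i, j) \<in> ?P" for i j
    proof -
      have "(\<Prod>l<k. if l = i \<or> l = j then w (xs ! l) else 1) = (\<Prod>l\<in>{i, j}. w (xs ! l))"
        using that by (intro prod.mono_neutral_cong_right) auto
      then show ?thesis using that unfolding g_def prod.distrib mass_def d(2) by auto
    qed
    then show ?thesis unfolding c sum_distrib_left by (intro sum.cong) auto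
  qed
  have one: "(\<Sum>xs\<in>cycle_lists n k. (\<Prod>l<k. g i j l (xs ! l)) / L) \<le> R ^ (k - 1) * (T / L\<^sup>2)"
    if ij: "(i, j) \<in> ?P" for i j
  proof -
    let ?S3 = "\<Sum>x=1..n. w x ^ 3"
    \<comment> \<open>Giving up distinctness makes the sum factorise over the positions.\<close>
    have "(\<Sum>xs\<in>cycle_lists n k. (\<Prod>l<k. g i j l (xs ! l)) / L) \<le> (\<Sum>xs\<in>?D. (\<Prod>l<k. g i j l (xs ! l)) / L)"
    proof (rule sum_mono2[OF _ cycle_lists_subset])
      fix xs assume "xs \<in> ?D - cycle_lists n k"
      then have "xs ! l \<in> {1..n}" if "l < k" for l using that nth_mem by blast
      then show "0 \<le> (\<Prod>l<k. g i j l (xs ! l)) / L"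
        using w0 L_pos by (auto simp: g_def intro!: divide_nonneg_nonneg prod_nonneg mult_nonneg_nonneg)
    qed (simp add: finite_lists_length_eq)
    also have "\<dots> = (\<Prod>l<k. \<Sum>x=1..n. g i j l x) / L"
      using sum_lists_prod[of "{1..n}" "g i j" k] by (simp add: sum_divide_distrib[symmetric])
    also have "(\<Prod>l<k. \<Sum>x=1..n. g i j l x) = (\<Prod>l<k. if l = i \<or> l = j then ?S3 / L else R)"
    proof (rule prod.cong[OF refl])
      fix l
      have "(\<Sum>x=1..n. (w x)\<^sup>2 / L * w x) = ?S3 / L"
        by (simp add: sum_divide_distrib power2_eq_square power3_eq_cube)
      then show "(\<Sum>x=1..n. g i j l x) = (if l = i \<or> l = j then ?S3 / L else R)"
        using R_eq unfolding g_def by (cases "l = i \<or> l = j") simp_all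
    qed
    also have "\<dots> = ?S3 / L * (?S3 / L) * R ^ (k - 2)"
      using ij by (intro prod_two_distinguished) auto
    also have "\<dots> / L = ?S3\<^sup>2 / L ^ 3 * R ^ (k - 2)"
      by (simp add: power2_eq_square power3_eq_cube)
    also have "\<dots> \<le> (S * T) / L ^ 3 * R ^ (k - 2)"
    proof -
      have "(\<Sum>x=1..n. w x * (w x)\<^sup>2)\<^sup>2 \<le> (\<Sum>x=1..n. (w x)\<^sup>2) * (\<Sum>x=1..n. ((w x)\<^sup>2)\<^sup>2)"
        by (rule Cauchy_Schwarz_ineq_sum)
      then have "?S3\<^sup>2 \<le> S * T"
        by (simp add: S_def T_def power2_eq_square power3_eq_cube power4_eq_xxxx mult.assoc)
      then show ?thesis using L_pos R_nonneg by (intro mult_right_mono divide_right_mono) auto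
    qed
    also have "\<dots> = R ^ (k - 1) * (T / L\<^sup>2)"
    proof -
      have "R ^ (k - 1) = R * R ^ (k - 2)" using k by (cases k; cases "k - 1") auto
      moreover have "S * T / L ^ 3 = R * (T / L\<^sup>2)"
        by (simp add: R_def power2_eq_square power3_eq_cube)
      ultimately show ?thesis by (simp add: mult_ac)
    qed
    finally show ?thesis .
  qed
  have "(\<Sum>xs\<in>cycle_lists n k. mass xs * cross (set xs))
        = (\<Sum>z\<in>?P. \<Sum>xs\<in>cycle_lists n k. (\<Prod>l<k. g (fst z) (snd z) l (xs ! l)) / L)"
    using cr by (subst sum.swap) (simp add: case_prod_unfold)
  also have "\<dots> \<le> (\<Sum>z\<in>?P. R ^ (k - 1) * (T / L\<^sup>2))"
    using one by (intro sum_mono) (auto simp: case_prod_unfold)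
  also have "\<dots> = real (card ?P) * (R ^ (k - 1) * (T / L\<^sup>2))" by simp
  also have "\<dots> \<le> (real k)\<^sup>2 * (R ^ (k - 1) * (T / L\<^sup>2))"
    using card_distinct_pairs_le R_nonneg T_nonneg by (intro mult_right_mono) auto
  finally show ?thesis .
qed

text \<open>Lists with a repetition are covered by the pairs of positions that may coincide. Such a
  pair contributes the sum of the squares of \<open>(w u)\<^sup>2 / L\<close>, that is
  \<open>T / L\<^sup>2\<close>, and each of the other \<open>k - 2\<close> positions contributes
  \<open>R\<close>.\<close>

lemma sum_mass_cycle_lists_bounds:
  assumes k: "2 \<le> k"
  shows "(\<Sum>xs\<in>cycle_lists n k. mass xs) \<le> R ^ k"
    and "R ^ k \<le> (\<Sum>xs\<in>cycle_lists n k. mass xs) + (real k)\<^sup>2 * (R ^ (k - 2) * (T / L\<^sup>2))"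
proof -
  let ?D = "{xs. set xs \<subseteq> {1..n} \<and> length xs = k}"
  let ?P = "{(i, j). i < k \<and> j < k \<and> i \<noteq> j}"
  have fin: "finite ?D" by (simp add: finite_lists_length_eq)
  have finP: "finite ?P" by (rule finite_subset[of _ "{..<k} \<times> {..<k}"]) auto
  show "(\<Sum>xs\<in>cycle_lists n k. mass xs) \<le> R ^ k"
    unfolding sum_mass_lists[symmetric]
    using fin cycle_lists_subset mass_nonneg by (intro sum_mono2) auto
  have total: "R ^ k = (\<Sum>xs\<in>cycle_lists n k. mass xs) + (\<Sum>xs\<in>?D - cycle_lists n k. mass xs)"
    unfolding sum_mass_lists[symmetric] using fin cycle_lists_subset
    by (subst sum.subset_diff[of "cycle_lists n k"]) auto
  have "(\<Sum>xs\<in>?D - cycle_lists n k. mass xs)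
        \<le> (\<Sum>xs\<in>?D. \<Sum>(i, j)\<in>?P. of_bool (xs ! i = xs ! j) * mass xs)"
  proof -
    have "(\<Sum>xs\<in>?D - cycle_lists n k. mass xs)
          \<le> (\<Sum>xs\<in>?D - cycle_lists n k. \<Sum>(i, j)\<in>?P. of_bool (xs ! i = xs ! j) * mass xs)"
    proof (rule sum_mono)
      fix xs assume "xs \<in> ?D - cycle_lists n k"
      then have "\<not> distinct xs" "length xs = k" by (auto simp: cycle_lists_def)
      then obtain i j where ij: "(i, j) \<in> ?P" "xs ! i = xs ! j"
        by (auto simp: distinct_conv_nth)
      from member_le_sum[OF ij(1) _ finP, of "\<lambda>(i, j). of_bool (xs ! i = xs ! j) * mass xs"] ij(2)
      show "mass xs \<le> (\<Sum>(i, j)\<in>?P. of_bool (xs ! i = xs ! j) * mass xs)"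
        using mass_nonneg by (auto simp: case_prod_unfold)
    qed
    also have "\<dots> \<le> (\<Sum>xs\<in>?D. \<Sum>(i, j)\<in>?P. of_bool (xs ! i = xs ! j) * mass xs)"
      using fin by (intro sum_mono2) (auto intro!: sum_nonneg mult_nonneg_nonneg mass_nonneg)
    finally show ?thesis .
  qed
  also have "\<dots> = (\<Sum>z\<in>?P. \<Sum>xs\<in>?D. of_bool (xs ! fst z = xs ! snd z) * mass xs)"
    by (subst sum.swap) (simp add: case_prod_unfold)
  also have "\<dots> = (\<Sum>z\<in>?P. R ^ (k - 2) * (T / L\<^sup>2))"
  proof (intro sum.cong refl)
    fix z assume z: "z \<in> ?P"
    obtain i j where [simp]: "z = (i, j)" by (metis prod.exhaust)
    have ij: "i < k" "j < k" "i \<noteq> j" using z by auto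
    \<comment> \<open>Fixing the common value \<open>u\<close> at \<open>i\<close> and
      \<open>j\<close> and summing over \<open>u\<close> writes the coincidence as a product over
      positions.\<close>
    define g where "g = (\<lambda>u (l :: nat) x. (w x)\<^sup>2 / L * (if l = i \<or> l = j then of_bool (x = u) else 1))"
    have split: "of_bool (xs ! i = xs ! j) * mass xs = (\<Sum>u=1..n. \<Prod>l<k. g u l (xs ! l))"
      if xs: "xs \<in> ?D" for xs
    proof -
      have "(\<Prod>l<k. g u l (xs ! l)) = (if u = xs ! i then of_bool (xs ! i = xs ! j) * mass xs else 0)" for u
      proof -
        have "(\<Prod>l<k. if l = i \<or> l = j then of_bool (xs ! l = u) else 1)
              = (\<Prod>l\<in>{i, j}. of_bool (xs ! l = u) :: real)"
          using ij by (intro prod.mono_neutral_cong_right) auto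
        then show ?thesis using ij xs unfolding g_def prod.distrib mass_def by auto
      qed
      moreover have "xs ! i \<in> {1..n}" using xs ij nth_mem by blast
      ultimately show ?thesis by (simp add: sum.delta')
    qed
    have "(\<Sum>xs\<in>?D. of_bool (xs ! i = xs ! j) * mass xs) = (\<Sum>xs\<in>?D. \<Sum>u=1..n. \<Prod>l<k. g u l (xs ! l))"
      using split by (intro sum.cong) auto
    also have "\<dots> = (\<Sum>u=1..n. \<Prod>l<k. \<Sum>x=1..n. g u l x)"
      using sum_lists_prod[of "{1..n}" _ k] by (subst sum.swap) simp
    also have "\<dots> = (\<Sum>u=1..n. \<Prod>l<k. if l = i \<or> l = j then (w u)\<^sup>2 / L else R)"
    proof (intro sum.cong prod.cong refl)
      fix u l assume u: "u \<in> {1..n}"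
      have "(\<Sum>x=1..n. (w x)\<^sup>2 / L * of_bool (x = u)) = (\<Sum>x=1..n. if x = u then (w x)\<^sup>2 / L else 0)"
        by (intro sum.cong) auto
      also have "\<dots> = (w u)\<^sup>2 / L" using u by simp
      finally show "(\<Sum>x=1..n. g u l x) = (if l = i \<or> l = j then (w u)\<^sup>2 / L else R)"
        using R_eq unfolding g_def by (cases "l = i \<or> l = j") simp_all
    qed
    also have "\<dots> = (\<Sum>u=1..n. (w u)\<^sup>2 / L * ((w u)\<^sup>2 / L) * R ^ (k - 2))"
      using ij by (intro sum.cong prod_two_distinguished) auto
    also have "\<dots> = R ^ (k - 2) * (T / L\<^sup>2)"
      by (simp add: T_def sum_distrib_left sum_divide_distrib power2_eq_square power4_eq_xxxx mult_ac)
    finally show "(\<Sum>xs\<in>?D. of_bool (xs ! fst z = xs ! snd z) * mass xs) = R ^ (k - 2) * (T / L\<^sup>2)"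
      by simp
  qed
  also have "\<dots> = real (card ?P) * (R ^ (k - 2) * (T / L\<^sup>2))" by simp
  also have "\<dots> \<le> (real k)\<^sup>2 * (R ^ (k - 2) * (T / L\<^sup>2))"
    using card_distinct_pairs_le R_nonneg T_nonneg by (intro mult_right_mono) auto
  finally show "R ^ k \<le> (\<Sum>xs\<in>cycle_lists n k. mass xs) + (real k)\<^sup>2 * (R ^ (k - 2) * (T / L\<^sup>2))"
    unfolding total by simp
qed

end

section \<open>Power series with coefficients $1/(2k)$\<close>

text \<open>By the convention for division by zero the coefficient at \<open>k = 0\<close> is
  \<open>0\<close>, so the series built from it have no constant term.\<close>

definition cycle_coeff :: "nat set \<Rightarrow> nat \<Rightarrow> real" where
  "cycle_coeff A k = of_bool (k \<in> A) / (2 * real k)"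

definition cycle_series :: "nat set \<Rightarrow> real \<Rightarrow> real" where
  "cycle_series A r = (\<Sum>k. cycle_coeff A k * r ^ k)"

text \<open>The termwise derivative, which serves as the linear coefficient when
  \<open>cycle_series A\<close> is expanded at \<open>r\<close>.\<close>

definition cycle_series_deriv :: "nat set \<Rightarrow> real \<Rightarrow> real" where
  "cycle_series_deriv A r = (\<Sum>k. cycle_coeff A k * (real k * r ^ (k - 1)))"

text \<open>Dominates the values and the first and second order differences of
  \<open>cycle_series A\<close> on the interval from \<open>0\<close> to \<open>\<rho>\<close>, for
  all \<open>A\<close> at once. Truncated subtraction makes the term at \<open>k = 1\<close> equal
  to \<open>1\<close>.\<close>

definition square_series :: "real \<Rightarrow> real" where
  "square_series \<rho> = (\<Sum>k. (real k)\<^sup>2 * \<rho> ^ (k - 2))"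

lemma cycle_coeff_bounds: "0 \<le> cycle_coeff A k" "cycle_coeff A k \<le> 1"
  unfolding cycle_coeff_def by (cases k; auto simp: divide_simps)+

text \<open>From index two on, the terms are at most twice those of the second derivative of the
  geometric series.\<close>

lemma square_summable:
  assumes "0 \<le> \<rho>" "\<rho> < 1"
  shows "summable (\<lambda>k. (real k)\<^sup>2 * \<rho> ^ (k - 2))"
proof -
  let ?c = "\<lambda>_ :: nat. 1 :: real"
  have 1: "summable (\<lambda>n. diffs ?c n * x ^ n)" if "norm x < 1" for x
    by (rule termdiff_converges[OF that]) (simp add: summable_geometric)
  have 2: "summable (\<lambda>n. diffs (diffs ?c) n * x ^ n)" if "norm x < 1" for x
    by (rule termdiff_converges[OF that 1])
  have sm: "summable (\<lambda>n. 2 * (diffs (diffs ?c) n * \<rho> ^ n))"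
    using assms by (intro summable_mult 2) auto
  have "summable (\<lambda>k. (real (k + 2))\<^sup>2 * \<rho> ^ (k + 2 - 2))"
  proof (rule summable_comparison_test'[OF sm])
    fix k
    have "(real (k + 2))\<^sup>2 \<le> 2 * ((1 + real k) * (2 + real k))"
      by (simp add: power2_eq_square algebra_simps)
    from mult_right_mono[OF this, of "\<rho> ^ k"] assms
    show "norm ((real (k + 2))\<^sup>2 * \<rho> ^ (k + 2 - 2)) \<le> 2 * (diffs (diffs ?c) k * \<rho> ^ k)"
      by (simp add: diffs_def mult_ac)
  qed
  then show ?thesis by (subst (asm) summable_iff_shift)
qed

lemma square_series_nonneg:
  assumes "0 \<le> \<rho>" "\<rho> < 1"
  shows "0 \<le> square_series \<rho>"
  unfolding square_series_def using assms by (intro suminf_nonneg square_summable) auto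

text \<open>The coefficients lie between \<open>0\<close> and \<open>1\<close> whatever
  \<open>A\<close> is, which makes the bound uniform in \<open>A\<close>. The factor
  \<open>z\<close> stands for \<open>1\<close>, \<open>\<bar>r - s\<bar>\<close> or
  \<open>(r - s)\<^sup>2\<close>.\<close>

lemma suminf_coeff_bound:
  assumes \<rho>: "0 \<le> \<rho>" "\<rho> < 1" and f: "\<And>k. \<bar>f k\<bar> \<le> (real k)\<^sup>2 * \<rho> ^ (k - 2) * z"
  shows "summable (\<lambda>k. cycle_coeff A k * f k)"
    and "\<bar>\<Sum>k. cycle_coeff A k * f k\<bar> \<le> square_series \<rho> * z"
proof -
  have le: "norm (cycle_coeff A k * f k) \<le> (real k)\<^sup>2 * \<rho> ^ (k - 2) * z" for k
  proof -
    have "norm (cycle_coeff A k * f k) \<le> 1 * \<bar>f k\<bar>"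
      unfolding real_norm_def abs_mult using cycle_coeff_bounds[of A k] by (intro mult_right_mono) auto
    with f[of k] show ?thesis by simp
  qed
  have sm: "summable (\<lambda>k. (real k)\<^sup>2 * \<rho> ^ (k - 2) * z)"
    by (intro summable_mult2 square_summable \<rho>)
  show "summable (\<lambda>k. cycle_coeff A k * f k)"
    by (rule summable_comparison_test'[OF sm le])
  have "norm (\<Sum>k. cycle_coeff A k * f k) \<le> (\<Sum>k. (real k)\<^sup>2 * \<rho> ^ (k - 2) * z)"
    by (rule norm_suminf_le[OF le sm])
  also have "\<dots> = square_series \<rho> * z"
    unfolding square_series_def by (intro suminf_mult2[symmetric] square_summable \<rho>)
  finally show "\<bar>\<Sum>k. cycle_coeff A k * f k\<bar> \<le> square_series \<rho> * z" by simp
qed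

lemma power_le_square_series_term:
  assumes "0 \<le> r" "r \<le> \<rho>" "\<rho> < (1::real)" "k \<noteq> 0"
  shows "r ^ k \<le> (real k)\<^sup>2 * \<rho> ^ (k - 2)" "real k * r ^ (k - 1) \<le> (real k)\<^sup>2 * \<rho> ^ (k - 2)"
proof -
  have k1: "1 \<le> real k" using assms(4) by simp
  have le: "r ^ m \<le> \<rho> ^ (k - 2)" if "k - 2 \<le> m" for m
  proof -
    have "r ^ m \<le> \<rho> ^ m" using assms by (intro power_mono) auto
    also have "\<dots> \<le> \<rho> ^ (k - 2)" using assms that by (intro power_decreasing) auto
    finally show ?thesis .
  qed
  have 1: "1 * r ^ k \<le> (real k)\<^sup>2 * \<rho> ^ (k - 2)"
    using k1 assms one_le_power[OF k1, of 2] by (intro mult_mono le) auto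
  have 2: "real k * r ^ (k - 1) \<le> (real k)\<^sup>2 * \<rho> ^ (k - 2)"
    using k1 assms mult_left_mono[OF k1, of "real k"]
    by (intro mult_mono le) (auto simp: power2_eq_square)
  from 1 2 show "r ^ k \<le> (real k)\<^sup>2 * \<rho> ^ (k - 2)"
    "real k * r ^ (k - 1) \<le> (real k)\<^sup>2 * \<rho> ^ (k - 2)" by auto
qed

section \<open>First and second order differences of powers\<close>

lemma power_diff_le:
  assumes "0 \<le> r" "r \<le> \<rho>" "0 \<le> s" "s \<le> (\<rho>::real)"
  shows "\<bar>r ^ k - s ^ k\<bar> \<le> real k * \<rho> ^ (k - 1) * \<bar>r - s\<bar>"
proof (induction k)
  case (Suc k)
  have "r ^ Suc k - s ^ Suc k = r * (r ^ k - s ^ k) + s ^ k * (r - s)" by (simp add: algebra_simps)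
  also have "\<bar>\<dots>\<bar> \<le> r * \<bar>r ^ k - s ^ k\<bar> + s ^ k * \<bar>r - s\<bar>"
    using assms by (intro order_trans[OF abs_triangle_ineq]) (auto simp: abs_mult)
  also have "\<dots> \<le> \<rho> * (real k * \<rho> ^ (k - 1) * \<bar>r - s\<bar>) + \<rho> ^ k * \<bar>r - s\<bar>"
    using assms Suc by (intro add_mono mult_mono power_mono) auto
  also have "\<dots> = real (Suc k) * \<rho> ^ (Suc k - 1) * \<bar>r - s\<bar>"
    by (cases k) (auto simp: algebra_simps)
  finally show ?case .
qed simp

text \<open>The remainder for \<open>Suc k\<close> is \<open>r\<close> times that for
  \<open>k\<close> plus \<open>k * s ^ (k - 1) * (r - s)\<^sup>2\<close>, and
  \<open>k\<^sup>2 + k \<le> (k + 1)\<^sup>2\<close>.\<close>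

lemma power_taylor_le:
  assumes "0 \<le> r" "r \<le> \<rho>" "0 \<le> s" "s \<le> (\<rho>::real)"
  shows "\<bar>r ^ k - s ^ k - real k * s ^ (k - 1) * (r - s)\<bar> \<le> (real k)\<^sup>2 * \<rho> ^ (k - 2) * (r - s)\<^sup>2"
proof (induction k)
  case (Suc k)
  show ?case
  proof (cases "k = 0")
    case False
    then obtain m where k: "k = Suc m" by (cases k) auto
    have "r ^ Suc k - s ^ Suc k - real (Suc k) * s ^ (Suc k - 1) * (r - s)
          = r * (r ^ k - s ^ k - real k * s ^ (k - 1) * (r - s)) + real k * s ^ (k - 1) * (r - s)\<^sup>2"
      unfolding k by (simp add: algebra_simps power2_eq_square)
    also have "\<bar>\<dots>\<bar> \<le> r * \<bar>r ^ k - s ^ k - real k * s ^ (k - 1) * (r - s)\<bar>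
                          + real k * s ^ (k - 1) * (r - s)\<^sup>2"
      using assms by (intro order_trans[OF abs_triangle_ineq]) (auto simp: abs_mult)
    also have "\<dots> \<le> \<bar>real k\<bar>\<^sup>2 * \<rho> ^ (k - 1) * (r - s)\<^sup>2 + real k * \<rho> ^ (k - 1) * (r - s)\<^sup>2"
    proof (intro add_mono)
      \<comment> \<open>The case \<open>k = 1\<close>, where the remainder is \<open>0\<close>, is
        kept apart: with truncated subtraction \<open>\<rho> * \<rho> ^ (k - 2)\<close> becomes
        \<open>\<rho> ^ (k - 1)\<close> only from \<open>k = 2\<close> on.\<close>
      have "r * \<bar>r ^ k - s ^ k - real k * s ^ (k - 1) * (r - s)\<bar>
            \<le> \<rho> * ((real k)\<^sup>2 * \<rho> ^ (k - 2) * (r - s)\<^sup>2)" if "m \<noteq> 0"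
        using assms Suc by (intro mult_mono) auto
      then show "r * \<bar>r ^ k - s ^ k - real k * s ^ (k - 1) * (r - s)\<bar>
            \<le> \<bar>real k\<bar>\<^sup>2 * \<rho> ^ (k - 1) * (r - s)\<^sup>2"
        by (cases m) (auto simp: k mult_ac)
      show "real k * s ^ (k - 1) * (r - s)\<^sup>2 \<le> real k * \<rho> ^ (k - 1) * (r - s)\<^sup>2"
        using assms by (intro mult_right_mono mult_left_mono power_mono) auto
    qed
    also have "\<dots> = ((real k)\<^sup>2 + real k) * (\<rho> ^ (k - 1) * (r - s)\<^sup>2)"
      by (simp add: algebra_simps)
    also have "\<dots> \<le> (real (Suc k))\<^sup>2 * (\<rho> ^ (k - 1) * (r - s)\<^sup>2)"
    proof (rule mult_right_mono)
      show "(real k)\<^sup>2 + real k \<le> (real (Suc k))\<^sup>2" by (simp add: power2_eq_square algebra_simps)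
      show "0 \<le> \<rho> ^ (k - 1) * (r - s)\<^sup>2" using assms by simp
    qed
    finally show ?thesis by (simp add: mult_ac numeral_2_eq_2)
  qed simp
qed simp

lemma cycle_series_estimates:
  assumes A: "0 \<notin> A" and \<rho>: "\<rho> < 1" and r: "0 \<le> r" "r \<le> \<rho>" and s: "0 \<le> s" "s \<le> \<rho>"
  shows "summable (\<lambda>k. cycle_coeff A k * r ^ k)"
    and "0 \<le> cycle_series A r" "cycle_series A r \<le> square_series \<rho>"
    and "\<bar>cycle_series_deriv A s\<bar> \<le> square_series \<rho>"
    and "\<bar>cycle_series A r - cycle_series A s\<bar> \<le> square_series \<rho> * \<bar>r - s\<bar>"
    and "\<bar>cycle_series A r - cycle_series A s - cycle_series_deriv A s * (r - s)\<bar>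
         \<le> square_series \<rho> * (r - s)\<^sup>2"
proof -
  have \<rho>0: "0 \<le> \<rho>" using r by simp
  note bnd = suminf_coeff_bound[OF \<rho>0 \<rho>]
  have c0: "cycle_coeff A 0 = 0" by (simp add: cycle_coeff_def)
  \<comment> \<open>At \<open>k = 0\<close> the majorant vanishes although \<open>r ^ 0 = 1\<close>.
    Since the coefficient is \<open>0\<close> there, the term can be masked before the bound is
    applied.\<close>
  have eq: "cycle_coeff A k * f k = cycle_coeff A k * (of_bool (k \<noteq> 0) * f k)" for f k
    by (cases "k = 0") (auto simp: c0)
  have eq': "(\<Sum>k. cycle_coeff A k * f k) = (\<Sum>k. cycle_coeff A k * (of_bool (k \<noteq> 0) * f k))" for f
    by (rule suminf_cong, rule eq)
  have b1: "\<bar>of_bool (k \<noteq> 0) * t ^ k\<bar> \<le> (real k)\<^sup>2 * \<rho> ^ (k - 2) * 1"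
    if "0 \<le> t" "t \<le> \<rho>" for t k
    using power_le_square_series_term[OF that \<rho>, of k] that by (cases "k = 0") auto
  have b2: "\<bar>of_bool (k \<noteq> 0) * (real k * s ^ (k - 1))\<bar> \<le> (real k)\<^sup>2 * \<rho> ^ (k - 2) * 1" for k
    using power_le_square_series_term[OF s \<rho>, of k] s by (cases "k = 0") auto
  have sm: "summable (\<lambda>k. cycle_coeff A k * t ^ k)" if "0 \<le> t" "t \<le> \<rho>" for t
    using bnd(1)[OF b1[OF that], of A] by (subst eq)
  then show "summable (\<lambda>k. cycle_coeff A k * r ^ k)" using r by blast
  have smd: "summable (\<lambda>k. cycle_coeff A k * (real k * s ^ (k - 1)))"
    using bnd(1)[OF b2, of A] by (subst eq)
  show "0 \<le> cycle_series A r"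
    unfolding cycle_series_def using sm r cycle_coeff_bounds by (intro suminf_nonneg) auto
  show "cycle_series A r \<le> square_series \<rho>"
    using bnd(2)[OF b1[OF r], of A] eq'[of "\<lambda>k. r ^ k"] unfolding cycle_series_def by simp
  show "\<bar>cycle_series_deriv A s\<bar> \<le> square_series \<rho>"
    using bnd(2)[OF b2, of A] eq'[of "\<lambda>k. real k * s ^ (k - 1)"]
    unfolding cycle_series_deriv_def by simp
  have "cycle_series A r - cycle_series A s = (\<Sum>k. cycle_coeff A k * (r ^ k - s ^ k))"
    unfolding cycle_series_def right_diff_distrib by (rule suminf_diff[OF sm[OF r] sm[OF s]])
  moreover have "\<bar>r ^ k - s ^ k\<bar> \<le> (real k)\<^sup>2 * \<rho> ^ (k - 2) * \<bar>r - s\<bar>" for k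
  proof (cases "k = 0")
    case False
    have "real k * \<rho> ^ (k - 1) * \<bar>r - s\<bar> \<le> (real k)\<^sup>2 * \<rho> ^ (k - 2) * \<bar>r - s\<bar>"
      using power_le_square_series_term(2)[OF \<rho>0 order_refl \<rho> False] by (intro mult_right_mono) auto
    with power_diff_le[OF r s, of k] show ?thesis by linarith
  qed simp
  ultimately show "\<bar>cycle_series A r - cycle_series A s\<bar> \<le> square_series \<rho> * \<bar>r - s\<bar>"
    using bnd(2)[of "\<lambda>k. r ^ k - s ^ k" "\<bar>r - s\<bar>" A] by simp
  have "cycle_series A r - cycle_series A s - cycle_series_deriv A s * (r - s)
        = (\<Sum>k. cycle_coeff A k * (r ^ k - s ^ k - real k * s ^ (k - 1) * (r - s)))"
  proof -
    have e: "cycle_series A r - cycle_series A s = (\<Sum>k. cycle_coeff A k * r ^ k - cycle_coeff A k * s ^ k)"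
      "cycle_series_deriv A s * (r - s) = (\<Sum>k. cycle_coeff A k * (real k * s ^ (k - 1)) * (r - s))"
      unfolding cycle_series_def cycle_series_deriv_def
      by (rule suminf_diff[OF sm[OF r] sm[OF s]], rule suminf_mult2[OF smd])
    show ?thesis
      unfolding e suminf_diff[OF summable_diff[OF sm[OF r] sm[OF s]] summable_mult2[OF smd]]
      by (intro suminf_cong) (simp add: algebra_simps)
  qed
  then show "\<bar>cycle_series A r - cycle_series A s - cycle_series_deriv A s * (r - s)\<bar>
         \<le> square_series \<rho> * (r - s)\<^sup>2"
    using bnd(2)[OF power_taylor_le[OF r s], of A] by simp
qed

section \<open>Poisson approximation for given weights\<close>

context positive_weights
begin

section \<open>The conditional mean number of cycles\<close>

definition mean_count :: "nat set \<Rightarrow> real" where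
  "mean_count A = (\<Sum>a\<in>all_cycles n A. prod p a)"

text \<open>The upper bound is termwise. For the lower one there are two losses, from lists with
  repeated vertices and from edge probabilities below \<open>w i * w j / L\<close>; each is at most
  \<open>(real k)\<^sup>2 * \<rho> ^ (k - 2) * (T / L\<^sup>2)\<close>.\<close>

lemma mean_count_bounds:
  assumes A: "A \<subseteq> {3..}" and R: "R \<le> \<rho>" "\<rho> < 1"
  shows "mean_count A \<le> cycle_series A R"
    and "cycle_series A R \<le> mean_count A + square_series \<rho> * (T / L\<^sup>2)"
proof -
  define P where "P = (\<lambda>k. \<Sum>xs\<in>cycle_lists n k. prod p (cycle_edges xs))"
  have A3: "3 \<le> k" if "k \<in> A" for k using A that by auto
  have z: "0 \<le> T / L\<^sup>2" using T_nonneg by simp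
  have \<rho>0: "0 \<le> \<rho>" using R R_nonneg by linarith
  have le1: "P k \<le> R ^ k" if "k \<in> A" for k
  proof -
    have "P k \<le> (\<Sum>xs\<in>cycle_lists n k. mass xs)"
      unfolding P_def using prod_cycle_bounds(1) A3[OF that] by (intro sum_mono) auto
    also have "\<dots> \<le> R ^ k" using sum_mass_cycle_lists_bounds(1) A3[OF that] by simp
    finally show ?thesis .
  qed
  have le2: "R ^ k - P k \<le> 2 * ((real k)\<^sup>2 * \<rho> ^ (k - 2) * (T / L\<^sup>2))" if "k \<in> A" for k
  proof -
    have k3: "3 \<le> k" using A3[OF that] .
    have 1: "R ^ k \<le> (\<Sum>xs\<in>cycle_lists n k. mass xs) + (real k)\<^sup>2 * (R ^ (k - 2) * (T / L\<^sup>2))"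
      using k3 by (intro sum_mass_cycle_lists_bounds) auto
    have 2: "(\<Sum>xs\<in>cycle_lists n k. mass xs)
               \<le> P k + (\<Sum>xs\<in>cycle_lists n k. mass xs * cross (set xs))"
      unfolding P_def sum.distrib[symmetric]
    proof (rule sum_mono)
      fix xs assume "xs \<in> cycle_lists n k"
      from prod_cycle_bounds(2)[OF this k3]
      show "mass xs \<le> prod p (cycle_edges xs) + mass xs * cross (set xs)" by (simp add: algebra_simps)
    qed
    have 3: "(\<Sum>xs\<in>cycle_lists n k. mass xs * cross (set xs)) \<le> (real k)\<^sup>2 * (R ^ (k - 1) * (T / L\<^sup>2))"
      using k3 by (intro sum_mass_cross_le) auto
    have 4: "(real k)\<^sup>2 * (R ^ (k - 1) * (T / L\<^sup>2)) \<le> (real k)\<^sup>2 * (\<rho> ^ (k - 2) * (T / L\<^sup>2))"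
    proof (intro mult_left_mono mult_right_mono z)
      have "R ^ (k - 1) \<le> \<rho> ^ (k - 1)" using R R_nonneg by (intro power_mono) auto
      also have "\<dots> \<le> \<rho> ^ (k - 2)" using R \<rho>0 by (intro power_decreasing) auto
      finally show "R ^ (k - 1) \<le> \<rho> ^ (k - 2)" .
    qed auto
    have 5: "(real k)\<^sup>2 * (R ^ (k - 2) * (T / L\<^sup>2)) \<le> (real k)\<^sup>2 * (\<rho> ^ (k - 2) * (T / L\<^sup>2))"
      using R R_nonneg z by (intro mult_left_mono mult_right_mono power_mono) auto
    have arith: "a - q \<le> 2 * u" if "a \<le> m + v" "m \<le> q + c" "c \<le> d" "d \<le> u" "v \<le> u"
      for a q m c d u v :: real
      using that by linarith
    from arith[OF 1 2 3 4 5] show ?thesis by (simp only: mult.assoc)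
  qed
  have "mean_count A = (\<Sum>k\<in>A \<inter> {..n}. cycle_coeff A k * P k)"
    unfolding mean_count_def sum_all_cycles[OF A] P_def
    by (intro sum.cong) (auto simp: cycle_coeff_def)
  also have "\<dots> = (\<Sum>k. cycle_coeff A k * P k)"
    by (intro suminf_finite[symmetric]) (auto simp: cycle_coeff_def P_def cycle_lists_empty not_le)
  finally have mc: "mean_count A = \<dots>" .
  have smP: "summable (\<lambda>k. cycle_coeff A k * P k)"
    by (rule summable_finite[of "A \<inter> {..n}"])
       (auto simp: cycle_coeff_def P_def cycle_lists_empty not_le)
  have smR: "summable (\<lambda>k. cycle_coeff A k * R ^ k)"
    using A R R_nonneg by (intro cycle_series_estimates(1)[of A \<rho> R R]) auto
  have le: "cycle_coeff A k * P k \<le> cycle_coeff A k * R ^ k" for k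
    using le1[of k] cycle_coeff_bounds[of A k]
    by (cases "k \<in> A") (auto simp: cycle_coeff_def intro: divide_right_mono)
  show "mean_count A \<le> cycle_series A R"
    unfolding mc cycle_series_def by (rule suminf_le[OF le smP smR])
  have "cycle_series A R - mean_count A = (\<Sum>k. cycle_coeff A k * R ^ k - cycle_coeff A k * P k)"
    unfolding mc cycle_series_def by (rule suminf_diff[OF smR smP])
  also have "\<dots> \<le> (\<Sum>k. (real k)\<^sup>2 * \<rho> ^ (k - 2) * (T / L\<^sup>2))"
  proof (rule suminf_le)
    fix k
    show "cycle_coeff A k * R ^ k - cycle_coeff A k * P k \<le> (real k)\<^sup>2 * \<rho> ^ (k - 2) * (T / L\<^sup>2)"
    proof (cases "k \<in> A")
      case True
      let ?z = "(real k)\<^sup>2 * \<rho> ^ (k - 2) * (T / L\<^sup>2)"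
      \<comment> \<open>The factor \<open>2\<close> from the two losses is absorbed by
        \<open>cycle_coeff A k \<le> 1 / 2\<close>.\<close>
      have "cycle_coeff A k * (R ^ k - P k) \<le> (1 / 2) * (2 * ?z)"
        using le1[OF True] le2[OF True] A3[OF True] cycle_coeff_bounds[of A k]
        by (intro mult_mono) (auto simp: cycle_coeff_def divide_simps)
      then show ?thesis by (simp add: right_diff_distrib)
    next
      case False
      have "0 \<le> (real k)\<^sup>2 * \<rho> ^ (k - 2) * (T / L\<^sup>2)"
        using z \<rho>0 by (intro mult_nonneg_nonneg) auto
      with False show ?thesis by (simp add: cycle_coeff_def)
    qed
  qed (intro summable_diff smR smP summable_mult2 square_summable \<rho>0 R)+
  also have "\<dots> = square_series \<rho> * (T / L\<^sup>2)"
    unfolding square_series_def by (intro suminf_mult2[symmetric] square_summable \<rho>0 R)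
  finally show "cycle_series A R \<le> mean_count A + square_series \<rho> * (T / L\<^sup>2)" by simp
qed

text \<open>For a fixed cycle the ears cost \<open>cross (set xs) / (1 - \<rho>)\<close>, which
  leaves the sums of \<open>mass\<close> times \<open>cross\<close> already bounded for each
  length.\<close>

lemma sum_cycles_ears_le:
  assumes A: "A \<subseteq> {3..}" and R: "R \<le> \<rho>" "\<rho> < 1"
  shows "(\<Sum>a\<in>all_cycles n A. prod p a * (\<Sum>g\<in>ears {1..n} a. prod p g))
         \<le> square_series \<rho> / (1 - \<rho>) * (T / L\<^sup>2)"
proof -
  have A3: "3 \<le> k" if "k \<in> A" for k using A that by auto
  have z: "0 \<le> T / L\<^sup>2" using T_nonneg by simp
  have \<rho>0: "0 \<le> \<rho>" using R R_nonneg by linarith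
  let ?f = "\<lambda>a. prod p a * (\<Sum>g\<in>ears {1..n} a. prod p g)"
  have "sum ?f (all_cycles n A)
        = (\<Sum>k\<in>A \<inter> {..n}. (\<Sum>xs\<in>cycle_lists n k. ?f (cycle_edges xs)) / (2 * real k))"
    by (rule sum_all_cycles[OF A])
  also have "\<dots> \<le> (\<Sum>k\<in>A \<inter> {..n}. (real k)\<^sup>2 * \<rho> ^ (k - 2) * (T / L\<^sup>2 / (1 - \<rho>)))"
  proof (rule sum_mono)
    fix k assume "k \<in> A \<inter> {..n}"
    then have k3: "3 \<le> k" using A3 by auto
    have "?f (cycle_edges xs) \<le> mass xs * (cross (set xs) / (1 - \<rho>))"
      if xs: "xs \<in> cycle_lists n k" for xs
    proof -
      have d: "distinct xs" "length xs = k" "set xs \<subseteq> {1..n}" using xs by (auto simp: cycle_lists_def)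
      then have "xs \<noteq> []" using k3 by auto
      then have "(\<Sum>g\<in>ears {1..n} (cycle_edges xs). prod p g) \<le> cross (set xs) / (1 - \<rho>)"
        by (intro sum_ears_le d R Union_cycle_edges)
      moreover have "0 \<le> prod p (cycle_edges xs)"
        using d k3 cycle_edges_subset_vertex_pairs[of xs n] by (intro prod_p_nonneg) auto
      ultimately have "?f (cycle_edges xs) \<le> prod p (cycle_edges xs) * (cross (set xs) / (1 - \<rho>))"
        by (intro mult_left_mono)
      also have "\<dots> \<le> mass xs * (cross (set xs) / (1 - \<rho>))"
        using prod_cycle_bounds(1)[OF xs k3] cross_nonneg[OF d(3)] R by (intro mult_right_mono) auto
      finally show ?thesis .
    qed
    then have "(\<Sum>xs\<in>cycle_lists n k. ?f (cycle_edges xs))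
        \<le> (\<Sum>xs\<in>cycle_lists n k. mass xs * cross (set xs)) / (1 - \<rho>)"
      unfolding sum_divide_distrib by (intro sum_mono) auto
    also have "\<dots> \<le> (real k)\<^sup>2 * (R ^ (k - 1) * (T / L\<^sup>2)) / (1 - \<rho>)"
      using R k3 by (intro divide_right_mono sum_mass_cross_le) auto
    also have "\<dots> \<le> (real k)\<^sup>2 * (\<rho> ^ (k - 2) * (T / L\<^sup>2)) / (1 - \<rho>)"
    proof (intro divide_right_mono mult_left_mono mult_right_mono z)
      have "R ^ (k - 1) \<le> \<rho> ^ (k - 1)" using R R_nonneg by (intro power_mono) auto
      also have "\<dots> \<le> \<rho> ^ (k - 2)" using R \<rho>0 by (intro power_decreasing) auto
      finally show "R ^ (k - 1) \<le> \<rho> ^ (k - 2)" .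
    qed (use R in auto)
    finally have le: "(\<Sum>xs\<in>cycle_lists n k. ?f (cycle_edges xs))
        \<le> (real k)\<^sup>2 * \<rho> ^ (k - 2) * (T / L\<^sup>2 / (1 - \<rho>))" (is "?s \<le> ?t") by (simp add: mult_ac)
    have "0 \<le> T / L\<^sup>2 / (1 - \<rho>)" using z R by (intro divide_nonneg_nonneg[OF z]) auto
    then have t0: "0 \<le> ?t" using \<rho>0 by (intro mult_nonneg_nonneg) auto
    have "?s / (2 * real k) \<le> ?t / (2 * real k)" using le k3 by (intro divide_right_mono) auto
    also have "\<dots> \<le> ?t / 1" using t0 k3 by (intro divide_left_mono) auto
    finally show "?s / (2 * real k) \<le> ?t" by simp
  qed
  also have "\<dots> \<le> (\<Sum>k. (real k)\<^sup>2 * \<rho> ^ (k - 2) * (T / L\<^sup>2 / (1 - \<rho>)))"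
  proof (intro sum_le_suminf summable_mult2 square_summable)
    have "0 \<le> T / L\<^sup>2 / (1 - \<rho>)" using z R by (intro divide_nonneg_nonneg[OF z]) auto
    then show "0 \<le> (real k)\<^sup>2 * \<rho> ^ (k - 2) * (T / L\<^sup>2 / (1 - \<rho>))" for k
      using \<rho>0 by (intro mult_nonneg_nonneg) auto
  qed (use \<rho>0 R in auto)
  also have "\<dots> = square_series \<rho> * (T / L\<^sup>2 / (1 - \<rho>))"
    unfolding square_series_def by (intro suminf_mult2[symmetric] square_summable \<rho>0 R)
  finally show ?thesis by (simp add: mult_ac)
qed

lemma cycle_count_approx_mean_count:
  assumes A: "A \<subseteq> {3..}" and R: "R \<le> \<rho>" "\<rho> < 1" and h: "\<And>m. \<bar>h m\<bar> \<le> 1"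
  shows "\<bar>subset_mean (vertex_pairs n) p (\<lambda>G. h (cycle_count G A)) - poisson_mean h (mean_count A)\<bar>
         \<le> 4 * (square_series \<rho> / (1 - \<rho>) * (T / L\<^sup>2))"
proof -
  have Un: "\<Union> a \<subseteq> {1..n}" if "a \<in> all_cycles n A" for a
  proof -
    have "\<Union> (vertex_pairs n) \<subseteq> {1..n}" by (auto simp: vertex_pairs_def)
    then show ?thesis using all_cycles_subset[of n A] that by blast
  qed
  have "subset_mean (vertex_pairs n) p (\<lambda>G. h (cycle_count G A))
        = subset_mean (vertex_pairs n) p (\<lambda>G. h (card {a \<in> all_cycles n A. a \<subseteq> G}))"
    by (intro subset_mean_cong) (simp add: cycle_count_conv)
  also have "\<bar>\<dots> - poisson_mean h (mean_count A)\<bar>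
      \<le> 4 * 1 * (\<Sum>a\<in>all_cycles n A. prod p a * (\<Sum>g\<in>ears {1..n} a. prod p g))"
    unfolding mean_count_def
  proof (rule subset_count_poisson_approx)
    fix a assume a: "a \<in> all_cycles n A"
    have "finite (\<Union> a)" using Un[OF a] finite_subset by blast
    then show "finite (ears {1..n} a)" unfolding ears_def by (intro finite_imageI finite_ear_paths) auto
    show "g \<subseteq> vertex_pairs n" if "g \<in> ears {1..n} a" for g
      using that ears_subset_vertex_pairs[OF Un[OF a]] by (auto simp: ears_def)
    show "card {b \<in> all_cycles n A. b \<subseteq> G \<union> a} = Suc (card {b \<in> all_cycles n A. b \<subseteq> G})"
      if "G \<subseteq> vertex_pairs n" "\<not> (\<exists>g\<in>ears {1..n} a. g \<subseteq> G)" for G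
      using cycle_count_no_ear[OF a that] .
  qed (use p_bounds all_cycles_subset h in auto)
  also have "\<dots> \<le> 4 * (square_series \<rho> / (1 - \<rho>) * (T / L\<^sup>2))"
    using sum_cycles_ears_le[OF A R] by simp
  finally show ?thesis .
qed

section \<open>Replacing the random parameter by its limit\<close>

definition deviation :: "real \<Rightarrow> real \<Rightarrow> real" where
  "deviation \<mu> m2 = (T + (S - real n * m2)\<^sup>2 + (L - real n * \<mu>)\<^sup>2) / (real n)\<^sup>2"

lemma deviation_nonneg: "0 \<le> deviation \<mu> m2"
  unfolding deviation_def using T_nonneg by simp

lemma mean_count_nonneg: "0 \<le> mean_count A"
  unfolding mean_count_def using all_cycles_subset by (intro sum_nonneg prod_p_nonneg) blast

text \<open>Three errors are added: the count against the Poisson law with the exact conditional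
  mean, the second order term in the Poisson parameter, and the replacement of the linear term by a
  multiple of \<open>S - \<nu> * L\<close>. Each is quadratic in the deviations of \<open>S\<close>
  and \<open>L\<close> or of order \<open>T / L\<^sup>2\<close>.\<close>

lemma approx_if_typical:
  assumes A: "A \<subseteq> {3..}" and h: "\<And>m. \<bar>h m\<bar> \<le> 1"
    and m: "0 \<le> m2" "m2 < \<mu>" and c: "0 < c" "c \<le> \<mu>" "c * real n \<le> L"
    and \<rho>: "R \<le> \<rho>" "m2 / \<mu> \<le> \<rho>" "\<rho> < 1"
  defines "\<nu> \<equiv> m2 / \<mu>"
  defines "\<kappa> \<equiv> cycle_series A \<nu>" and "q \<equiv> square_series \<rho>"
  defines "a \<equiv> poisson_mean (shift_diff h) \<kappa> * cycle_series_deriv A \<nu> / (real n * \<mu>)"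
  shows "\<bar>subset_mean (vertex_pairs n) p (\<lambda>G. h (cycle_count G A)) - poisson_mean h \<kappa>
            - a * (S - \<nu> * L)\<bar>
         \<le> (4 * q / (1 - \<rho>) + 24 * q\<^sup>2 + 10 * q) * (deviation \<mu> m2 / c\<^sup>2)"
proof -
  define N where "N = real n"
  define x where "x = S - N * m2"
  define y where "y = L - N * \<mu>"
  define Y where "Y = deviation \<mu> m2 / c\<^sup>2"
  define D where "D = S - \<nu> * L"
  define d where "d = R - \<nu>"
  \<comment> \<open>Here \<open>d\<close> is \<open>D / L\<close>; replacing the random
    \<open>L\<close> by \<open>N * \<mu>\<close> costs \<open>e\<close>, which is a product of two
    deviations.\<close>
  define e where "e = d - D / (N * \<mu>)"
  define u where "u = T / L\<^sup>2"
  define g where "g = cycle_series A R - mean_count A"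
  define E where "E = subset_mean (vertex_pairs n) p (\<lambda>G. h (cycle_count G A))"
  define qd where "qd = poisson_mean (shift_diff h) \<kappa>"
  define \<phi> where "\<phi> = cycle_series_deriv A \<nu>"
  have N: "1 \<le> N" using n by (simp add: N_def)
  have \<mu>: "0 < \<mu>" using m by linarith
  have \<nu>: "0 \<le> \<nu>" "\<nu> \<le> \<rho>" "\<nu> \<le> 1" using m \<mu> \<rho> by (auto simp: \<nu>_def)
  have \<rho>0: "0 \<le> \<rho>" using \<nu> by linarith
  have q0: "0 \<le> q" unfolding q_def using \<rho>0 \<rho> by (intro square_series_nonneg)
  have cN: "0 < c * N" "c * N \<le> L" using c N by (auto simp: N_def)
  have Y: "Y = (T + x\<^sup>2 + y\<^sup>2) / (c * N)\<^sup>2"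
    by (simp add: Y_def deviation_def x_def y_def N_def power_mult_distrib mult.commute)
  have sqpos: "0 < L\<^sup>2 * (c * N)\<^sup>2"
    using zero_less_power[OF L_pos, of 2] zero_less_power[OF cN(1), of 2] by (rule mult_pos_pos)
  have T0: "0 \<le> T" by (rule T_nonneg)
  have leY: "z / (c * N)\<^sup>2 \<le> k * Y" if "z \<le> k * (T + x\<^sup>2 + y\<^sup>2)" for z k
    unfolding Y using divide_right_mono[OF that, of "(c * N)\<^sup>2"] by simp
  have u: "0 \<le> u" "u \<le> Y"
  proof -
    have "u \<le> T / (c * N)\<^sup>2"
      unfolding u_def using cN T0 sqpos by (intro divide_left_mono power_mono) auto
    then show "u \<le> Y" using leY[of T 1] by simp
  qed (simp add: u_def T0)
  have Dxy: "D = x - \<nu> * y" unfolding D_def x_def y_def \<nu>_def using \<mu> by (simp add: field_simps)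
  have D: "\<bar>D\<bar> \<le> \<bar>x\<bar> + \<bar>y\<bar>"
  proof -
    have "\<bar>D\<bar> \<le> \<bar>x\<bar> + \<nu> * \<bar>y\<bar>" unfolding Dxy using \<nu> abs_triangle_ineq4[of x "\<nu> * y"]
      by (simp add: abs_mult)
    also have "\<nu> * \<bar>y\<bar> \<le> 1 * \<bar>y\<bar>" using \<nu> by (intro mult_right_mono) auto
    finally show ?thesis by simp
  qed
  define xy where "xy = \<bar>x\<bar> * \<bar>y\<bar>"
  have amgm: "2 * xy \<le> x\<^sup>2 + y\<^sup>2"
    using sum_squares_bound[of "\<bar>x\<bar>" "\<bar>y\<bar>"] by (simp add: xy_def)
  have dD: "d = D / L" unfolding d_def D_def R_def using L_pos by (simp add: field_simps)
  have d: "d\<^sup>2 \<le> 2 * Y"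
  proof -
    have "d\<^sup>2 = D\<^sup>2 / L\<^sup>2" by (simp add: dD power_divide)
    also have "\<dots> \<le> D\<^sup>2 / (c * N)\<^sup>2"
      using cN sqpos by (intro divide_left_mono power_mono) auto
    also have "\<dots> \<le> 2 * Y"
    proof (rule leY)
      have "D\<^sup>2 \<le> (\<bar>x\<bar> + \<bar>y\<bar>)\<^sup>2" using D by (intro abs_le_square_iff[THEN iffD1]) auto
      also have "\<dots> = x\<^sup>2 + y\<^sup>2 + 2 * xy" by (simp add: power2_sum xy_def)
      finally show "D\<^sup>2 \<le> 2 * (T + x\<^sup>2 + y\<^sup>2)" using amgm T0 unfolding distrib_left by linarith
    qed
    finally show ?thesis .
  qed
  have e: "\<bar>e\<bar> \<le> 2 * Y"
  proof -
    have "e = - (D * y) / (L * (N * \<mu>))"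
      unfolding e_def dD y_def using L_pos N \<mu> by (simp add: field_simps)
    then have "\<bar>e\<bar> = \<bar>D\<bar> * \<bar>y\<bar> / (L * (N * \<mu>))"
      using L_pos N \<mu> by (simp add: abs_mult)
    also have "\<dots> \<le> \<bar>D\<bar> * \<bar>y\<bar> / (c * N)\<^sup>2"
    proof (intro divide_left_mono)
      have "c * N \<le> N * \<mu>" using c N by (simp add: mult.commute)
      then show "(c * N)\<^sup>2 \<le> L * (N * \<mu>)"
        using cN L_pos unfolding power2_eq_square by (intro mult_mono[of "c * N"]) auto
      have "0 < N * \<mu>" using N \<mu> by simp
      from mult_pos_pos[OF mult_pos_pos[OF L_pos this] zero_less_power[OF cN(1), of 2]]
      show "0 < L * (N * \<mu>) * (c * N)\<^sup>2" .
    qed auto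
    also have "\<dots> \<le> 2 * Y"
    proof (rule leY)
      have "\<bar>D\<bar> * \<bar>y\<bar> \<le> (\<bar>x\<bar> + \<bar>y\<bar>) * \<bar>y\<bar>" using D by (intro mult_right_mono) auto
      also have "\<dots> = xy + y\<^sup>2" by (simp add: algebra_simps power2_eq_square xy_def)
      finally show "\<bar>D\<bar> * \<bar>y\<bar> \<le> 2 * (T + x\<^sup>2 + y\<^sup>2)"
        using amgm T0 zero_le_power2[of x] zero_le_power2[of y] unfolding distrib_left by linarith
    qed
    finally show ?thesis .
  qed
  have "0 \<notin> A" using A by auto
  note est = cycle_series_estimates[OF this \<rho>(3) R_nonneg \<rho>(1) \<nu>(1,2), folded q_def]
  note est\<nu> = cycle_series_estimates[OF \<open>0 \<notin> A\<close> \<rho>(3) \<nu>(1,2) \<nu>(1,2), folded q_def]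
  have g: "0 \<le> g" "g \<le> q * u" "g \<le> q"
    using mean_count_bounds[OF A \<rho>(1,3)] est(3) mean_count_nonneg[of A]
    by (auto simp: g_def u_def q_def)
  have \<kappa>0: "0 \<le> \<kappa>" unfolding \<kappa>_def by (rule est\<nu>(2))
  have qd: "\<bar>qd\<bar> \<le> 2"
    unfolding qd_def using shift_diff_abs_le[of h 1, OF h] \<kappa>0 by (intro poisson_mean_abs_le) auto
  have \<phi>: "\<bar>\<phi>\<bar> \<le> q" unfolding \<phi>_def by (rule est(4))
  define s where "s = cycle_series A R - \<kappa>"
  have s: "\<bar>s\<bar> \<le> q * \<bar>d\<bar>" "\<bar>s - \<phi> * d\<bar> \<le> q * d\<^sup>2"
    using est(5,6) by (auto simp: s_def \<kappa>_def d_def \<phi>_def)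
  have ms: "mean_count A - \<kappa> = s - g" by (simp add: s_def g_def)
  have sq: "(s - g)\<^sup>2 \<le> 2 * q\<^sup>2 * (d\<^sup>2 + u)"
  proof -
    have "(s - g)\<^sup>2 \<le> 2 * (s\<^sup>2 + g\<^sup>2)"
      using sum_squares_bound[of s "- g"] by (simp add: power2_diff)
    moreover have "s\<^sup>2 \<le> q\<^sup>2 * d\<^sup>2"
      using power_mono[OF s(1), of 2] by (simp add: power_mult_distrib)
    moreover have "g\<^sup>2 \<le> q * (q * u)"
      unfolding power2_eq_square using g q0 by (intro mult_mono) auto
    ultimately show ?thesis by (simp add: power2_eq_square algebra_simps)
  qed
  have 1: "\<bar>E - poisson_mean h (mean_count A)\<bar> \<le> 4 * q / (1 - \<rho>) * Y"
  proof -
    have "\<bar>E - poisson_mean h (mean_count A)\<bar> \<le> 4 * (q / (1 - \<rho>) * u)"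
      unfolding E_def q_def u_def by (rule cycle_count_approx_mean_count[OF A \<rho>(1,3) h])
    also have "\<dots> \<le> 4 * (q / (1 - \<rho>) * Y)" using u q0 \<rho> by (intro mult_left_mono) auto
    finally show ?thesis by simp
  qed
  have 2: "\<bar>poisson_mean h (mean_count A) - poisson_mean h \<kappa> - (s - g) * qd\<bar> \<le> 24 * q\<^sup>2 * Y"
  proof -
    have "\<bar>poisson_mean h (mean_count A) - poisson_mean h \<kappa> - (s - g) * qd\<bar> \<le> 4 * (s - g)\<^sup>2"
      using poisson_mean_taylor[of h 1, OF h \<kappa>0 mean_count_nonneg[of A]]
      unfolding ms qd_def by simp
    also have "\<dots> \<le> 4 * (2 * q\<^sup>2 * (d\<^sup>2 + u))" using sq by simp
    \<comment> \<open>\<open>d\<^sup>2 \<le> 2 * Y\<close> and \<open>u \<le> Y\<close>, which gives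
      the constant \<open>24\<close>.\<close>
    also have "\<dots> \<le> 4 * (2 * q\<^sup>2 * (3 * Y))" using d u by (intro mult_left_mono) auto
    finally show ?thesis by simp
  qed
  have 3: "\<bar>(s - g) * qd - a * D\<bar> \<le> 10 * q * Y"
  proof -
    have a: "a * D = qd * (\<phi> * (d - e))"
      unfolding a_def e_def qd_def[symmetric] \<phi>_def[symmetric] N_def by simp
    have "(s - g) * qd - a * D = qd * ((s - \<phi> * d) - g + \<phi> * e)"
      unfolding a by (simp add: algebra_simps)
    also have "\<bar>\<dots>\<bar> \<le> 2 * (q * d\<^sup>2 + q * u + q * (2 * Y))"
    proof -
      have "\<bar>\<phi> * e\<bar> \<le> q * (2 * Y)" unfolding abs_mult using \<phi> e q0 by (intro mult_mono) auto
      then have "\<bar>(s - \<phi> * d) - g + \<phi> * e\<bar> \<le> q * d\<^sup>2 + q * u + q * (2 * Y)"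
        using s(2) g by linarith
      then show ?thesis unfolding abs_mult using qd by (intro mult_mono) auto
    qed
    also have "\<dots> = 2 * q * (d\<^sup>2 + u + 2 * Y)" by (simp add: algebra_simps)
    also have "\<dots> \<le> 2 * q * (5 * Y)" using d u q0 by (intro mult_left_mono) auto
    finally show ?thesis by simp
  qed
  have "\<bar>E - poisson_mean h \<kappa> - a * D\<bar> \<le> 4 * q / (1 - \<rho>) * Y + 24 * q\<^sup>2 * Y + 10 * q * Y"
    using 1 2 3 by linarith
  also have "\<dots> = (4 * q / (1 - \<rho>) + 24 * q\<^sup>2 + 10 * q) * Y" by (simp only: distrib_right)
  finally show ?thesis unfolding E_def D_def Y_def .
qed

text \<open>Chebyshev in pointwise form: for atypical weights \<open>deviation\<close> is at least
  \<open>\<delta>\<^sup>2\<close>, so any constant is at most a multiple of it. The linear term is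
  unbounded, but grows at most like \<open>1 + deviation\<close>.\<close>

lemma approx_if_atypical:
  assumes h: "\<And>m. \<bar>h m\<bar> \<le> 1" and \<mu>: "0 < \<mu>" and \<delta>: "0 < \<delta>" and A: "0 \<notin> A"
    and atyp: "\<delta> * real n < \<bar>S - real n * m2\<bar> \<or> \<delta> * real n < \<bar>L - real n * \<mu>\<bar>"
    and \<nu>: "\<nu> = m2 / \<mu>" "0 \<le> \<nu>" "\<nu> \<le> \<rho>" "\<rho> < 1"
  defines "\<kappa> \<equiv> cycle_series A \<nu>" and "q \<equiv> square_series \<rho>"
  defines "a \<equiv> poisson_mean (shift_diff h) \<kappa> * cycle_series_deriv A \<nu> / (real n * \<mu>)"
  shows "\<bar>subset_mean (vertex_pairs n) p (\<lambda>G. h (cycle_count G A)) - poisson_mean h \<kappa>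
            - a * (S - \<nu> * L)\<bar>
         \<le> ((2 + 4 * q / \<mu>) / \<delta>\<^sup>2 + 4 * q / \<mu>) * deviation \<mu> m2"
proof -
  define N where "N = real n"
  define x where "x = (S - N * m2) / N"
  define y where "y = (L - N * \<mu>) / N"
  define Z where "Z = deviation \<mu> m2"
  define E where "E = subset_mean (vertex_pairs n) p (\<lambda>G. h (cycle_count G A))"
  note est\<nu> = cycle_series_estimates[OF A \<nu>(4) \<nu>(2,3) \<nu>(2,3), folded q_def]
  have N: "1 \<le> N" using n by (simp add: N_def)
  have q0: "0 \<le> q" unfolding q_def using \<nu> by (intro square_series_nonneg) auto
  have Z: "x\<^sup>2 + y\<^sup>2 \<le> Z"
    unfolding Z_def deviation_def x_def y_def N_def power_divide add_divide_distrib using T_nonneg by simp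
  have one: "1 \<le> Z / \<delta>\<^sup>2"
  proof -
    have "\<delta> \<le> \<bar>x\<bar> \<or> \<delta> \<le> \<bar>y\<bar>"
      using atyp N unfolding x_def y_def N_def[symmetric] by (auto simp: field_simps)
    then have "\<delta>\<^sup>2 \<le> x\<^sup>2 \<or> \<delta>\<^sup>2 \<le> y\<^sup>2"
      using \<delta> power_mono[of \<delta> "\<bar>x\<bar>" 2] power_mono[of \<delta> "\<bar>y\<bar>" 2] by auto
    then have "\<delta>\<^sup>2 \<le> Z" using Z zero_le_power2[of x] zero_le_power2[of y] by linarith
    then show ?thesis using \<delta> by simp
  qed
  have Z0: "0 \<le> Z" unfolding Z_def by (rule deviation_nonneg)
  have \<kappa>0: "0 \<le> \<kappa>" unfolding \<kappa>_def by (rule est\<nu>(2))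
  have E: "\<bar>E\<bar> \<le> 1"
    using subset_mean_abs_le[of "vertex_pairs n" p "\<lambda>G. h (cycle_count G A)" "\<lambda>_. 1"] p_bounds h
    by (simp add: E_def)
  have Q: "\<bar>poisson_mean h \<kappa>\<bar> \<le> 1" using h \<kappa>0 by (rule poisson_mean_abs_le)
  have aD: "\<bar>a * (S - \<nu> * L)\<bar> \<le> 4 * q / \<mu> * (1 + Z)"
  proof -
    have "S - \<nu> * L = N * (x - \<nu> * y)" unfolding x_def y_def \<nu>(1) using \<mu> N by (simp add: field_simps)
    then have "a * (S - \<nu> * L) = poisson_mean (shift_diff h) \<kappa> * cycle_series_deriv A \<nu> / \<mu> * (x - \<nu> * y)"
      unfolding a_def N_def[symmetric] using N by simp
    also have "\<bar>\<dots>\<bar> = \<bar>poisson_mean (shift_diff h) \<kappa>\<bar> * \<bar>cycle_series_deriv A \<nu>\<bar> / \<mu> * \<bar>x - \<nu> * y\<bar>"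
      using \<mu> by (simp add: abs_mult)
    also have "\<dots> \<le> 2 * q / \<mu> * (2 * (1 + Z))"
    proof (intro mult_mono divide_right_mono)
      show "\<bar>poisson_mean (shift_diff h) \<kappa>\<bar> \<le> 2"
        using shift_diff_abs_le[of h 1, OF h] \<kappa>0 by (intro poisson_mean_abs_le) auto
      show "\<bar>cycle_series_deriv A \<nu>\<bar> \<le> q" by (rule est\<nu>(4))
      have "\<bar>\<nu> * y\<bar> \<le> 1 * \<bar>y\<bar>" unfolding abs_mult using \<nu> by (intro mult_right_mono) auto
      moreover have "\<bar>z\<bar> \<le> 1 + z\<^sup>2" for z :: real
      proof -
        have "2 * \<bar>z\<bar> \<le> z\<^sup>2 + 1" using sum_squares_bound[of "\<bar>z\<bar>" 1] by simp
        then show ?thesis using zero_le_power2[of z] by linarith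
      qed
      ultimately show "\<bar>x - \<nu> * y\<bar> \<le> 2 * (1 + Z)"
        using Z Z0 abs_triangle_ineq4[of x "\<nu> * y"] by (smt (verit))
    qed (use \<mu> q0 in auto)
    also have "\<dots> = 4 * q / \<mu> * (1 + Z)" by (simp add: field_simps)
    finally show ?thesis .
  qed
  have "\<bar>E - poisson_mean h \<kappa> - a * (S - \<nu> * L)\<bar> \<le> 2 + 4 * q / \<mu> * (1 + Z)"
    using E Q aD by linarith
  also have "\<dots> = (2 + 4 * q / \<mu>) * 1 + 4 * q / \<mu> * Z" by (simp only: distrib_left mult_1_right)
  also have "\<dots> \<le> (2 + 4 * q / \<mu>) * (Z / \<delta>\<^sup>2) + 4 * q / \<mu> * Z"
    using one q0 \<mu> by (intro add_mono mult_left_mono) auto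
  also have "\<dots> = ((2 + 4 * q / \<mu>) / \<delta>\<^sup>2 + 4 * q / \<mu>) * Z"
    by (simp add: add_divide_distrib algebra_simps)
  finally show ?thesis unfolding E_def Z_def .
qed

end

lemma cycle_count_approx:
  assumes m: "0 \<le> m2" "m2 < \<mu>"
  obtains K where "0 \<le> K"
    and "\<And>n w A h. positive_weights n w \<Longrightarrow> A \<subseteq> {3..} \<Longrightarrow> (\<And>m. \<bar>h m\<bar> \<le> 1) \<Longrightarrow>
      \<bar>subset_mean (vertex_pairs n) (edge_prob n w) (\<lambda>G. h (cycle_count G A))
        - poisson_mean h (cycle_series A (m2 / \<mu>))
        - poisson_mean (shift_diff h) (cycle_series A (m2 / \<mu>)) * cycle_series_deriv A (m2 / \<mu>) / (real n * \<mu>)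
          * (positive_weights.S n w - m2 / \<mu> * positive_weights.L n w)\<bar>
      \<le> K * positive_weights.deviation n w \<mu> m2"
proof -
  \<comment> \<open>A third of the gap: typical weights have
    \<open>S \<le> (m2 + \<delta>) * n\<close> and \<open>L \<ge> (m2 + 2 * \<delta>) * n\<close>,
    whence \<open>R \<le> \<rho> < 1\<close>.\<close>
  define \<delta> where "\<delta> = (\<mu> - m2) / 3"
  define c where "c = \<mu> - \<delta>"
  define \<rho> where "\<rho> = (m2 + \<delta>) / c"
  define q where "q = square_series \<rho>"
  have \<mu>: "0 < \<mu>" and \<delta>: "0 < \<delta>" using m by (auto simp: \<delta>_def)
  have c: "c = m2 + 2 * \<delta>" "0 < c" "c \<le> \<mu>" using m \<delta> by (auto simp: c_def \<delta>_def field_simps)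
  have \<rho>: "\<rho> < 1" "0 \<le> \<rho>" using c m \<delta> by (auto simp: \<rho>_def)
  have \<nu>\<rho>: "m2 / \<mu> \<le> \<rho>"
    unfolding \<rho>_def using c m \<delta> \<mu> by (intro frac_le) auto
  have q0: "0 \<le> q" unfolding q_def using \<rho> by (intro square_series_nonneg)
  define K1 where "K1 = (4 * q / (1 - \<rho>) + 24 * q\<^sup>2 + 10 * q) / c\<^sup>2"
  define K2 where "K2 = (2 + 4 * q / \<mu>) / \<delta>\<^sup>2 + 4 * q / \<mu>"
  have K: "0 \<le> K1" "0 \<le> K2" unfolding K1_def K2_def using q0 \<rho> \<mu> by auto
  show thesis
  proof (rule that[of "K1 + K2"])
    show "0 \<le> K1 + K2" using K by simp
    fix n w and A :: "nat set" and h :: "nat \<Rightarrow> real"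
    assume pw: "positive_weights n w" and A: "A \<subseteq> {3..}" and h: "\<And>m. \<bar>h m\<bar> \<le> 1"
    interpret positive_weights n w by (rule pw)
    let ?lhs = "\<bar>subset_mean (vertex_pairs n) (edge_prob n w) (\<lambda>G. h (cycle_count G A))
        - poisson_mean h (cycle_series A (m2 / \<mu>))
        - poisson_mean (shift_diff h) (cycle_series A (m2 / \<mu>)) * cycle_series_deriv A (m2 / \<mu>) / (real n * \<mu>)
          * (S - m2 / \<mu> * L)\<bar>"
    have dev: "0 \<le> deviation \<mu> m2" by (rule deviation_nonneg)
    show "?lhs \<le> (K1 + K2) * deviation \<mu> m2"
    proof (cases "\<delta> * real n < \<bar>S - real n * m2\<bar> \<or> \<delta> * real n < \<bar>L - real n * \<mu>\<bar>")
      case True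
      have "0 \<notin> A" using A by auto
      have "?lhs \<le> K2 * deviation \<mu> m2"
        unfolding K2_def q_def
        using approx_if_atypical[OF h \<mu> \<delta> \<open>0 \<notin> A\<close> True refl _ \<nu>\<rho> \<rho>(1)] m \<mu> by simp
      also have "\<dots> \<le> (K1 + K2) * deviation \<mu> m2" using K dev by (intro mult_right_mono) auto
      finally show ?thesis .
    next
      case False
      then have SL: "S \<le> (m2 + \<delta>) * real n" "c * real n \<le> L"
        unfolding c_def by (auto simp: algebra_simps abs_le_iff not_less)
      have n0: "0 < real n" using n by simp
      have "R \<le> ((m2 + \<delta>) * real n) / (c * real n)"
        unfolding R_def using SL c n0 m \<delta> S_nonneg by (intro frac_le) auto
      then have R: "R \<le> \<rho>" using n0 by (simp add: \<rho>_def)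
      have "?lhs \<le> K1 * deviation \<mu> m2"
        using approx_if_typical[OF A h m c(2,3) SL(2) R \<nu>\<rho> \<rho>(1)] by (simp add: K1_def q_def)
      also have "\<dots> \<le> (K1 + K2) * deviation \<mu> m2" using K dev by (intro mult_right_mono) auto
      finally show ?thesis .
    qed
  qed
qed

section \<open>The law of the random graph\<close>

text \<open>\<open>bernoulli_pmf\<close> truncates its parameter to the unit interval. Doing the
  same here makes the formula for the conditional law valid for all \<open>w\<close>, including the
  null set where some weight is not positive, so measurability can be shown without
  exceptions.\<close>

definition clamped_edge_prob :: "nat \<Rightarrow> (nat \<Rightarrow> real) \<Rightarrow> nat set \<Rightarrow> real" where
  "clamped_edge_prob n w e = min 1 (max 0 (edge_prob n w e))"

lemma pmf_bernoulli: "pmf (bernoulli_pmf p) b = (if b then min 1 (max 0 p) else 1 - min 1 (max 0 p))"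
  by (simp add: bernoulli_pmf.rep_eq)

lemma prob_grg_given_weights:
  "measure_pmf.prob (grg_given_weights n w) X
   = subset_mean (vertex_pairs n) (clamped_edge_prob n w) (\<lambda>G. of_bool (G \<in> X))"
proof -
  let ?V = "vertex_pairs n"
  let ?P = "Pi_pmf ?V False (\<lambda>e. bernoulli_pmf (edge_prob n w e))"
  define r where "r = (\<lambda>present. {e \<in> ?V. present e})"
  \<comment> \<open>\<open>f\<close> encodes an edge set as its indicator function and is inverted
    by \<open>r\<close>; the product law is concentrated on such indicators.\<close>
  define f where "f = (\<lambda>G e. e \<in> (G :: nat set set))"
  define F where "F = f ` Pow ?V"
  have "set_pmf ?P \<subseteq> {g. \<forall>x. x \<notin> ?V \<longrightarrow> g x = False}" by (rule set_Pi_pmf_subset) simp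
  also have "\<dots> \<subseteq> F"
  proof
    fix g assume "g \<in> {g. \<forall>x. x \<notin> ?V \<longrightarrow> g x = False}"
    then have "g = f {e \<in> ?V. g e}" by (auto simp: f_def fun_eq_iff)
    then show "g \<in> F" unfolding F_def by blast
  qed
  finally have sub: "set_pmf ?P \<subseteq> F" .
  have finF: "finite F" by (simp add: F_def)
  have inj: "inj_on f (Pow ?V)" by (auto simp: inj_on_def f_def fun_eq_iff)
  have rf: "r (f G) = G" if "G \<in> Pow ?V" for G using that by (auto simp: r_def f_def)
  have "measure_pmf.prob (grg_given_weights n w) X = measure_pmf.prob ?P (r -` X)"
    unfolding grg_given_weights_def r_def by simp
  also have "\<dots> = measure_pmf.prob ?P (r -` X \<inter> F)"
    using measure_Int_set_pmf[of ?P "r -` X"] measure_Int_set_pmf[of ?P "r -` X \<inter> F"] sub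
    by (simp add: Int_assoc Int_absorb1)
  also have "\<dots> = (\<Sum>g\<in>r -` X \<inter> F. pmf ?P g)"
    using finF by (intro measure_measure_pmf_finite) auto
  also have "\<dots> = (\<Sum>g\<in>F. pmf ?P g * of_bool (r g \<in> X))"
    using finF by (intro sum.mono_neutral_cong_left) auto
  also have "\<dots> = (\<Sum>G\<in>Pow ?V. pmf ?P (f G) * of_bool (G \<in> X))"
    unfolding F_def sum.reindex[OF inj] o_def using rf by (intro sum.cong) auto
  also have "\<dots> = subset_mean ?V (clamped_edge_prob n w) (\<lambda>G. of_bool (G \<in> X))"
    unfolding subset_mean_def
  proof (intro sum.cong refl arg_cong2[of _ _ _ _ "(*)"])
    fix G assume "G \<in> Pow ?V"
    then have "pmf ?P (f G) = (\<Prod>e\<in>?V. pmf (bernoulli_pmf (edge_prob n w e)) (f G e))"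
      by (intro pmf_Pi') (auto simp: f_def)
    then show "pmf ?P (f G)
      = (\<Prod>e\<in>?V. if e \<in> G then clamped_edge_prob n w e else 1 - clamped_edge_prob n w e)"
      by (simp add: pmf_bernoulli clamped_edge_prob_def f_def cong: if_cong)
  qed
  finally show ?thesis .
qed

lemma edge_prob_measurable:
  assumes "e \<in> vertex_pairs n" "sets D = sets borel"
  shows "(\<lambda>w. edge_prob n w e) \<in> borel_measurable (\<Pi>\<^sub>M i\<in>{1..n}. D)"
proof -
  have c: "(\<lambda>w. w i) \<in> borel_measurable (\<Pi>\<^sub>M i\<in>{1..n}. D)" if "i \<in> {1..n}" for i
    using measurable_component_singleton[OF that, of "\<lambda>_. D"] assms(2)
    by (simp cong: measurable_cong_sets)
  have "e \<subseteq> {1..n}" using assms(1) by (auto simp: vertex_pairs_def)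
  with c show ?thesis unfolding edge_prob_def
    by (intro borel_measurable_divide borel_measurable_add borel_measurable_prod borel_measurable_sum) auto
qed

lemma prob_grg_given_weights_measurable:
  assumes "sets D = sets borel"
  shows "(\<lambda>w. measure_pmf.prob (grg_given_weights n w) X) \<in> borel_measurable (\<Pi>\<^sub>M i\<in>{1..n}. D)"
proof -
  have "(\<lambda>w. if e \<in> G then clamped_edge_prob n w e else 1 - clamped_edge_prob n w e)
        \<in> borel_measurable (\<Pi>\<^sub>M i\<in>{1..n}. D)" if "e \<in> vertex_pairs n" for e G
    using edge_prob_measurable[OF that assms] unfolding clamped_edge_prob_def
    by (cases "e \<in> G") simp_all
  then show ?thesis unfolding prob_grg_given_weights subset_mean_def
    by (intro borel_measurable_sum borel_measurable_times borel_measurable_prod) auto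
qed

text \<open>Measurability of the conditional laws as a kernel allows the mixture in
  \<open>grg\<close> to be evaluated as an integral over the weights.\<close>

lemma grg_kernel:
  assumes "sets D = sets borel"
  shows "(\<lambda>w. measure_pmf (grg_given_weights n w))
         \<in> measurable (\<Pi>\<^sub>M i\<in>{1..n}. D) (subprob_algebra (count_space UNIV))"
proof (rule measurable_subprob_algebra)
  fix X :: "nat set set set"
  show "(\<lambda>w. emeasure (measure_pmf (grg_given_weights n w)) X) \<in> borel_measurable (\<Pi>\<^sub>M i\<in>{1..n}. D)"
    using prob_grg_given_weights_measurable[OF assms, of n X]
    by (simp add: measure_pmf.emeasure_eq_measure)
qed (auto intro: measure_pmf.subprob_space_axioms)

lemma (in prob_space) measure_grg:
  assumes W: "random_variable borel W"
  shows "space (grg M W n) = UNIV"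
    and "measure (grg M W n) X
         = (\<integral>w. measure_pmf.prob (grg_given_weights n w) X \<partial>(\<Pi>\<^sub>M i\<in>{1..n}. distr M borel W))"
proof -
  interpret D: prob_space "distr M borel W" by (rule prob_space_distr[OF W])
  interpret N: prob_space "\<Pi>\<^sub>M i\<in>{1..n}. distr M borel W"
    by (rule prob_space_PiM) (rule D.prob_space_axioms)
  have k: "(\<lambda>w. measure_pmf (grg_given_weights n w))
        \<in> measurable (\<Pi>\<^sub>M i\<in>{1..n}. distr M borel W) (subprob_algebra (count_space UNIV))"
    by (rule grg_kernel) simp
  show "space (grg M W n) = UNIV"
    unfolding grg_def using space_bind_measurable[OF k N.not_empty] by simp
  show "measure (grg M W n) X
         = (\<integral>w. measure_pmf.prob (grg_given_weights n w) X \<partial>(\<Pi>\<^sub>M i\<in>{1..n}. distr M borel W))"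
    unfolding grg_def by (rule N.measure_bind[OF k]) simp
qed

section \<open>Moments of sums over independent weights\<close>

context
  fixes D :: "real measure" and n :: nat
  assumes D: "prob_space D"
begin

interpretation D: prob_space D by (rule D)
interpretation prod: product_prob_space "\<lambda>_ :: nat. D" "{1..n}" ..

abbreviation (input) "product_law \<equiv> \<Pi>\<^sub>M i\<in>{1..n}. D"

lemma integral_component:
  fixes g :: "real \<Rightarrow> real"
  assumes g: "integrable D g" and i: "i \<in> {1..n}"
  shows "integrable product_law (\<lambda>w. g (w i))" "(\<integral>w. g (w i) \<partial>product_law) = (\<integral>x. g x \<partial>D)"
proof -
  have c: "distr product_law D (\<lambda>w. w i) = D" by (rule prod.PiM_component[OF i])
  have m: "(\<lambda>w. w i) \<in> measurable product_law D" by (rule measurable_component_singleton[OF i])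
  have gm: "g \<in> borel_measurable D" using g by simp
  show "integrable product_law (\<lambda>w. g (w i))"
    using integrable_distr[OF m, of g] g unfolding c by blast
  show "(\<integral>w. g (w i) \<partial>product_law) = (\<integral>x. g x \<partial>D)"
    using integral_distr[OF m gm] unfolding c by simp
qed

lemma integral_sum_components:
  fixes g :: "real \<Rightarrow> real"
  assumes "integrable D g"
  shows "integrable product_law (\<lambda>w. \<Sum>i=1..n. g (w i))"
    "(\<integral>w. (\<Sum>i=1..n. g (w i)) \<partial>product_law) = real n * (\<integral>x. g x \<partial>D)"
  using integral_component[OF assms] by auto

lemma integral_pair:
  fixes g :: "real \<Rightarrow> real"
  assumes g: "integrable D g" "(\<integral>x. g x \<partial>D) = 0" and ij: "i \<in> {1..n}" "j \<in> {1..n}" "i \<noteq> j"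
  shows "integrable product_law (\<lambda>w. g (w i) * g (w j))" "(\<integral>w. g (w i) * g (w j) \<partial>product_law) = 0"
proof -
  \<comment> \<open>Factors \<open>1\<close> at the remaining coordinates extend the pair to a full
    product, to which independence applies.\<close>
  define f where "f = (\<lambda>l. if l = i \<or> l = j then g else (\<lambda>_. 1))"
  have int: "integrable D (f l)" for l using g by (auto simp: f_def)
  have eq: "(\<Prod>l\<in>{1..n}. f l (w l)) = g (w i) * g (w j)" for w
  proof -
    have "(\<Prod>l\<in>{1..n}. f l (w l)) = (\<Prod>l\<in>{i, j}. f l (w l))"
      using ij by (intro prod.mono_neutral_right) (auto simp: f_def)
    then show ?thesis using ij by (simp add: f_def)
  qed
  show "integrable product_law (\<lambda>w. g (w i) * g (w j))"
    using prod.product_integrable_prod[of "{1..n}" f, OF _ int] unfolding eq by simp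
  have "(\<integral>w. g (w i) * g (w j) \<partial>product_law) = (\<Prod>l\<in>{1..n}. \<integral>x. f l x \<partial>D)"
    using prod.product_integral_prod[of "{1..n}" f, OF _ int] unfolding eq by simp
  also have "\<dots> = 0" using ij g(2) by (intro prod_zero) (auto simp: f_def intro!: bexI[of _ i])
  finally show "(\<integral>w. g (w i) * g (w j) \<partial>product_law) = 0" .
qed

text \<open>The variance of a sum of independent centred variables: off-diagonal products have mean
  zero.\<close>

lemma integral_square_sum_components:
  fixes g :: "real \<Rightarrow> real"
  assumes g: "integrable D g" "(\<integral>x. g x \<partial>D) = 0" "integrable D (\<lambda>x. (g x)\<^sup>2)"
  shows "integrable product_law (\<lambda>w. (\<Sum>i=1..n. g (w i))\<^sup>2)"
    "(\<integral>w. (\<Sum>i=1..n. g (w i))\<^sup>2 \<partial>product_law) = real n * (\<integral>x. (g x)\<^sup>2 \<partial>D)"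
proof -
  have eq: "(\<Sum>i=1..n. g (w i))\<^sup>2 = (\<Sum>i=1..n. \<Sum>j=1..n. g (w i) * g (w j))" for w
    by (simp add: power2_eq_square sum_product)
  have int: "integrable product_law (\<lambda>w. g (w i) * g (w j))"
    "(\<integral>w. g (w i) * g (w j) \<partial>product_law) = (if i = j then \<integral>x. (g x)\<^sup>2 \<partial>D else 0)"
    if "i \<in> {1..n}" "j \<in> {1..n}" for i j
    using integral_pair[OF g(1,2) that] integral_component[OF g(3) that(1)]
    by (cases "i = j"; simp add: power2_eq_square)+
  show "integrable product_law (\<lambda>w. (\<Sum>i=1..n. g (w i))\<^sup>2)"
    unfolding eq using int(1) by (intro Bochner_Integration.integrable_sum) auto
  have "(\<integral>w. (\<Sum>i=1..n. g (w i))\<^sup>2 \<partial>product_law) = (\<Sum>i=1..n. \<integral>w. (\<Sum>j=1..n. g (w i) * g (w j)) \<partial>product_law)"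
    unfolding eq using int(1)
    by (intro Bochner_Integration.integral_sum Bochner_Integration.integrable_sum) auto
  also have "\<dots> = (\<Sum>i=1..n. \<Sum>j=1..n. \<integral>w. g (w i) * g (w j) \<partial>product_law)"
    by (intro sum.cong refl Bochner_Integration.integral_sum int(1))
  also have "\<dots> = (\<Sum>i=1..n. \<integral>x. (g x)\<^sup>2 \<partial>D)"
  proof (rule sum.cong[OF refl])
    fix i assume i: "i \<in> {1..n}"
    have "(\<Sum>j=1..n. \<integral>w. g (w i) * g (w j) \<partial>product_law) = (\<Sum>j=1..n. if i = j then \<integral>x. (g x)\<^sup>2 \<partial>D else 0)"
      using int(2)[OF i] by (intro sum.cong) auto
    also have "\<dots> = (\<integral>x. (g x)\<^sup>2 \<partial>D)" using i by simp
    finally show "(\<Sum>j=1..n. \<integral>w. g (w i) * g (w j) \<partial>product_law) = (\<integral>x. (g x)\<^sup>2 \<partial>D)" .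
  qed
  finally show "(\<integral>w. (\<Sum>i=1..n. g (w i))\<^sup>2 \<partial>product_law) = real n * (\<integral>x. (g x)\<^sup>2 \<partial>D)" by simp
qed

end

section \<open>The Poisson side\<close>

text \<open>For \<open>r < 1\<close> the intensity is finite also on infinite \<open>A\<close>, so
  that \<open>\<eta>\<close> has an honest Poisson count on every \<open>A\<close>.\<close>

lemma emeasure_cycle_intensity:
  assumes A: "A \<subseteq> {3..}" and r: "0 \<le> r" "r < 1" "r = (\<integral>x. (W x)\<^sup>2 \<partial>M) / (\<integral>x. W x \<partial>M)"
  shows "emeasure (cycle_intensity M W) A = ennreal (cycle_series A r)"
proof -
  have "emeasure (cycle_intensity M W) A
        = (\<integral>\<^sup>+k. ennreal (cycle_rate M W k) * indicator A k \<partial>count_space {3..})"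
    unfolding cycle_intensity_def point_measure_def using A by (subst emeasure_density) auto
  also have "\<dots> = (\<integral>\<^sup>+k. ennreal (cycle_rate M W k) * indicator A k \<partial>count_space UNIV)"
    using A by (intro nn_integral_count_space_eq) (auto simp: indicator_def)
  also have "\<dots> = (\<Sum>k. ennreal (cycle_rate M W k) * indicator A k)"
    by (rule nn_integral_count_space_nat)
  also have "\<dots> = (\<Sum>k. ennreal (cycle_coeff A k * r ^ k))"
    by (intro suminf_cong) (auto simp: cycle_rate_def cycle_coeff_def r(3) indicator_def)
  also have "\<dots> = ennreal (cycle_series A r)"
    unfolding cycle_series_def
    using A r(1,2) cycle_coeff_bounds by (intro suminf_ennreal2 cycle_series_estimates(1)[of A r r r]) auto
  finally show ?thesis .
qed

lemma poisson_point_process_prob: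
  assumes P: "poisson_point_process P \<Lambda> \<eta>" and A: "A \<in> sets \<Lambda>" "emeasure \<Lambda> A < \<infinity>"
  shows "measure P {\<omega> \<in> space P. emeasure (\<eta> \<omega>) A \<in> of_nat ` B}
         = poisson_mean (\<lambda>m. of_bool (m \<in> B)) (measure \<Lambda> A)"
proof -
  interpret prob_space P using P by (simp add: poisson_point_process_def point_process_def)
  have meas: "(\<lambda>\<omega>. emeasure (\<eta> \<omega>) A) \<in> borel_measurable P"
    using P A by (simp add: poisson_point_process_def point_process_def)
  have pk: "prob {\<omega> \<in> space P. emeasure (\<eta> \<omega>) A = of_nat k}
            = measure \<Lambda> A ^ k / fact k * exp (- measure \<Lambda> A)" for k :: nat
    using P A by (simp add: poisson_point_process_def)
  \<comment> \<open>\<open>Z k\<close> is empty for \<open>k\<close> outside \<open>B\<close>, so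
    the disjoint union can run over all \<open>k\<close>.\<close>
  define Z where "Z = (\<lambda>k. {\<omega> \<in> space P. k \<in> B \<and> emeasure (\<eta> \<omega>) A = of_nat k})"
  have "Z k \<in> events" for k
    unfolding Z_def using meas by measurable
  moreover have "disjoint_family Z"
    unfolding disjoint_family_on_def Z_def by auto
  ultimately have "(\<lambda>k. prob (Z k)) sums prob (\<Union>k. Z k)"
    by (intro finite_measure_UNION) auto
  moreover have "(\<Union>k. Z k) = {\<omega> \<in> space P. emeasure (\<eta> \<omega>) A \<in> of_nat ` B}"
    unfolding Z_def by auto
  moreover have "prob (Z k) = of_bool (k \<in> B) / fact k * measure \<Lambda> A ^ k * exp (- measure \<Lambda> A)" for k
    using pk[of k] by (cases "k \<in> B") (simp_all add: Z_def)
  ultimately have "prob {\<omega> \<in> space P. emeasure (\<eta> \<omega>) A \<in> of_nat ` B}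
      = (\<Sum>k. of_bool (k \<in> B) / fact k * measure \<Lambda> A ^ k * exp (- measure \<Lambda> A))"
    by (simp add: sums_iff)
  also have "\<dots> = poisson_mean (\<lambda>m. of_bool (m \<in> B)) (measure \<Lambda> A)"
    unfolding poisson_mean_def by (intro suminf_mult2[symmetric] summable_poisson[of _ 1]) auto
  finally show ?thesis .
qed

section \<open>Averaging over the weights\<close>

lemma subset_mean_cong_prob:
  "(\<And>e. e \<in> V \<Longrightarrow> p e = p' e) \<Longrightarrow> subset_mean V p F = subset_mean V p' F"
  unfolding subset_mean_def by (intro sum.cong arg_cong2[of _ _ _ _ "(*)"] prod.cong) auto

text \<open>For positive weights the edge probabilities lie in the unit interval, so the truncation
  has no effect.\<close>

lemma (in positive_weights) prob_cycle_count:
  "measure_pmf.prob (grg_given_weights n w) {G. cycle_count G A \<in> B}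
   = subset_mean (vertex_pairs n) p (\<lambda>G. of_bool (cycle_count G A \<in> B))"
  unfolding prob_grg_given_weights using p_bounds
  by (simp add: subset_mean_cong_prob[of "vertex_pairs n" p "clamped_edge_prob n w"]
      clamped_edge_prob_def)

text \<open>The pointwise estimate, with \<open>h\<close> the indicator of \<open>B\<close>, holds
  for almost all weights and is integrated over their law.\<close>

lemma (in prob_space) cycle_count_poisson_rate:
  assumes W: "random_variable borel W" "AE x in M. 0 < W x" "integrable M (\<lambda>x. W x ^ 4)"
    and less: "expectation (\<lambda>x. (W x)\<^sup>2) < expectation W"
  obtains C where "0 \<le> C" and "\<And>n A B. 1 \<le> n \<Longrightarrow> A \<subseteq> {3..} \<Longrightarrow>
    \<bar>measure (grg M W n) {G. cycle_count G A \<in> B}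
      - poisson_mean (\<lambda>m. of_bool (m \<in> B))
          (cycle_series A (expectation (\<lambda>x. (W x)\<^sup>2) / expectation W))\<bar> \<le> C / n"
proof -
  define D where "D = distr M borel W"
  interpret D: prob_space D unfolding D_def by (rule prob_space_distr[OF W(1)])
  have sD: "sets D = sets borel" by (simp add: D_def)
  \<comment> \<open>The fourth moment controls the first and second.\<close>
  have bound: "\<bar>x\<bar> \<le> 1 + x ^ 4" "x\<^sup>2 \<le> 1 + x ^ 4" for x :: real
  proof -
    have 1: "\<bar>z\<bar> \<le> 1 + z\<^sup>2" for z :: real
    proof -
      have "2 * \<bar>z\<bar> \<le> z\<^sup>2 + 1" using sum_squares_bound[of "\<bar>z\<bar>" 1] by simp
      then show ?thesis using zero_le_power2[of z] by linarith
    qed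
    have x4: "(x\<^sup>2)\<^sup>2 = x ^ 4" by simp
    show "x\<^sup>2 \<le> 1 + x ^ 4" using 1[of "x\<^sup>2"] unfolding x4 by simp
    show "\<bar>x\<bar> \<le> 1 + x ^ 4"
    proof (cases "\<bar>x\<bar> \<le> 1")
      case True
      then show ?thesis using zero_le_power2[of "x\<^sup>2"] unfolding x4 by linarith
    next
      case False
      then have "\<bar>x\<bar> ^ 1 \<le> \<bar>x\<bar> ^ 4" by (intro power_increasing) auto
      then show ?thesis by simp
    qed
  qed
  have int4: "integrable D (\<lambda>x. x ^ 4)"
    unfolding D_def using W by (subst integrable_distr_eq) auto
  have int2: "integrable D (\<lambda>x. x\<^sup>2)"
    using bound(2) sD by (intro Bochner_Integration.integrable_bound[OF Bochner_Integration.integrable_add[OF D.integrable_const[of 1] int4]])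
      (auto simp: cong: measurable_cong_sets)
  have int1: "integrable D (\<lambda>x. x)"
    using bound(1) sD by (intro Bochner_Integration.integrable_bound[OF Bochner_Integration.integrable_add[OF D.integrable_const[of 1] int4]])
      (auto simp: cong: measurable_cong_sets)
  define \<mu> where "\<mu> = D.expectation (\<lambda>x. x)"
  define m2 where "m2 = D.expectation (\<lambda>x. x\<^sup>2)"
  have \<mu>: "expectation W = \<mu>" and m2: "expectation (\<lambda>x. (W x)\<^sup>2) = m2"
    unfolding \<mu>_def m2_def D_def using W(1) by (simp_all add: integral_distr)
  have m: "0 \<le> m2" "m2 < \<mu>" using less unfolding \<mu> m2 by (simp_all add: m2_def)
  then have \<mu>0: "0 < \<mu>" by linarith
  define m4 where "m4 = D.expectation (\<lambda>x. x ^ 4)"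
  define v1 where "v1 = D.expectation (\<lambda>x. (x - \<mu>)\<^sup>2)"
  define v2 where "v2 = D.expectation (\<lambda>x. (x\<^sup>2 - m2)\<^sup>2)"
  have int_v1: "integrable D (\<lambda>x. (x - \<mu>)\<^sup>2)"
    unfolding power2_diff using int1 int2 by simp
  have int_v2: "integrable D (\<lambda>x. (x\<^sup>2 - m2)\<^sup>2)"
    unfolding power2_diff using int2 int4 by simp
  have centered: "integrable D (\<lambda>x. x - \<mu>)" "D.expectation (\<lambda>x. x - \<mu>) = 0"
    "integrable D (\<lambda>x. x\<^sup>2 - m2)" "D.expectation (\<lambda>x. x\<^sup>2 - m2) = 0"
    using int1 int2 by (simp_all add: \<mu>_def m2_def D.prob_space)
  have pos: "AE x in D. 0 < x"
    unfolding D_def using W by (subst AE_distr_iff) auto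
  have moments0: "0 \<le> m4" "0 \<le> v1" "0 \<le> v2" by (simp_all add: m4_def v1_def v2_def)
  obtain K where K: "0 \<le> K"
    "\<And>n w A h. positive_weights n w \<Longrightarrow> A \<subseteq> {3..} \<Longrightarrow> (\<And>m. \<bar>h m\<bar> \<le> 1) \<Longrightarrow>
      \<bar>subset_mean (vertex_pairs n) (edge_prob n w) (\<lambda>G. h (cycle_count G A))
        - poisson_mean h (cycle_series A (m2 / \<mu>))
        - poisson_mean (shift_diff h) (cycle_series A (m2 / \<mu>)) * cycle_series_deriv A (m2 / \<mu>) / (real n * \<mu>)
          * (positive_weights.S n w - m2 / \<mu> * positive_weights.L n w)\<bar>
      \<le> K * positive_weights.deviation n w \<mu> m2"
    using cycle_count_approx[OF m] by metis
  show thesis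
  proof (rule that[of "K * (m4 + v2 + v1)"])
    show "0 \<le> K * (m4 + v2 + v1)" using K moments0 by simp
    fix n :: nat and A B :: "nat set"
    assume n: "1 \<le> n" and A: "A \<subseteq> {3..}"
    define N where "N = (\<Pi>\<^sub>M i\<in>{1..n}. D)"
    interpret N: prob_space N unfolding N_def by (rule prob_space_PiM) (rule D.prob_space_axioms)
    define h where "h = (\<lambda>m. of_bool (m \<in> B) :: real)"
    define \<kappa> where "\<kappa> = cycle_series A (m2 / \<mu>)"
    define a where "a = poisson_mean (shift_diff h) \<kappa> * cycle_series_deriv A (m2 / \<mu>) / (real n * \<mu>)"
    define f where "f = (\<lambda>w. measure_pmf.prob (grg_given_weights n w) {G. cycle_count G A \<in> B})"
    \<comment> \<open>Unlike in the locale, \<open>S\<close> and \<open>L\<close> are centred here,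
      so both have mean zero.\<close>
    define S where "S = (\<lambda>w :: nat \<Rightarrow> real. \<Sum>i=1..n. (w i)\<^sup>2 - m2)"
    define L where "L = (\<lambda>w :: nat \<Rightarrow> real. \<Sum>i=1..n. w i - \<mu>)"
    define T where "T = (\<lambda>w :: nat \<Rightarrow> real. \<Sum>i=1..n. w i ^ 4)"
    note sums = integral_sum_components[OF D.prob_space_axioms, of _ n, folded N_def]
    note squares = integral_square_sum_components[OF D.prob_space_axioms, of _ n, folded N_def]
    have fm: "f \<in> borel_measurable N"
      unfolding f_def N_def by (rule prob_grg_given_weights_measurable[OF sD])
    have fint: "integrable N f"
      using fm by (intro N.integrable_const_bound[of _ 1]) (auto simp: f_def)
    have Sint: "integrable N S" "N.expectation S = 0"
      using sums[OF centered(3)] centered(4) by (simp_all add: S_def)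
    have Lint: "integrable N L" "N.expectation L = 0"
      using sums[OF centered(1)] centered(2) by (simp_all add: L_def)
    have Tint: "integrable N T" "N.expectation T = n * m4"
      using sums[OF int4] by (simp_all add: T_def m4_def)
    have S2int: "integrable N (\<lambda>w. (S w)\<^sup>2)" "N.expectation (\<lambda>w. (S w)\<^sup>2) = n * v2"
      using squares[OF centered(3,4) int_v2] by (simp_all add: S_def v2_def)
    have L2int: "integrable N (\<lambda>w. (L w)\<^sup>2)" "N.expectation (\<lambda>w. (L w)\<^sup>2) = n * v1"
      using squares[OF centered(1,2) int_v1] by (simp_all add: L_def v1_def)
    let ?g = "\<lambda>w. f w - poisson_mean h \<kappa> - a * (S w - m2 / \<mu> * L w)"
    let ?b = "\<lambda>w. K * ((T w + (S w)\<^sup>2 + (L w)\<^sup>2) / (real n)\<^sup>2)"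
    have "AE w in N. \<forall>i\<in>{1..n}. 0 < w i"
    proof (rule AE_finite_allI)
      fix i assume "i \<in> {1..n}"
      then show "AE w in N. 0 < w i"
        unfolding N_def using pos D.prob_space_axioms by (intro AE_PiM_component) auto
    qed simp
    then have AE: "AE w in N. norm (?g w) \<le> ?b w"
    proof eventually_elim
      fix w :: "nat \<Rightarrow> real" assume "\<forall>i\<in>{1..n}. 0 < w i"
      then interpret w: positive_weights n w using n by unfold_locales auto
      have S: "w.S = S w + n * m2" by (simp add: w.S_def S_def sum_subtractf)
      have L: "w.L = L w + n * \<mu>" by (simp add: w.L_def L_def sum_subtractf)
      have "w.S - m2 / \<mu> * w.L = S w - m2 / \<mu> * L w"
        unfolding S L using \<mu>0 by (simp add: field_simps)
      moreover have "w.deviation \<mu> m2 = (T w + (S w)\<^sup>2 + (L w)\<^sup>2) / (real n)\<^sup>2"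
        unfolding w.deviation_def S L by (simp add: w.T_def T_def)
      ultimately show "norm (?g w) \<le> ?b w"
        using K(2)[OF w.positive_weights_axioms A, of h]
        unfolding f_def w.prob_cycle_count a_def \<kappa>_def by (simp add: h_def)
    qed
    have gint: "integrable N ?g" using fint Sint Lint by simp
    have bint: "integrable N ?b" using Tint S2int L2int by simp
    \<comment> \<open>Subtracting the linear term does not change the expectation, which is the
      point of carrying it along.\<close>
    have 1: "N.expectation f - poisson_mean h \<kappa> = N.expectation ?g"
      using fint Sint Lint by (simp add: N.prob_space)
    have 2: "\<bar>N.expectation ?g\<bar> \<le> N.expectation (\<lambda>w. norm (?g w))"
      using integral_norm_bound[of N ?g] by (simp only: real_norm_def)
    have 3: "N.expectation (\<lambda>w. norm (?g w)) \<le> N.expectation ?b"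
      by (rule integral_mono_AE[OF integrable_norm[OF gint] bint AE])
    have "N.expectation ?b = K * ((n * m4 + n * v2 + n * v1) / (real n)\<^sup>2)"
      using Tint S2int L2int by simp
    also have "\<dots> = K * (m4 + v2 + v1) / n"
      using n by (simp add: power2_eq_square field_simps)
    finally have 4: "N.expectation ?b = K * (m4 + v2 + v1) / n" .
    have "\<bar>N.expectation f - poisson_mean h \<kappa>\<bar> \<le> K * (m4 + v2 + v1) / n"
      using order_trans[OF 2 3] unfolding 1 4 .
    then show "\<bar>measure (grg M W n) {G. cycle_count G A \<in> B}
        - poisson_mean (\<lambda>m. of_bool (m \<in> B))
            (cycle_series A (expectation (\<lambda>x. (W x)\<^sup>2) / expectation W))\<bar>
      \<le> K * (m4 + v2 + v1) / n"
      unfolding measure_grg(2)[OF W(1)] \<mu> m2 f_def N_def D_def h_def \<kappa>_def .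
  qed
qed

theorem theorem2p4:
  fixes M :: "'a measure" and W :: "'a \<Rightarrow> real"
    and P :: "'o measure" and \<eta> :: "'o \<Rightarrow> nat measure"
  assumes "prob_space M"
    and "W \<in> borel_measurable M"
    and "AE x in M. 0 < W x"
    and "integrable M (\<lambda>x. W x ^ 4)"
    and "(\<integral>x. (W x)\<^sup>2 \<partial>M) < (\<integral>x. W x \<partial>M)"
    and "poisson_point_process P (cycle_intensity M W) \<eta>"
  shows "\<exists>C>0. \<forall>n\<ge>3. \<forall>A\<subseteq>{3..}.
           dTV (grg M W n) (\<lambda>G. of_nat (cycle_count G A)) P (\<lambda>\<omega>. emeasure (\<eta> \<omega>) A)
             \<le> C * ln (real n) ^ 3 / real n"
proof -
  interpret prob_space M by (rule assms(1))
  define r where "r = expectation (\<lambda>x. (W x)\<^sup>2) / expectation W"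
  have m2: "0 \<le> expectation (\<lambda>x. (W x)\<^sup>2)" by simp
  with assms(5) have "0 < expectation W" by linarith
  with m2 assms(5) have r: "0 \<le> r" "r < 1"
    unfolding r_def by (simp_all only: divide_nonneg_pos divide_less_eq_1_pos)
  obtain C where C: "0 \<le> C" "\<And>n A B. 1 \<le> n \<Longrightarrow> A \<subseteq> {3..} \<Longrightarrow>
    \<bar>measure (grg M W n) {G. cycle_count G A \<in> B}
      - poisson_mean (\<lambda>m. of_bool (m \<in> B)) (cycle_series A r)\<bar> \<le> C / real n"
    using cycle_count_poisson_rate[OF assms(2-5)] unfolding r_def by metis
  have "dTV (grg M W n) (\<lambda>G. of_nat (cycle_count G A)) P (\<lambda>\<omega>. emeasure (\<eta> \<omega>) A)
        \<le> (C + 1) * ln (real n) ^ 3 / real n" if n: "3 \<le> n" and A: "A \<subseteq> {3..}" for n A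
  proof -
    have ser: "0 \<le> cycle_series A r"
      using A r by (intro cycle_series_estimates(2)[of A r r r]) auto
    have em: "emeasure (cycle_intensity M W) A = ennreal (cycle_series A r)"
      using A r r_def by (rule emeasure_cycle_intensity)
    have sets: "A \<in> sets (cycle_intensity M W)"
      using A by (simp add: cycle_intensity_def sets_point_measure)
    \<comment> \<open>From \<open>n \<ge> 3 \<ge> exp 1\<close> the logarithmic factor is at least
      \<open>1\<close>, so the bound \<open>C / n\<close> implies the stated one;
      \<open>C + 1\<close> makes the constant positive.\<close>
    have ln: "1 \<le> ln (real n) ^ 3"
    proof -
      have "3 \<le> real n" using n by simp
      then have "exp 1 \<le> real n" using exp_le by linarith
      then have "1 \<le> ln (real n)" using n by (simp add: ln_ge_iff)
      then show ?thesis by (rule one_le_power)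
    qed
    have "C * 1 \<le> (C + 1) * ln (real n) ^ 3" using C(1) ln by (intro mult_mono) auto
    then have le: "C / real n \<le> (C + 1) * ln (real n) ^ 3 / real n"
      by (intro divide_right_mono) auto
    show ?thesis unfolding dTV_def
    proof (rule cSUP_least)
      fix B :: "nat set"
      \<comment> \<open>The space of \<open>grg\<close> is \<open>UNIV\<close>, and
        \<open>of_nat\<close> is injective into \<open>ennreal\<close>.\<close>
      have 1: "{G \<in> space (grg M W n). (of_nat (cycle_count G A) :: ennreal) \<in> of_nat ` B}
               = {G. cycle_count G A \<in> B}"
        using measure_grg(1)[OF assms(2), of n] by auto
      have 2: "measure P {\<omega> \<in> space P. emeasure (\<eta> \<omega>) A \<in> of_nat ` B}
               = poisson_mean (\<lambda>m. of_bool (m \<in> B)) (cycle_series A r)"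
        using poisson_point_process_prob[OF assms(6) sets] em ser by (simp add: measure_def)
      show "\<bar>measure (grg M W n)
            {G \<in> space (grg M W n). (of_nat (cycle_count G A) :: ennreal) \<in> of_nat ` B}
          - measure P {\<omega> \<in> space P. emeasure (\<eta> \<omega>) A \<in> of_nat ` B}\<bar>
          \<le> (C + 1) * ln (real n) ^ 3 / real n"
        unfolding 1 2 using C(2)[of n A B] n A le by auto
    qed simp
  qed
  then show ?thesis using C(1) by (intro exI[of _ "C + 1"]) auto
qed

end
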